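(* Let $F\subset\mathrm{Sym}^2(\mathbb R^n)$ be an ST-invariant cone subequation with finite Riesz characteristic $p$, and write $K=K_p$. Let $u$ be $F$-subharmonic in a neighborhood of the origin in $\mathbb R^n$. Then $$\frac{M(u,r)-M(u,s)}{K(r)-K(s)}$$ is increasing (i.e. non-decreasing) in $r$ and in $s$, for all $0<s<r$ for which $M$ is defined. Furthermore, if $F$ is convex, the same statement holds with $M(u,\cdot)$ replaced by either $S(u,\cdot)$ or $V(u,\cdot)$.
   Context: Fix $n\ge 2$. $\mathrm{Sym}^2(\mathbb R^n)$ is the space of real symmetric $n\times n$ matrices and $\mathcal P=\{A: A\ge 0\}$. A subequation is a nonempty proper closed subset $F\subset \mathrm{Sym}^2(\mathbb R^n)$ with $F+\mathcal P\subset F$. It is a cone if $tF\subset F$ for all $t\ge 0$. It is ST-invariant if there is a subgroup $G\subset O(n)$ acting transitively on $S^{n-1}$ such that $F$ is invariant under $A\mapsto gAg^t$ for all $g\in G$. For a unit vector $e$, $P_e$ and $P_{e^\perp}=I-P_e$ are the orthogonal projections onto $\mathbb R e$ and $e^\perp$. The Riesz characteristic is $p_F=\sup\{\bar p: P_{e^\perp}-(\bar p-1)P_e\in F\}\in[1,\infty]$ (independent of $e$). The Riesz kernel is $K_p(t)=t^{2-p}$ if $1\le p<2$, $K_2(t)=\log t$, $K_p(t)=-t^{2-p}$ if $2<p<\infty$. An upper semi-continuous $u:X\to[-\infty,\infty)$ on an open set $X$, not identically $-\infty$ on any connected component of $X$, is $F$-subharmonic if whenever $\varphi$ is $C^2$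 near $x_0\in X$ with $u\le\varphi$ near $x_0$ and equality at $x_0$, one has $D^2\varphi(x_0)\in F$. For $r>0$ with the closed ball $\{|x|\le r\}$ contained in the domain of $u$: $M(u,r)=\sup_{|x|\le r}u(x)$, $S(u,r)=\frac1{|S|}\int_S u(r\sigma)\,d\sigma$, $V(u,r)=\frac1{|B|}\int_B u(rx)\,dx$, where $B=\{|x|\le1\}$, $S=\partial B$. *)

theory Defs
  imports "HOL-Analysis.Analysis"
begin

definition Sym2 :: "(real^'n^'n) set" where
  "Sym2 = {A. transpose A = A}"

definition psd_cone :: "(real^'n^'n) set" where
  "psd_cone = {A \<in> Sym2. \<forall>x. 0 \<le> x \<bullet> (A *v x)}"

definition subequation :: "(real^'n^'n) set \<Rightarrow> bool" where
  "subequation F \<longleftrightarrow> F \<noteq> {} \<and> F \<subset> Sym2 \<and> closed F \<and> (\<forall>A\<in>F. \<forall>P\<in>psd_cone. A + P \<in> F)"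

definition cone_subequation :: "(real^'n^'n) set \<Rightarrow> bool" where
  "cone_subequation F \<longleftrightarrow> subequation F \<and> (\<forall>t\<ge>0. \<forall>A\<in>F. t *\<^sub>R A \<in> F)"

definition orthogonal_subgroup :: "(real^'n^'n) set \<Rightarrow> bool" where
  "orthogonal_subgroup G \<longleftrightarrow> G \<subseteq> {g. orthogonal_matrix g} \<and> mat 1 \<in> G \<and>
     (\<forall>g\<in>G. \<forall>h\<in>G. g ** h \<in> G) \<and> (\<forall>g\<in>G. matrix_inv g \<in> G)"

definition ST_invariant :: "(real^'n^'n) set \<Rightarrow> bool" where
  "ST_invariant F \<longleftrightarrow> (\<exists>G. orthogonal_subgroup G \<and>
     (\<forall>x\<in>sphere 0 1. \<forall>y\<in>sphere 0 1. \<exists>g\<in>G. g *v x = y) \<and>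
     (\<forall>g\<in>G. \<forall>A\<in>F. g ** A ** transpose g \<in> F))"

definition proj_line :: "real^'n \<Rightarrow> real^'n^'n" where
  "proj_line e = (\<chi> i j. e $ i * e $ j)"

definition proj_perp :: "real^'n \<Rightarrow> real^'n^'n" where
  "proj_perp e = mat 1 - proj_line e"

text \<open>The value depends on the unit vector \<open>e\<close> for a general \<open>F\<close>, but not for an
  ST-invariant one.\<close>

definition riesz_characteristic :: "(real^'n^'n) set \<Rightarrow> real^'n \<Rightarrow> ereal" where
  "riesz_characteristic F e = Sup {ereal q | q. proj_perp e - (q - 1) *\<^sub>R proj_line e \<in> F}"

text \<open>Only used for \<open>p \<ge> 1\<close> and \<open>t > 0\<close>.\<close>

definition riesz_kernel :: "real \<Rightarrow> real \<Rightarrow> real" where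
  "riesz_kernel p t = (if p < 2 then t powr (2 - p) else if p = 2 then ln t else - (t powr (2 - p)))"

text \<open>\<open>\<phi>\<close> is twice continuously differentiable on the open set \<open>U\<close> with gradient \<open>D\<close> and
  Hessian matrix \<open>H\<close>.\<close>

definition C2_on :: "(real^'n) set \<Rightarrow> (real^'n \<Rightarrow> real) \<Rightarrow> (real^'n \<Rightarrow> real^'n) \<Rightarrow> (real^'n \<Rightarrow> real^'n^'n) \<Rightarrow> bool" where
  "C2_on U \<phi> D H \<longleftrightarrow> open U \<and> continuous_on U H \<and>
     (\<forall>x\<in>U. (\<phi> has_derivative (\<lambda>h. D x \<bullet> h)) (at x) \<and> (D has_derivative (\<lambda>h. H x *v h)) (at x))"

definition usc_on :: "'a::topological_space set \<Rightarrow> ('a \<Rightarrow> ereal) \<Rightarrow> bool" where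
  "usc_on X u \<longleftrightarrow> (\<forall>x\<in>X. \<forall>c. u x < c \<longrightarrow> (\<forall>\<^sub>F y in at x within X. u y < c))"

text \<open>Functions with values in \<open>[-\<infinity>, \<infinity>)\<close> are encoded as \<^typ>\<open>ereal\<close>-valued functions on the
  whole space that are \<open>< \<infinity>\<close> on \<open>X\<close>; values outside \<open>X\<close> are irrelevant.\<close>

definition subharmonic :: "(real^'n^'n) set \<Rightarrow> (real^'n) set \<Rightarrow> (real^'n \<Rightarrow> ereal) \<Rightarrow> bool" where
  "subharmonic F X u \<longleftrightarrow> open X \<and> (\<forall>x\<in>X. u x < \<infinity>) \<and> usc_on X u \<and>
     (\<forall>C\<in>components X. \<exists>x\<in>C. u x \<noteq> -\<infinity>) \<and>
     (\<forall>x0\<in>X. \<forall>U \<phi> D H. x0 \<in> U \<and> C2_on U \<phi> D H \<and>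
        (\<forall>\<^sub>F x in nhds x0. u x \<le> ereal (\<phi> x)) \<and> u x0 = ereal (\<phi> x0) \<longrightarrow> H x0 \<in> F)"

text \<open>Surface measure on the unit sphere, as in the polar coordinate formula:
  \<open>\<sigma>(A) = n \<cdot> |{t\<omega> : \<omega> \<in> A, 0 < t \<le> 1}|\<close>.\<close>

definition sphere_measure :: "(real^'n) measure" where
  "sphere_measure = scale_measure (of_nat CARD('n))
     (distr (restrict_space lborel (cball 0 1 - {0})) (restrict_space borel (sphere 0 1)) sgn)"

lemma emeasure_sphere_measure:
  fixes A :: "(real^'n) set"
  assumes "A \<in> sets (restrict_space borel (sphere 0 1))"
  shows "emeasure sphere_measure A = of_nat CARD('n) * emeasure lborel {x \<in> cball 0 1 - {0}. sgn x \<in> A}"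
proof -
  have "cball 0 1 - {0::real^'n} \<in> sets borel" by auto
  moreover have "sgn \<in> measurable (restrict_space borel (cball 0 1 - {0::real^'n})) (restrict_space borel (sphere 0 1))"
    by (intro measurable_restrict_space3) (auto simp: norm_sgn)
  then have "(sgn::real^'n \<Rightarrow> real^'n) \<in> measurable (restrict_space lborel (cball 0 1 - {0})) (restrict_space borel (sphere 0 1))"
    by (subst measurable_cong_sets[OF _ refl]) (auto cong: sets_restrict_space_cong)
  ultimately show ?thesis
    using assms
    by (auto simp: sphere_measure_def emeasure_scale_measure emeasure_distr space_restrict_space
        emeasure_restrict_space intro!: arg_cong2[where f = "(*)"] arg_cong[where f = "emeasure lborel"])
qed

text \<open>Lebesgue integral of an extended real function, positive part minus negative part. It is
  meaningful as soon as the function is bounded above and the measure is finite, and may then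
  be \<open>-\<infinity>\<close>.\<close>

definition ereal_integral :: "'a measure \<Rightarrow> ('a \<Rightarrow> ereal) \<Rightarrow> ereal" where
  "ereal_integral N f =
     enn2ereal (\<integral>\<^sup>+x. e2ennreal (f x) \<partial>N) - enn2ereal (\<integral>\<^sup>+x. e2ennreal (- f x) \<partial>N)"

definition mean_value :: "'a measure \<Rightarrow> ('a \<Rightarrow> ereal) \<Rightarrow> ereal" where
  "mean_value N f = ereal_integral N f / ereal (measure N (space N))"

definition max_ball :: "(real^'n \<Rightarrow> ereal) \<Rightarrow> real \<Rightarrow> ereal" where
  "max_ball u r = (SUP x\<in>cball 0 r. u x)"

definition mean_sphere :: "(real^'n \<Rightarrow> ereal) \<Rightarrow> real \<Rightarrow> ereal" where
  "mean_sphere u r = mean_value sphere_measure (\<lambda>\<sigma>. u (r *\<^sub>R \<sigma>))"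

definition mean_ball :: "(real^'n \<Rightarrow> ereal) \<Rightarrow> real \<Rightarrow> ereal" where
  "mean_ball u r = mean_value (restrict_space lborel (cball 0 1)) (\<lambda>x. u (r *\<^sub>R x))"

definition diff_quotient :: "(real \<Rightarrow> ereal) \<Rightarrow> (real \<Rightarrow> real) \<Rightarrow> real \<Rightarrow> real \<Rightarrow> ereal" where
  "diff_quotient \<Phi> K r s = (\<Phi> r - \<Phi> s) / ereal (K r - K s)"

text \<open>\<open>R\<close> is the set of admissible radii. Finiteness of \<open>\<Phi>\<close> on \<open>R\<close> makes the difference
  quotients genuine real numbers, so that no convention about \<open>-\<infinity> - (-\<infinity>)\<close> is involved.\<close>

definition increasing_diff_quotients :: "real set \<Rightarrow> (real \<Rightarrow> ereal) \<Rightarrow> (real \<Rightarrow> real) \<Rightarrow> bool" where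
  "increasing_diff_quotients R \<Phi> K \<longleftrightarrow>
     (\<forall>r\<in>R. \<bar>\<Phi> r\<bar> \<noteq> \<infinity>) \<and>
     (\<forall>s\<in>R. \<forall>r\<in>R. \<forall>r'\<in>R. s < r \<and> r \<le> r' \<longrightarrow> diff_quotient \<Phi> K r s \<le> diff_quotient \<Phi> K r' s) \<and>
     (\<forall>s\<in>R. \<forall>s'\<in>R. \<forall>r\<in>R. s \<le> s' \<and> s' < r \<longrightarrow> diff_quotient \<Phi> K r s \<le> diff_quotient \<Phi> K r s')"

end

theory Submission
  imports Defs
begin

text \<open>
  The Hessian of \<open>K(|x|)\<close>, with \<open>K\<close> the Riesz kernel, is a positive multiple of
  \<open>P\<^sub>\<bottom> - (p - 1) P\<^sub>e\<close>, where \<open>e = x / |x|\<close> and \<open>P\<^sub>\<bottom>\<close> is the projection onto the complement of \<open>e\<close>.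
  By the definition of \<open>p\<close> this matrix leaves \<open>F\<close> as soon as any positive multiple of the identity
  is subtracted. Hence \<open>\<alpha> + \<beta> K(|x|) - \<delta> |x|\<^sup>2\<close> with \<open>\<beta> \<ge> 0\<close> and \<open>\<delta> > 0\<close> never touches an
  \<open>F\<close>-subharmonic function from above, and \<open>\<delta> \<rightarrow> 0\<close> yields comparison with \<open>\<alpha> + \<beta> K\<close> on every annulus
  (\<open>three_spheres_comparison\<close>). For the suprema over balls this says that \<open>M(u, r)\<close> is a convex
  function of \<open>K(r)\<close>, and convex functions have monotone difference quotients. The same barriers,
  with boundary values tending to \<open>-\<infinity>\<close>, show that \<open>M(u, r)\<close> is finite.

  For convex \<open>F\<close>, averages of \<open>F\<close>-subharmonic functions are \<open>F\<close>-subharmonic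
  (\<open>average_subsolution\<close>). By compactness, finitely many \<open>g\<^sub>1, \<dots>, g\<^sub>m\<close> in the transitive group suffice
  to move every point approximately to every other point of its sphere, so iterates of
  \<open>f \<mapsto> (1/m) \<Sum> f \<circ> g\<^sub>j\<close> make a continuous function nearly constant on all spheres in a given ball. Applied to
  \<open>u\<close> and to a continuous \<open>\<xi> \<ge> u\<close>, such an iterate turns the three-spheres comparison into a pointwise
  inequality along rays. Integrated against a rotation invariant measure, which does not
  see the averaging, it says that the mean of \<open>u\<close> is convex in \<open>K\<close> after \<open>\<xi>\<close> has decreased to \<open>u\<close>.
  Since \<open>K(cr)\<close> is an increasing affine function of \<open>K(r)\<close>, measures on the sphere and on the ball are
  treated alike: neither Haar measure nor polar coordinates are involved.

  A symmetric \<open>H\<close> outside the convex cone \<open>F\<close> is separated from it by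
  \<open>A = \<Sum> v\<^sub>k v\<^sub>k\<^sup>T\<close>. Let \<open>T\<^sub>h \<phi>\<close> average \<open>\<phi>(x \<plusminus> h v\<^sub>k)\<close> over \<open>k\<close> and the signs. A parabolic
  maximum principle in \<open>(h, x)\<close> gives \<open>u \<le> T\<^sub>h \<phi> + O(h\<^sup>2 \<omega>(h))\<close> whenever \<open>u \<le> \<phi>\<close>, where \<open>\<omega>\<close> is a modulus of
  continuity of \<open>D\<^sup>2\<phi>\<close>. Iterating \<open>j\<close> times with \<open>h\<^sup>2 = t / j\<close>, the error vanishes as \<open>j \<rightarrow> \<infinity>\<close>. The resulting
  inequality is linear in \<open>(u, \<phi>)\<close> and so passes to averages \<open>v\<close>. If a function with Hessian \<open>H\<close>
  touched \<open>v\<close> from above at \<open>x\<^sub>0\<close>, then moments of the walk would give \<open>v(x\<^sub>0) \<le> v(x\<^sub>0) + t \<beta> + O(t\<^sup>2)\<close> with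
  \<open>\<beta> < 0\<close>. Global functions are needed for this; \<open>u\<close> is replaced by its maximum with a steep paraboloid
  that is at least \<open>u\<close> near the edge of a slightly larger ball and, as it gets steeper, tends to \<open>-\<infinity>\<close> on the
  ball considered.
\<close>

section \<open>Rank-one matrices and the calculus of \<open>C\<^sup>2\<close> functions\<close>

definition outer :: "real^'n \<Rightarrow> real^'n \<Rightarrow> real^'n^'n" where
  "outer a b = (\<chi> i j. a $ i * b $ j)"

lemma outer_mult_vec: "outer a b *v h = (b \<bullet> h) *\<^sub>R a"
  by (simp add: outer_def vec_eq_iff matrix_vector_mult_def inner_vec_def sum_distrib_left algebra_simps)

lemma inner_outer: "outer v v \<bullet> B = v \<bullet> (B *v v)"
  by (simp add: outer_def inner_vec_def matrix_vector_mult_def sum_distrib_left algebra_simps)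

lemma proj_line_eq_outer: "proj_line e = outer e e"
  by (simp add: proj_line_def outer_def)

lemma continuous_on_matrixI:
  fixes f :: "'a::topological_space \<Rightarrow> real^'n^'m"
  assumes "\<And>i j. continuous_on S (\<lambda>x. f x $ i $ j)"
  shows "continuous_on S f"
proof -
  have "continuous_on S (\<lambda>x. \<chi> i j. f x $ i $ j)"
    by (intro continuous_on_vec_lambda assms)
  then show ?thesis by simp
qed

lemma continuous_on_outer [continuous_intros]:
  "continuous_on S f \<Longrightarrow> continuous_on S g \<Longrightarrow> continuous_on S (\<lambda>x. outer (f x) (g x))"
  by (rule continuous_on_matrixI) (auto simp: outer_def intro!: continuous_intros)

lemma continuous_on_matrix_mult_const:
  fixes f :: "'a::topological_space \<Rightarrow> real^'n^'n"
  assumes "continuous_on S f"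
  shows "continuous_on S (\<lambda>x. A ** f x ** B)"
  by (rule continuous_on_matrixI)
     (auto simp: matrix_matrix_mult_def intro!: continuous_intros assms)

lemma Sym2_iff: "A \<in> Sym2 \<longleftrightarrow> (\<forall>i j. A $ i $ j = A $ j $ i)"
  by (auto simp: Sym2_def transpose_def vec_eq_iff)

lemma Sym2_add: "A \<in> Sym2 \<Longrightarrow> B \<in> Sym2 \<Longrightarrow> A + B \<in> Sym2"
  and Sym2_diff: "A \<in> Sym2 \<Longrightarrow> B \<in> Sym2 \<Longrightarrow> A - B \<in> Sym2"
  and Sym2_scaleR: "A \<in> Sym2 \<Longrightarrow> c *\<^sub>R A \<in> Sym2"
  and Sym2_0: "0 \<in> Sym2"
  and Sym2_mat: "mat c \<in> Sym2"
  and Sym2_outer: "outer a a \<in> Sym2"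
  and Sym2_outer2: "outer a b + outer b a \<in> Sym2"
  by (auto simp: Sym2_iff outer_def mat_def)

lemma Sym2_conj: "H \<in> Sym2 \<Longrightarrow> g ** H ** transpose g \<in> Sym2"
  by (auto simp: Sym2_def matrix_transpose_mul matrix_mul_assoc)

lemma Sym2_inner_commute: "H \<in> Sym2 \<Longrightarrow> x \<bullet> (H *v y) = y \<bullet> (H *v x)"
  by (metis (mono_tags, lifting) Sym2_def dot_lmul_matrix inner_commute mem_Collect_eq transpose_matrix_vector)

lemma norm_matrix_vector_mult: "norm (A *v x) \<le> norm (A::real^'n^'m) * norm x"
proof -
  have "(norm (A *v x))\<^sup>2 \<le> (norm A * norm x)\<^sup>2"
  proof -
    have "(norm (A *v x))\<^sup>2 = (\<Sum>i\<in>UNIV. (A $ i \<bullet> x)\<^sup>2)"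
      by (simp add: power2_norm_eq_inner) (simp add: matrix_vector_mult_def inner_vec_def power2_eq_square)
    also have "\<dots> \<le> (\<Sum>i\<in>UNIV. (norm (A $ i))\<^sup>2 * (norm x)\<^sup>2)"
      by (intro sum_mono) (metis Cauchy_Schwarz_ineq2 abs_le_square_iff abs_mult abs_norm_cancel power_mult_distrib)
    also have "\<dots> = (norm A * norm x)\<^sup>2"
      by (simp add: power_mult_distrib sum_distrib_right[symmetric] norm_vec_def L2_set_def sum_nonneg)
    finally show ?thesis .
  qed
  then show ?thesis
    by (rule power2_le_imp_le) simp
qed

lemma C2_onD:
  assumes "C2_on U \<phi> D H"
  shows "open U" "continuous_on U H" "\<And>x. x \<in> U \<Longrightarrow> (\<phi> has_derivative (\<lambda>h. D x \<bullet> h)) (at x)"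
    "\<And>x. x \<in> U \<Longrightarrow> (D has_derivative (\<lambda>h. H x *v h)) (at x)"
    "continuous_on U D" "continuous_on U \<phi>"
  using assms unfolding C2_on_def
  by (auto intro!: continuous_at_imp_continuous_on dest: has_derivative_continuous)

lemma C2_on_const: "open U \<Longrightarrow> C2_on U (\<lambda>x. c) (\<lambda>x. 0) (\<lambda>x. 0)"
  by (auto simp: C2_on_def)

lemma C2_on_linear: "open U \<Longrightarrow> C2_on U (\<lambda>x. a \<bullet> x) (\<lambda>x. a) (\<lambda>x. 0)"
  by (auto simp: C2_on_def intro!: derivative_eq_intros)

lemma C2_on_add:
  assumes "C2_on U f D H" "C2_on U g D' H'"
  shows "C2_on U (\<lambda>x. f x + g x) (\<lambda>x. D x + D' x) (\<lambda>x. H x + H' x)"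
  using assms unfolding C2_on_def
  by (auto intro!: derivative_eq_intros continuous_intros simp: inner_add_left matrix_vector_mult_add_rdistrib)

lemma C2_on_cmul:
  assumes "C2_on U f D H"
  shows "C2_on U (\<lambda>x. c * f x) (\<lambda>x. c *\<^sub>R D x) (\<lambda>x. c *\<^sub>R H x)"
  using assms unfolding C2_on_def
  by (auto intro!: derivative_eq_intros continuous_intros simp: scaleR_matrix_vector_assoc)

lemma C2_on_mult:
  assumes "C2_on U f D H" "C2_on U g D' H'"
  shows "C2_on U (\<lambda>x. f x * g x) (\<lambda>x. f x *\<^sub>R D' x + g x *\<^sub>R D x)
    (\<lambda>x. f x *\<^sub>R H' x + g x *\<^sub>R H x + (outer (D x) (D' x) + outer (D' x) (D x)))"
proof -
  note f = C2_onD[OF assms(1)] and g = C2_onD[OF assms(2)]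
  show ?thesis
    unfolding C2_on_def
    by (auto intro!: derivative_eq_intros continuous_intros f g
        simp: inner_add_left matrix_vector_mult_add_rdistrib outer_mult_vec scaleR_matrix_vector_assoc[symmetric]
          inner_commute algebra_simps)
qed

lemma C2_on_compose:
  assumes f: "C2_on U f D H"
    and k: "\<And>t. t \<in> f ` U \<Longrightarrow> (k has_field_derivative k' t) (at t)"
      "\<And>t. t \<in> f ` U \<Longrightarrow> (k' has_field_derivative k'' t) (at t)" "continuous_on (f ` U) k''"
  shows "C2_on U (\<lambda>x. k (f x)) (\<lambda>x. k' (f x) *\<^sub>R D x)
     (\<lambda>x. k' (f x) *\<^sub>R H x + k'' (f x) *\<^sub>R outer (D x) (D x))"
proof -
  note f = C2_onD[OF f]
  have k'_cont: "continuous_on (f ` U) k'"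
    using k(2) by (meson DERIV_isCont continuous_at_imp_continuous_on)
  have 1: "((\<lambda>x. k (f x)) has_derivative (\<lambda>h. k' (f x) * (D x \<bullet> h))) (at x)" if "x \<in> U" for x
    using has_derivative_compose[OF f(3)[OF that], of k "\<lambda>h. k' (f x) * h"] k(1)[of "f x"] that
    by (auto simp: has_field_derivative_def)
  have 2: "((\<lambda>x. k' (f x)) has_derivative (\<lambda>h. k'' (f x) * (D x \<bullet> h))) (at x)" if "x \<in> U" for x
    using has_derivative_compose[OF f(3)[OF that], of k' "\<lambda>h. k'' (f x) * h"] k(2)[of "f x"] that
    by (auto simp: has_field_derivative_def)
  show ?thesis
    unfolding C2_on_def
  proof (intro conjI ballI)
    show "continuous_on U (\<lambda>x. k' (f x) *\<^sub>R H x + k'' (f x) *\<^sub>R outer (D x) (D x))"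
      by (intro continuous_intros f continuous_on_compose2[OF k'_cont] continuous_on_compose2[OF k(3)]) auto
    show "((\<lambda>x. k' (f x) *\<^sub>R D x) has_derivative
            (*v) (k' (f x) *\<^sub>R H x + k'' (f x) *\<^sub>R outer (D x) (D x))) (at x)" if "x \<in> U" for x
      using 2[OF that] f(4)[OF that]
      by (auto intro!: derivative_eq_intros simp: matrix_vector_mult_add_rdistrib outer_mult_vec
          scaleR_matrix_vector_assoc[symmetric] algebra_simps)
    show "((\<lambda>x. k (f x)) has_derivative (\<bullet>) (k' (f x) *\<^sub>R D x)) (at x)" if "x \<in> U" for x
      using 1[OF that] by (simp add: inner_scaleR_left[abs_def])
  qed (rule f(1))
qed

lemma C2_on_norm_sq: "open U \<Longrightarrow> C2_on U (\<lambda>x::real^'n. x \<bullet> x) (\<lambda>x. 2 *\<^sub>R x) (\<lambda>x. 2 *\<^sub>R mat 1)"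
  unfolding C2_on_def
  by (auto intro!: derivative_eq_intros simp: scaleR_matrix_vector_assoc[symmetric] inner_commute)

lemma C2_on_shift:
  fixes a :: "real^'n"
  assumes "C2_on U f D H"
  shows "C2_on ((\<lambda>x. x - a) ` U) (\<lambda>x. f (x + a)) (\<lambda>x. D (x + a)) (\<lambda>x. H (x + a))"
proof -
  note f = C2_onD[OF assms]
  have o: "open ((\<lambda>x. x - a) ` U)"
    using f(1) by (rule open_translation_subtract)
  have d: "((\<lambda>x. x + a) has_derivative (\<lambda>h. h)) (at x)" for x
    by (auto intro!: derivative_eq_intros)
  show ?thesis
    unfolding C2_on_def using o
    apply (auto)
      apply (rule continuous_on_compose2[OF f(2)], auto intro!: continuous_intros)
     apply (rule has_derivative_compose[OF d, of f], simp add: f)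
    apply (rule has_derivative_compose[OF d, of D], simp add: f)
    done
qed

lemma C2_on_linear_image:
  fixes g :: "real^'n^'n"
  assumes "C2_on U f D H"
  shows "C2_on ((\<lambda>x. g *v x) -` U) (\<lambda>x. f (g *v x)) (\<lambda>x. transpose g *v D (g *v x))
     (\<lambda>x. transpose g ** H (g *v x) ** g)"
proof -
  note f = C2_onD[OF assms]
  have o: "open ((\<lambda>x. g *v x) -` U)"
    using f(1) by (intro open_vimage) (auto intro!: continuous_intros)
  have d: "((\<lambda>x. g *v x) has_derivative (\<lambda>h. g *v h)) (at x)" for x
    by (rule bounded_linear_imp_has_derivative) simp
  have 1: "((\<lambda>x. f (g *v x)) has_derivative (\<lambda>h. (transpose g *v D (g *v x)) \<bullet> h)) (at x)" if "g *v x \<in> U" for x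
  proof -
    have "((\<lambda>x. f (g *v x)) has_derivative (\<lambda>h. D (g *v x) \<bullet> (g *v h))) (at x)"
      by (rule has_derivative_compose[OF d, of f]) (simp add: f that)
    then show ?thesis by (simp add: dot_lmul_matrix[symmetric])
  qed
  have 2: "((\<lambda>x. transpose g *v D (g *v x)) has_derivative (\<lambda>h. (transpose g ** H (g *v x) ** g) *v h)) (at x)" if "g *v x \<in> U" for x
  proof -
    have "((\<lambda>x. D (g *v x)) has_derivative (\<lambda>h. H (g *v x) *v (g *v h))) (at x)"
      by (rule has_derivative_compose[OF d, of D]) (simp add: f that)
    then have "((\<lambda>x. transpose g *v D (g *v x)) has_derivative (\<lambda>h. transpose g *v (H (g *v x) *v (g *v h)))) (at x)"
      by (rule bounded_linear.has_derivative[OF matrix_vector_mul_bounded_linear])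
    then show ?thesis by (simp add: matrix_vector_mul_assoc matrix_mul_assoc)
  qed
  have 3: "continuous_on ((\<lambda>x. g *v x) -` U) (\<lambda>x. transpose g ** H (g *v x) ** g)"
    by (intro continuous_on_matrix_mult_const continuous_on_compose2[OF f(2)]) (auto intro!: continuous_intros)
  show ?thesis
    unfolding C2_on_def using o 1 2 3 by auto
qed

section \<open>Upper semicontinuity and viscosity subsolutions\<close>

text \<open>Otherwise the sets on which \<open>f\<close> lies below one of its own values cover \<open>K\<close>. Finitely many
  suffice, and the point of \<open>K\<close> with the largest of these finitely many values lies in none of them.\<close>

lemma upper_semicontinuous_attains_sup:
  fixes f :: "'a::topological_space \<Rightarrow> 'b::linorder"
  assumes K: "compact K" "K \<noteq> {}"
    and usc: "\<And>x c. x \<in> K \<Longrightarrow> f x < c \<Longrightarrow> \<forall>\<^sub>F y in at x within K. f y < c"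
  shows "\<exists>x\<in>K. \<forall>y\<in>K. f y \<le> f x"
proof (rule ccontr)
  assume "\<not> ?thesis"
  then have "\<forall>x\<in>K. \<exists>y\<in>K. f x < f y" by (meson not_less)
  then obtain g where g: "\<And>x. x \<in> K \<Longrightarrow> g x \<in> K \<and> f x < f (g x)" by metis
  have "\<exists>T. open T \<and> x \<in> T \<and> (\<forall>z\<in>T \<inter> K. f z < f (g x))" if "x \<in> K" for x
  proof -
    from usc[OF that conjunct2[OF g[OF that]]] obtain T where
      "open T" "x \<in> T" "\<forall>y\<in>T. y \<noteq> x \<longrightarrow> y \<in> K \<longrightarrow> f y < f (g x)"
      unfolding eventually_at_topological by auto
    with g[OF that] show ?thesis by (intro exI[of _ T]) auto
  qed
  then obtain T where T: "\<And>x. x \<in> K \<Longrightarrow> open (T x) \<and> x \<in> T x \<and> (\<forall>z\<in>T x \<inter> K. f z < f (g x))"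
    by metis
  from compactE_image[OF K(1), of K T] obtain C where C: "C \<subseteq> K" "finite C" "K \<subseteq> (\<Union>x\<in>C. T x)"
    using T by (metis UN_I subsetI)
  with K(2) have "C \<noteq> {}" by auto
  with C(2) have fin: "finite ((\<lambda>x. f (g x)) ` C)" "(\<lambda>x. f (g x)) ` C \<noteq> {}" by auto
  from Max_in[OF this] obtain x1 where x1: "x1 \<in> C" "f (g x1) = Max ((\<lambda>x. f (g x)) ` C)" by auto
  have "g x1 \<in> K" using x1 C g by auto
  then obtain x2 where x2: "x2 \<in> C" "g x1 \<in> T x2" using C by auto
  have "f (g x1) < f (g x2)" using T[of x2] x2 C \<open>g x1 \<in> K\<close> by auto
  moreover have "f (g x2) \<le> f (g x1)" using x1 x2 fin by simp
  ultimately show False by simp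
qed

lemma usc_on_subset: "usc_on X u \<Longrightarrow> K \<subseteq> X \<Longrightarrow> usc_on K u"
  unfolding usc_on_def by (meson at_le filter_leD subsetD)

lemma usc_on_attains_sup:
  assumes "usc_on K u" "compact K" "K \<noteq> {}"
  shows "\<exists>x\<in>K. \<forall>y\<in>K. u y \<le> u x"
  by (rule upper_semicontinuous_attains_sup) (use assms in \<open>auto simp: usc_on_def\<close>)

lemma usc_on_diff_continuous:
  fixes \<phi> :: "'a::topological_space \<Rightarrow> real"
  assumes u: "usc_on K u" and \<phi>: "continuous_on K \<phi>"
  shows "usc_on K (\<lambda>x. u x - ereal (\<phi> x))"
  unfolding usc_on_def
proof (intro ballI allI impI)
  fix x c assume x: "x \<in> K" and less: "u x - ereal (\<phi> x) < c"
  obtain c' where c': "u x - ereal (\<phi> x) < ereal c'" "ereal c' \<le> c"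
  proof -
    obtain z where z: "u x - ereal (\<phi> x) < z" "z < c" using less dense by blast
    then obtain r where "z = ereal r" by (cases z) auto
    with z that show ?thesis by (meson less_imp_le)
  qed
  have "u x < ereal (c' + \<phi> x)" using c' by (cases "u x") auto
  then obtain d where d: "u x < ereal d" "d < c' + \<phi> x"
    by (metis ereal_dense2 less_ereal.simps(1))
  have 1: "\<forall>\<^sub>F y in at x within K. u y < ereal d" using u x d unfolding usc_on_def by blast
  have "(\<phi> \<longlongrightarrow> \<phi> x) (at x within K)" using \<phi> x by (simp add: continuous_on)
  then have 2: "\<forall>\<^sub>F y in at x within K. d - c' < \<phi> y"
    using d by (intro order_tendstoD) auto
  show "\<forall>\<^sub>F y in at x within K. u y - ereal (\<phi> y) < c"
    using 1 2
  proof eventually_elim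
    case (elim y)
    then have "u y - ereal (\<phi> y) < ereal c'" by (cases "u y") auto
    with c' show ?case by simp
  qed
qed

text \<open>Only touching functions with symmetric Hessian are tested. The Hessian of a \<open>C\<^sup>2\<close> function is always
  symmetric, but asking for it here means that this need not be proved for the functions that touch an
  average of subsolutions.\<close>

definition subsolution :: "(real^'n^'n) set \<Rightarrow> (real^'n) set \<Rightarrow> (real^'n \<Rightarrow> ereal) \<Rightarrow> bool" where
  "subsolution F X u \<longleftrightarrow> open X \<and> (\<forall>x\<in>X. u x < \<infinity>) \<and> usc_on X u \<and>
     (\<forall>x0\<in>X. \<forall>U \<phi> D H. x0 \<in> U \<and> C2_on U \<phi> D H \<and> H x0 \<in> Sym2 \<and>
        (\<forall>\<^sub>F x in nhds x0. u x \<le> ereal (\<phi> x)) \<and> u x0 = ereal (\<phi> x0) \<longrightarrow> H x0 \<in> F)"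

lemma subharmonic_imp_subsolution: "subharmonic F X u \<Longrightarrow> subsolution F X u"
  unfolding subharmonic_def subsolution_def by blast

lemma subsolutionD:
  assumes "subsolution F X u"
  shows "open X" "\<And>x. x \<in> X \<Longrightarrow> u x < \<infinity>" "usc_on X u"
    "\<And>x0 U \<phi> D H. \<lbrakk>x0 \<in> X; x0 \<in> U; C2_on U \<phi> D H; H x0 \<in> Sym2;
      \<forall>\<^sub>F x in nhds x0. u x \<le> ereal (\<phi> x); u x0 = ereal (\<phi> x0)\<rbrakk> \<Longrightarrow> H x0 \<in> F"
  using assms unfolding subsolution_def by blast+

lemma eventually_nhds_translation:
  fixes z :: "'a::real_normed_vector"
  shows "(\<forall>\<^sub>F x in nhds (x0 + z). P x) \<longleftrightarrow> (\<forall>\<^sub>F x in nhds x0. P (x + z))"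
proof -
  have "nhds (x0 + z) = filtermap (\<lambda>x. x + z) (nhds x0)"
    using filtermap_nhds_shift[of "-z" x0] by simp
  then show ?thesis by (simp add: eventually_filtermap)
qed

lemma usc_on_compose:
  assumes u: "usc_on X u" and f: "continuous_on Y f" "f ` Y \<subseteq> X"
  shows "usc_on Y (\<lambda>x. u (f x))"
  unfolding usc_on_def
proof (intro ballI allI impI)
  fix x c assume x: "x \<in> Y" and c: "u (f x) < c"
  then have "\<forall>\<^sub>F y in at (f x) within X. u y < c"
    using u f unfolding usc_on_def by auto
  then obtain S where S: "open S" "f x \<in> S" "\<And>y. y \<in> S \<Longrightarrow> y \<noteq> f x \<Longrightarrow> y \<in> X \<Longrightarrow> u y < c"
    unfolding eventually_at_topological by auto
  have "\<forall>\<^sub>F y in at x within Y. f y \<in> S"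
    using f(1) x unfolding continuous_on by (intro topological_tendstoD[OF _ S(1,2)]) auto
  moreover have "\<forall>\<^sub>F y in at x within Y. y \<in> Y"
    by (simp add: eventually_at_filter)
  ultimately show "\<forall>\<^sub>F y in at x within Y. u (f y) < c"
  proof eventually_elim
    case (elim y)
    then show ?case using S f(2) c by (cases "f y = f x") auto
  qed
qed

lemma subsolution_translate:
  assumes u: "subsolution F X u"
  shows "subsolution F ((\<lambda>x. x - z) ` X) (\<lambda>x. u (x + z))"
  unfolding subsolution_def
proof (intro conjI ballI allI impI; (elim conjE)?)
  note u = subsolutionD[OF u]
  show "open ((\<lambda>x. x - z) ` X)" using u(1) by (rule open_translation_subtract)
  show "u (x + z) < \<infinity>" if "x \<in> (\<lambda>x. x - z) ` X" for x using that u(2) by auto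
  show "usc_on ((\<lambda>x. x - z) ` X) (\<lambda>x. u (x + z))"
    by (rule usc_on_compose[OF u(3)]) (auto intro!: continuous_intros)
  fix x0 U \<phi> D H
  assume x0: "x0 \<in> (\<lambda>x. x - z) ` X" "x0 \<in> U" and C2: "C2_on U \<phi> D H" and sym: "H x0 \<in> Sym2"
    and ev: "\<forall>\<^sub>F x in nhds x0. u (x + z) \<le> ereal (\<phi> x)" and eq: "u (x0 + z) = ereal (\<phi> x0)"
  have C2': "C2_on ((\<lambda>x. x - (-z)) ` U) (\<lambda>x. \<phi> (x + (-z))) (\<lambda>x. D (x + (-z))) (\<lambda>x. H (x + (-z)))"
    by (rule C2_on_shift[OF C2])
  have "H (x0 + z + (-z)) \<in> F"
    by (rule u(4)[OF _ _ C2']) (use x0 sym ev eq in \<open>auto simp: eventually_nhds_translation\<close>)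
  then show "H x0 \<in> F" by simp
qed

text \<open>At an interior point where \<open>u - \<phi>\<close> has a positive maximum a translate of \<open>\<phi>\<close> touches \<open>u\<close> from above,
  so its Hessian lies in \<open>F\<close>.\<close>

lemma strict_comparison:
  assumes u: "subsolution F X u" and K: "compact K" "K \<subseteq> X" "K \<subseteq> W"
    and C2: "C2_on W \<phi> D H"
    and strict: "\<And>x. x \<in> interior K \<Longrightarrow> H x \<in> Sym2 - F"
    and bd: "\<And>x. x \<in> K \<Longrightarrow> x \<notin> interior K \<Longrightarrow> u x \<le> ereal (\<phi> x)"
    and x: "x \<in> K"
  shows "u x \<le> ereal (\<phi> x)"
proof -
  note u = subsolutionD[OF u]
  have "usc_on K (\<lambda>x. u x - ereal (\<phi> x))"
    by (rule usc_on_diff_continuous) (use u(3) K C2_onD[OF C2] in \<open>auto intro: usc_on_subset continuous_on_subset\<close>)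
  from usc_on_attains_sup[OF this K(1)] x obtain x0 where x0: "x0 \<in> K"
    and max: "\<And>y. y \<in> K \<Longrightarrow> u y - ereal (\<phi> y) \<le> u x0 - ereal (\<phi> x0)" by blast
  have "u x0 \<le> ereal (\<phi> x0)"
  proof (rule ccontr)
    assume gt: "\<not> u x0 \<le> ereal (\<phi> x0)"
    then have int: "x0 \<in> interior K" using bd x0 by blast
    from gt u(2)[of x0] K x0 obtain c where c: "u x0 = ereal c" by (cases "u x0") auto
    have C2': "C2_on W (\<lambda>x. \<phi> x + (c - \<phi> x0)) (\<lambda>x. D x + 0) (\<lambda>x. H x + 0)"
      by (intro C2_on_add C2 C2_on_const C2_onD(1)[OF C2])
    have ev: "\<forall>\<^sub>F x in nhds x0. u x \<le> ereal (\<phi> x + (c - \<phi> x0))"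
      unfolding eventually_nhds
    proof (intro exI[of _ "interior K"] conjI ballI int)
      fix y assume "y \<in> interior K"
      then have "y \<in> K" using interior_subset by blast
      from max[OF this] show "u y \<le> ereal (\<phi> y + (c - \<phi> x0))"
        using c by (cases "u y") auto
    qed simp
    have "H x0 + 0 \<in> F"
      by (rule u(4)[OF _ _ C2' _ ev]) (use x0 K c strict[OF int] in auto)
    then show False using strict[OF int] by simp
  qed
  then have "u x0 - ereal (\<phi> x0) \<le> 0" by (cases "u x0") auto
  with max[OF x] have "u x - ereal (\<phi> x) \<le> 0" by simp
  then show ?thesis by (cases "u x") auto
qed

section \<open>The Riesz characteristic and radial barriers\<close>

text \<open>The part of the hypotheses that the barriers use. For an ST-invariant cone subequation the last
  assumption holds at every unit vector as soon as it holds at one.\<close>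

locale riesz_cone =
  fixes F :: "(real^'n^'n) set" and p :: real
  assumes cone: "cone_subequation F"
    and p_ge_1: "1 \<le> p"
    and riesz: "\<And>e q. norm e = 1 \<Longrightarrow> p < q \<Longrightarrow> proj_perp e - (q - 1) *\<^sub>R proj_line e \<notin> F"
begin

lemma F_closed: "closed F" and F_Sym2: "A \<in> F \<Longrightarrow> A \<in> Sym2"
  and F_add_psd: "A \<in> F \<Longrightarrow> P \<in> psd_cone \<Longrightarrow> A + P \<in> F"
  and F_scale: "A \<in> F \<Longrightarrow> 0 \<le> t \<Longrightarrow> t *\<^sub>R A \<in> F"
  using cone unfolding cone_subequation_def subequation_def by auto

lemma zero_in_F: "0 \<in> F"
proof -
  have "F \<noteq> {}" using cone unfolding cone_subequation_def subequation_def by auto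
  then obtain A where "A \<in> F" by auto
  from F_scale[OF this, of 0] show ?thesis by simp
qed

lemma psd_in_F: "P \<in> psd_cone \<Longrightarrow> P \<in> F"
  using F_add_psd[OF zero_in_F] by simp

end

lemma psd_outer: "outer v v \<in> psd_cone"
  by (auto simp: psd_cone_def Sym2_outer outer_mult_vec inner_commute)

lemma psd_scaleR: "P \<in> psd_cone \<Longrightarrow> 0 \<le> c \<Longrightarrow> c *\<^sub>R P \<in> psd_cone"
  by (auto simp: psd_cone_def Sym2_scaleR scaleR_matrix_vector_assoc[symmetric])

lemma psd_proj_perp:
  assumes "norm e = 1"
  shows "proj_perp e \<in> psd_cone"
proof -
  have "(e \<bullet> x) * (e \<bullet> x) \<le> x \<bullet> x" for x
    using Cauchy_Schwarz_ineq[of e x] assms by (simp add: norm_eq_1 power2_eq_square)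
  then show ?thesis
    by (auto simp: psd_cone_def proj_perp_def proj_line_eq_outer Sym2_diff Sym2_mat Sym2_outer
        matrix_vector_mult_diff_rdistrib outer_mult_vec inner_diff_right inner_commute)
qed

text \<open>The matrix is \<open>(b - d) I - b p P\<^sub>e\<close>. For \<open>d < b\<close> it is a positive multiple of \<open>P\<^sub>\<bottom> - (q - 1) P\<^sub>e\<close>
  with \<open>q = b p / (b - d) > p\<close>. For \<open>b \<le> d\<close>, adding a nonnegative multiple of \<open>P\<^sub>\<bottom>\<close> leaves a negative multiple
  of \<open>P\<^sub>e\<close>, and a cone subequation containing it would contain \<open>P\<^sub>\<bottom> - (q - 1) P\<^sub>e\<close> for all \<open>q > 1\<close>.\<close>

lemma (in riesz_cone) barrier_hessian_not_in_F:
  assumes x: "x \<noteq> 0" and b: "0 \<le> b" and d: "0 < d"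
  shows "b *\<^sub>R (mat 1 - (p / (x \<bullet> x)) *\<^sub>R outer x x) - d *\<^sub>R mat 1 \<notin> F"
proof
  define e where "e = x /\<^sub>R norm x"
  have e: "norm e = 1" using x by (simp add: e_def)
  have "outer x x = (x \<bullet> x) *\<^sub>R proj_line e"
    using x by (simp add: e_def proj_line_def outer_def vec_eq_iff power2_norm_eq_inner[symmetric] power2_eq_square field_simps)
  then have *: "(p / (x \<bullet> x)) *\<^sub>R outer x x = p *\<^sub>R proj_line e" using x by simp
  assume "b *\<^sub>R (mat 1 - (p / (x \<bullet> x)) *\<^sub>R outer x x) - d *\<^sub>R mat 1 \<in> F"
  then have B: "b *\<^sub>R (mat 1 - p *\<^sub>R proj_line e) - d *\<^sub>R mat 1 \<in> F" (is "?B \<in> F") unfolding * .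
  show False
  proof (cases "d < b")
    case True
    define q where "q = b * p / (b - d)"
    have q: "p < q" using True d p_ge_1 unfolding q_def by (simp add: field_simps)
    have "(1 / (b - d)) *\<^sub>R ?B = proj_perp e - (q - 1) *\<^sub>R proj_line e"
    proof -
      have "?B = (b - d) *\<^sub>R mat 1 - (b * p) *\<^sub>R proj_line e"
        by (simp add: algebra_simps)
      moreover have "(1 / (b - d)) *\<^sub>R ((b - d) *\<^sub>R mat 1) = (mat 1 :: real^'n^'n)" using True by simp
      ultimately show ?thesis by (simp add: q_def proj_perp_def scaleR_diff_right scaleR_diff_left)
    qed
    then show False using F_scale[OF B, of "1 / (b - d)"] riesz[OF e q] True by auto
  next
    case False
    define c where "c = d - b + b * p"
    have c: "0 < c" using False d p_ge_1 b unfolding c_def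
      by (cases "b = 0") (auto intro!: add_nonneg_pos)
    have "?B + (d - b) *\<^sub>R proj_perp e \<in> F"
      by (rule F_add_psd[OF B]) (use False psd_proj_perp[OF e] in \<open>auto intro: psd_scaleR\<close>)
    also have "?B + (d - b) *\<^sub>R proj_perp e = - c *\<^sub>R proj_line e"
      by (simp add: c_def proj_perp_def algebra_simps)
    finally have "- c *\<^sub>R proj_line e \<in> F" .
    from F_add_psd[OF F_scale[OF this, of "p / c"] psd_proj_perp[OF e]]
    have "(p / c) *\<^sub>R (- c *\<^sub>R proj_line e) + proj_perp e \<in> F"
      using c p_ge_1 by simp
    then have "proj_perp e - ((p + 1) - 1) *\<^sub>R proj_line e \<in> F" using c by (simp add: algebra_simps)
    with riesz[OF e, of "p + 1"] show False by simp
  qed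
qed

text \<open>In the variable \<open>s = |x|\<^sup>2\<close> the branches of the kernel can be treated together: the gradient of
  \<open>K(|x|)\<close> is a positive multiple of \<open>|x|\<^sup>-\<^sup>p x\<close> in all of them.\<close>

lemma riesz_kernel_sqrt_deriv:
  "\<exists>c>0. \<forall>s>0. ((\<lambda>s. riesz_kernel p (sqrt s)) has_field_derivative c * s powr (- p / 2)) (at s)"
proof -
  have half: "sqrt s powr a = s powr (a / 2)" if "0 < s" for s a
    using that by (simp add: powr_half_sqrt[symmetric] powr_powr)
  have pw: "((\<lambda>s. sqrt s powr (2 - p)) has_field_derivative ((2 - p) / 2) * s powr (- p / 2)) (at s)"
    if s: "0 < s" for s
  proof -
    have "((\<lambda>s. s powr ((2 - p) / 2)) has_field_derivative ((2 - p) / 2) * s powr ((2 - p) / 2 - 1)) (at s)"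
      using s by (rule has_real_derivative_powr)
    moreover have "\<forall>\<^sub>F t in nhds s. t powr ((2 - p) / 2) = sqrt t powr (2 - p)"
      using eventually_nhds_in_open[of "{0<..}" s] s by (auto elim!: eventually_mono simp: half)
    ultimately show ?thesis
      by (subst DERIV_cong_ev[OF refl _ refl, symmetric]) (auto simp: diff_divide_distrib)
  qed
  consider "p < 2" | "p = 2" | "p > 2" by linarith
  then show ?thesis
  proof cases
    case 1
    then show ?thesis using pw by (intro exI[of _ "(2 - p) / 2"]) (auto simp: riesz_kernel_def)
  next
    case 2
    have "((\<lambda>s. ln (sqrt s)) has_field_derivative (1/2) * s powr (-1)) (at s)" if "0 < s" for s
    proof -
      have "((\<lambda>s. (1/2) * ln s) has_field_derivative (1/2) * s powr (-1)) (at s)"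
        using that by (auto intro!: derivative_eq_intros simp: powr_minus field_simps)
      moreover have "\<forall>\<^sub>F t in nhds s. (1/2) * ln t = ln (sqrt t)"
        using eventually_nhds_in_open[of "{0<..}" s] that by (auto elim!: eventually_mono simp: ln_sqrt)
      ultimately show ?thesis by (subst DERIV_cong_ev[OF refl _ refl, symmetric]) auto
    qed
    then show ?thesis using 2 by (intro exI[of _ "1/2"]) (auto simp: riesz_kernel_def)
  next
    case 3
    have "((\<lambda>s. - (sqrt s powr (2 - p))) has_field_derivative ((p - 2) / 2) * s powr (- p / 2)) (at s)" if "0 < s" for s
      using DERIV_minus[OF pw[OF that]] by (simp add: algebra_simps diff_divide_distrib)
    then show ?thesis using 3 by (intro exI[of _ "(p - 2) / 2"]) (auto simp: riesz_kernel_def)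
  qed
qed

lemma riesz_kernel_strict_mono:
  assumes "0 < s" "s < t"
  shows "riesz_kernel p s < riesz_kernel p t"
proof (cases "p < 2")
  case True
  then show ?thesis using assms by (auto simp: riesz_kernel_def intro!: powr_less_mono2)
next
  case False
  then show ?thesis using assms by (auto simp: riesz_kernel_def intro!: powr_less_mono2_neg)
qed

lemma riesz_kernel_C2:
  fixes p :: real
  obtains c D H where "0 < c" "C2_on (- {0}) (\<lambda>x::real^'n. riesz_kernel p (norm x)) D H"
    "\<And>x. x \<noteq> 0 \<Longrightarrow> H x = (c * (x \<bullet> x) powr (- p / 2)) *\<^sub>R (mat 1 - (p / (x \<bullet> x)) *\<^sub>R outer x x)"
proof -
  obtain c where c: "0 < c"
    "\<And>s. 0 < s \<Longrightarrow> ((\<lambda>s. riesz_kernel p (sqrt s)) has_field_derivative c * s powr (- p / 2)) (at s)"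
    using riesz_kernel_sqrt_deriv[of p] by blast
  define k' where "k' s = c * s powr (- p / 2)" for s :: real
  define k'' where "k'' s = c * ((- p / 2) * s powr (- p / 2 - 1))" for s :: real
  have pos: "0 < t" if "t \<in> (\<lambda>x::real^'n. x \<bullet> x) ` (- {0})" for t using that by auto
  have C2: "C2_on (- {0}) (\<lambda>x::real^'n. riesz_kernel p (sqrt (x \<bullet> x))) (\<lambda>x. k' (x \<bullet> x) *\<^sub>R (2 *\<^sub>R x))
     (\<lambda>x. k' (x \<bullet> x) *\<^sub>R (2 *\<^sub>R mat 1) + k'' (x \<bullet> x) *\<^sub>R outer (2 *\<^sub>R x) (2 *\<^sub>R x))" (is "C2_on _ _ _ ?H")
  proof (rule C2_on_compose[OF C2_on_norm_sq])
    show "((\<lambda>s. riesz_kernel p (sqrt s)) has_field_derivative k' t) (at t)"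
      if "t \<in> (\<lambda>x::real^'n. x \<bullet> x) ` (- {0})" for t
      unfolding k'_def using c(2) pos[OF that] .
    show "(k' has_field_derivative k'' t) (at t)" if "t \<in> (\<lambda>x::real^'n. x \<bullet> x) ` (- {0})" for t
      unfolding k'_def k''_def using has_real_derivative_powr[OF pos[OF that], of "- p / 2"] by (rule DERIV_cmult)
    show "continuous_on ((\<lambda>x::real^'n. x \<bullet> x) ` (- {0})) k''"
      unfolding k''_def by (auto intro!: continuous_intros)
  qed auto
  have eq: "?H x = (2 * c * (x \<bullet> x) powr (- p / 2)) *\<^sub>R (mat 1 - (p / (x \<bullet> x)) *\<^sub>R outer x x)" if "x \<noteq> 0" for x :: "real^'n"
  proof -
    have "outer (2 *\<^sub>R x) (2 *\<^sub>R x) = 4 *\<^sub>R outer x x" by (simp add: outer_def vec_eq_iff)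
    moreover have "(x \<bullet> x) powr (- p / 2 - 1) = (x \<bullet> x) powr (- p / 2) / (x \<bullet> x)"
      using that by (simp add: powr_diff)
    ultimately show ?thesis by (simp add: k'_def k''_def scaleR_diff_right mult_ac)
  qed
  show ?thesis
    by (rule that[of "2 * c" _ ?H]) (use c C2 eq in \<open>auto simp: norm_eq_sqrt_inner\<close>)
qed

section \<open>Comparison on balls and annuli; convexity of the maximum\<close>

lemma interior_annulus:
  fixes x :: "'a::real_normed_vector"
  assumes "s < norm x" "norm x < r"
  shows "x \<in> interior (cball 0 r - ball 0 s)"
proof (rule interiorI[of "ball 0 r - cball 0 s"])
  show "open (ball 0 r - cball 0 s :: 'a set)" by (intro open_Diff) auto
qed (use assms in auto)

lemma interior_annulus_subset:
  "interior (cball 0 r - ball 0 s) \<subseteq> (cball 0 r - ball 0 s :: 'a::real_normed_vector set)"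
  by (rule interior_subset)

context riesz_cone
begin

text \<open>The right-hand side is \<open>a\<close> on the inner sphere, \<open>b\<close> on the outer one and affine in \<open>K(|x|)\<close>. With
  \<open>\<delta> (r\<^sup>2 - |x|\<^sup>2)\<close> added it is a barrier; then \<open>\<delta> \<rightarrow> 0\<close>.\<close>

lemma three_spheres_comparison:
  assumes u: "subsolution F X u" and X: "cball 0 r - ball 0 s \<subseteq> X" and s: "0 < s" "s < r"
    and us: "\<And>x. norm x = s \<Longrightarrow> u x \<le> ereal a" and ur: "\<And>x. norm x = r \<Longrightarrow> u x \<le> ereal b"
    and ab: "a \<le> b" and x: "s \<le> norm x" "norm x \<le> r"
  shows "u x \<le> ereal (a + (b - a) * ((riesz_kernel p (norm x) - riesz_kernel p s) / (riesz_kernel p r - riesz_kernel p s)))"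
proof -
  define K where "K = riesz_kernel p"
  define \<beta> where "\<beta> = (b - a) / (K r - K s)"
  have Ksr: "K s < K r" unfolding K_def by (rule riesz_kernel_strict_mono) (use s in auto)
  have \<beta>: "0 \<le> \<beta>" unfolding \<beta>_def using Ksr ab by simp
  obtain c D H where c: "0 < c" and C2: "C2_on (- {0}) (\<lambda>x::real^'n. K (norm x)) D H"
    and H: "\<And>x. x \<noteq> 0 \<Longrightarrow> H x = (c * (x \<bullet> x) powr (- p / 2)) *\<^sub>R (mat 1 - (p / (x \<bullet> x)) *\<^sub>R outer x x)"
    unfolding K_def by (rule riesz_kernel_C2[of p]) blast
  have le: "u x \<le> ereal (a + \<beta> * (K (norm x) - K s) + d * (r\<^sup>2 - x \<bullet> x))" if d: "0 < d" for d
  proof -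
    define A where "A = a - \<beta> * K s + d * r\<^sup>2"
    have C2': "C2_on (- {0}) (\<lambda>x::real^'n. A + (\<beta> * K (norm x) + (- d) * (x \<bullet> x)))
      (\<lambda>x. 0 + (\<beta> *\<^sub>R D x + (- d) *\<^sub>R (2 *\<^sub>R x))) (\<lambda>x. 0 + (\<beta> *\<^sub>R H x + (- d) *\<^sub>R (2 *\<^sub>R mat 1)))"
      by (intro C2_on_add C2_on_const C2_on_cmul C2 C2_on_norm_sq) auto
    have "u x \<le> ereal (A + (\<beta> * K (norm x) + (- d) * (x \<bullet> x)))"
    proof (rule strict_comparison[OF u _ X _ C2'])
      show "compact (cball 0 r - ball 0 s :: (real^'n) set)"
        by (intro compact_diff) auto
      show "cball 0 r - ball 0 s \<subseteq> - {0::real^'n}" using s by auto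
      show "x \<in> cball 0 r - ball 0 s" using x by auto
    next
      fix y :: "real^'n" assume "y \<in> interior (cball 0 r - ball 0 s)"
      then have "y \<noteq> 0" using interior_annulus_subset s by force
      note H = H[OF this] and nF = barrier_hessian_not_in_F[OF this]
      have "0 + (\<beta> *\<^sub>R H y + (- d) *\<^sub>R (2 *\<^sub>R mat 1)) =
        (\<beta> * (c * (y \<bullet> y) powr (- p / 2))) *\<^sub>R (mat 1 - (p / (y \<bullet> y)) *\<^sub>R outer y y) - (2 * d) *\<^sub>R mat 1" (is "?A = ?B")
        by (simp add: H mult_ac)
      moreover have "?B \<notin> F" by (rule nF) (use \<beta> c d in auto)
      moreover have "?B \<in> Sym2" by (intro Sym2_diff Sym2_scaleR Sym2_mat Sym2_outer)
      ultimately show "?A \<in> Sym2 - F" by simp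
    next
      fix y :: "real^'n" assume y: "y \<in> cball 0 r - ball 0 s" "y \<notin> interior (cball 0 r - ball 0 s)"
      then have y': "s \<le> norm y" "norm y \<le> r" by auto
      then consider "norm y = s" | "norm y = r" using interior_annulus[of s y r] y by linarith
      then show "u y \<le> ereal (A + (\<beta> * K (norm y) + (- d) * (y \<bullet> y)))"
      proof cases
        case 1
        then have "y \<bullet> y = s\<^sup>2" by (metis power2_norm_eq_inner)
        moreover have "d * s\<^sup>2 \<le> d * r\<^sup>2" using d s by (simp add: power_mono)
        ultimately have "a \<le> A + (\<beta> * K (norm y) + (- d) * (y \<bullet> y))" using 1 by (simp add: A_def)
        then show ?thesis using us[OF 1] by (meson ereal_less_eq(3) order_trans)
      next
        case 2
        then have "y \<bullet> y = r\<^sup>2" by (metis power2_norm_eq_inner)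
        then have "A + (\<beta> * K (norm y) + (- d) * (y \<bullet> y)) = a + \<beta> * (K r - K s)" using 2 by (simp add: A_def algebra_simps)
        also have "\<dots> = b" using Ksr by (simp add: \<beta>_def)
        finally show ?thesis using ur[OF 2] by simp
      qed
    qed
    then show ?thesis by (simp add: A_def algebra_simps)
  qed
  have "((\<lambda>d. ereal (a + \<beta> * (K (norm x) - K s) + d * (r\<^sup>2 - x \<bullet> x))) \<longlongrightarrow>
     ereal (a + \<beta> * (K (norm x) - K s) + 0 * (r\<^sup>2 - x \<bullet> x))) (at_right 0)"
    by (intro tendsto_intros)
  moreover have "\<forall>\<^sub>F d in at_right 0. u x \<le> ereal (a + \<beta> * (K (norm x) - K s) + d * (r\<^sup>2 - x \<bullet> x))"
    using eventually_at_right_less[of "0::real"] by eventually_elim (rule le)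
  ultimately have "u x \<le> ereal (a + \<beta> * (K (norm x) - K s) + 0 * (r\<^sup>2 - x \<bullet> x))"
    by (intro tendsto_lowerbound) auto
  then show ?thesis by (simp add: \<beta>_def K_def)
qed

text \<open>Here the barrier has no kernel term, so it is smooth at the origin as well.\<close>

lemma ball_maximum_principle:
  assumes u: "subsolution F X u" and X: "cball 0 r \<subseteq> X" 
    and ur: "\<And>x. norm x = r \<Longrightarrow> u x \<le> ereal b" and x: "norm x \<le> r"
  shows "u x \<le> ereal b"
proof -
  have le: "u x \<le> ereal (b + d * (r\<^sup>2 - x \<bullet> x))" if d: "0 < d" for d
  proof -
    have C2': "C2_on UNIV (\<lambda>x::real^'n. (b + d * r\<^sup>2) + (- d) * (x \<bullet> x))
      (\<lambda>x. 0 + (- d) *\<^sub>R (2 *\<^sub>R x)) (\<lambda>x. 0 + (- d) *\<^sub>R (2 *\<^sub>R mat 1))"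
      by (intro C2_on_add C2_on_const C2_on_cmul C2_on_norm_sq) auto
    have "u x \<le> ereal ((b + d * r\<^sup>2) + (- d) * (x \<bullet> x))"
    proof (rule strict_comparison[OF u _ X _ C2'])
      fix y :: "real^'n"
      show "0 + - d *\<^sub>R (2 *\<^sub>R mat 1) \<in> Sym2 - F"
      proof -
        have "axis undefined 1 \<noteq> (0 :: real^'n)" by (simp add: axis_eq_0_iff)
        from barrier_hessian_not_in_F[OF this, of 0 "2 * d"] d
        have "- (2 * d) *\<^sub>R mat 1 \<notin> F" by simp
        moreover have "- (2 * d) *\<^sub>R mat 1 \<in> (Sym2 :: (real^'n^'n) set)" by (intro Sym2_scaleR Sym2_mat)
        moreover have "0 + - d *\<^sub>R (2 *\<^sub>R mat 1) = - (2 * d) *\<^sub>R (mat 1 :: real^'n^'n)" by simp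
        ultimately show ?thesis by (simp only: Diff_iff) blast
      qed
      assume y: "y \<in> cball 0 r" "y \<notin> interior (cball 0 r)"
      then have "norm y = r" by auto
      moreover then have "y \<bullet> y = r\<^sup>2" by (metis power2_norm_eq_inner)
      ultimately show "u y \<le> ereal ((b + d * r\<^sup>2) + (- d) * (y \<bullet> y))" using ur by simp
    qed (use x in auto)
    then show ?thesis by (simp add: algebra_simps)
  qed
  have "((\<lambda>d. ereal (b + d * (r\<^sup>2 - x \<bullet> x))) \<longlongrightarrow> ereal (b + 0 * (r\<^sup>2 - x \<bullet> x))) (at_right 0)"
    by (intro tendsto_intros)
  moreover have "\<forall>\<^sub>F d in at_right 0. u x \<le> ereal (b + d * (r\<^sup>2 - x \<bullet> x))"
    using eventually_at_right_less[of "0::real"] by eventually_elim (rule le)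
  ultimately have "u x \<le> ereal (b + 0 * (r\<^sup>2 - x \<bullet> x))"
    by (intro tendsto_lowerbound) auto
  then show ?thesis by simp
qed

end

lemma subsolution_bounded_above:
  assumes u: "subsolution F X u" and K: "compact K" "K \<subseteq> X"
  obtains M where "0 \<le> M" "\<And>x. x \<in> K \<Longrightarrow> u x \<le> ereal M"
proof (cases "K = {}")
  case False
  note u = subsolutionD[OF u]
  obtain x where x: "x \<in> K" "\<forall>y\<in>K. u y \<le> u x"
    using usc_on_attains_sup[OF usc_on_subset[OF u(3) K(2)] K(1) False] by blast
  have "u x < \<infinity>" using u(2) x K by auto
  then obtain M where "u x \<le> ereal M" by (cases "u x") auto
  then have "u y \<le> ereal (max M 0)" if "y \<in> K" for y
    using x that by (metis ereal_less_eq(3) max.cobounded1 order_trans)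
  then show ?thesis using that[of "max M 0"] by simp
qed (use that[of 0] in auto)

context riesz_cone
begin

text \<open>On the inner sphere every \<open>c\<close> is an upper bound. The three-spheres comparison bounds \<open>u\<close> by
  \<open>c (1 - \<theta>) + M \<theta>\<close> with \<open>\<theta> < 1\<close>, which tends to \<open>-\<infinity>\<close> with \<open>c\<close>.\<close>

lemma minus_infinity_propagates:
  assumes u: "subsolution F X u" and X: "cball z r \<subseteq> X" and s: "0 < s" "s < r"
    and inf: "\<And>x. dist z x \<le> s \<Longrightarrow> u x = -\<infinity>" and x: "dist z x < r"
  shows "u x = -\<infinity>"
proof (cases "dist z x \<le> s")
  case False
  define v where "v y = u (y + z)" for y
  have v: "subsolution F ((\<lambda>x. x - z) ` X) v" unfolding v_def by (rule subsolution_translate[OF u])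
  have cb: "cball 0 r \<subseteq> (\<lambda>x. x - z) ` X"
  proof
    fix y :: "real^'n" assume "y \<in> cball 0 r"
    then have "y + z \<in> X" using X by (auto simp: dist_norm subset_eq)
    then show "y \<in> (\<lambda>x. x - z) ` X" by (auto intro!: image_eqI[of _ _ "y + z"])
  qed
  obtain M where M: "\<And>y. y \<in> cball 0 r \<Longrightarrow> v y \<le> ereal M"
    using subsolution_bounded_above[OF v _ cb] by auto
  define K where "K = riesz_kernel p"
  define \<rho> where "\<rho> = norm (x - z)"
  have \<rho>: "s < \<rho>" "\<rho> < r" using False x by (auto simp: \<rho>_def dist_norm norm_minus_commute)
  define \<theta> where "\<theta> = (K \<rho> - K s) / (K r - K s)"
  have "K s < K \<rho>" "K \<rho> < K r" unfolding K_def using s \<rho> by (auto intro!: riesz_kernel_strict_mono)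
  then have \<theta>: "\<theta> < 1" unfolding \<theta>_def by simp
  have le: "v (x - z) \<le> ereal (c + (M - c) * \<theta>)" if "c \<le> M" for c
    unfolding \<theta>_def K_def \<rho>_def
    by (rule three_spheres_comparison[OF v _ s])
       (use cb M that \<rho> s in \<open>auto simp: \<rho>_def v_def inf dist_norm\<close>)
  have "v (x - z) = -\<infinity>"
  proof (rule ccontr)
    assume "v (x - z) \<noteq> -\<infinity>"
    then obtain t where t: "v (x - z) = ereal t" using le[of M] by (cases "v (x - z)") auto
    define c where "c = min M ((t - 1 - M * \<theta>) / (1 - \<theta>))"
    have "c * (1 - \<theta>) \<le> t - 1 - M * \<theta>"
      using \<theta> unfolding c_def by (simp add: min_def pos_le_divide_eq)
    moreover have "t \<le> c + (M - c) * \<theta>" using le[of c] t unfolding c_def by simp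
    ultimately show False by (simp add: algebra_simps)
  qed
  then show ?thesis by (simp add: v_def)
qed (use inf in auto)

text \<open>The set of points near which \<open>u\<close> is \<open>-\<infinity>\<close> is open, and by propagation it is relatively closed in \<open>X\<close>.
  So it contains a whole component of \<open>X\<close> once it meets it.\<close>

lemma not_minus_infinity_near_0:
  assumes u: "subharmonic F X u" and X: "cball 0 r \<subseteq> X" and r: "0 < r"
  shows "\<exists>x\<in>cball 0 r. u x \<noteq> -\<infinity>"
proof (rule ccontr)
  assume "\<not> ?thesis"
  then have inf: "\<And>x. x \<in> cball 0 r \<Longrightarrow> u x = -\<infinity>" by blast
  have us: "subsolution F X u" by (rule subharmonic_imp_subsolution[OF u])
  note opX = subsolutionD(1)[OF us]
  define W where "W = {x. \<exists>s>0. \<forall>y\<in>ball x s. y \<in> X \<and> u y = -\<infinity>}"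
  have "open W"
    unfolding open_dist
  proof
    fix x assume "x \<in> W"
    then obtain s where s: "s > 0" "\<forall>y\<in>ball x s. y \<in> X \<and> u y = -\<infinity>" by (auto simp: W_def)
    show "\<exists>e>0. \<forall>y. dist y x < e \<longrightarrow> y \<in> W"
    proof (intro exI[of _ "s/2"] conjI allI impI)
      fix y assume y: "dist y x < s / 2"
      have "ball y (s/2) \<subseteq> ball x s"
      proof
        fix w assume "w \<in> ball y (s/2)"
        then show "w \<in> ball x s" using y dist_triangle[of x w y] by (simp add: dist_commute)
      qed
      then show "y \<in> W" using s unfolding W_def by (auto intro!: exI[of _ "s/2"])
    qed (use s in simp)
  qed
  have V: "\<exists>e>0. \<forall>y\<in>ball x e. y \<in> X - W" if x: "x \<in> X - W" for x
  proof -
    obtain d where d: "d > 0" "ball x d \<subseteq> X" using opX x openE by blast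
    define e where "e = d / 4"
    have e: "e > 0" using d by (simp add: e_def)
    have "y \<notin> W" if y: "y \<in> ball x e" for y
    proof
      assume "y \<in> W"
      then obtain s where s: "s > 0" "\<forall>w\<in>ball y s. u w = -\<infinity>" by (auto simp: W_def)
      define s' where "s' = min (s/2) e"
      have s': "0 < s'" "s' < s" "s' < 2 * e" using s e by (auto simp: s'_def)
      have "u w = -\<infinity>" if "dist y w < 2 * e" for w
      proof (rule minus_infinity_propagates[OF us _ s'(1,3) _ that])
        show "cball y (2 * e) \<subseteq> X"
        proof
          fix z assume "z \<in> cball y (2 * e)"
          then have "dist x z < d" using y dist_triangle[of x z y] e by (simp add: e_def)
          then show "z \<in> X" using d by auto
        qed
      qed (use s s' in auto)
      moreover have "dist y w < 2 * e" if "w \<in> ball x e" for w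
        using that y dist_triangle[of y w x] by (simp add: dist_commute)
      moreover have "w \<in> X" if "w \<in> ball x e" for w using that d e by (auto simp: e_def)
      ultimately have "x \<in> W" unfolding W_def using e by auto
      with x show False by simp
    qed
    moreover have "y \<in> X" if "y \<in> ball x e" for y using that d e by (auto simp: e_def)
    ultimately show ?thesis using e by blast
  qed
  have opV: "open (X - W)" unfolding open_contains_ball using V by blast
  define C where "C = connected_component_set X 0"
  have X0: "0 \<in> X" using X r by auto
  have C: "C \<in> components X" using X0 by (auto simp: C_def components_def)
  then have conn: "connected C" and CX: "C \<subseteq> X" by (auto simp: in_components_connected in_components_subset)
  have "0 \<in> W \<inter> C" using X r inf X0 unfolding W_def C_def by (auto intro!: exI[of _ r])
  with connectedD[OF conn \<open>open W\<close> opV] CX have "C \<subseteq> W" by blast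
  then have "\<forall>x\<in>C. u x = -\<infinity>" by (auto simp: W_def)
  moreover have "\<forall>C\<in>components X. \<exists>x\<in>C. u x \<noteq> -\<infinity>"
    using u unfolding subharmonic_def by (elim conjE)
  ultimately show False using C by blast
qed

lemma max_ball_convex:
  assumes u: "subharmonic F X u"
  defines "K \<equiv> riesz_kernel p"
  obtains f where "\<And>r. 0 < r \<Longrightarrow> cball 0 r \<subseteq> X \<Longrightarrow> max_ball u r = ereal (f r)"
    "\<And>s t r. 0 < s \<Longrightarrow> s < t \<Longrightarrow> t < r \<Longrightarrow> cball 0 r \<subseteq> X \<Longrightarrow>
        f t \<le> f s + (f r - f s) * ((K t - K s) / (K r - K s))"
proof -
  have us: "subsolution F X u" by (rule subharmonic_imp_subsolution[OF u])
  have "\<bar>max_ball u r\<bar> \<noteq> \<infinity>" if r: "0 < r" "cball 0 r \<subseteq> X" for r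
  proof -
    obtain M where "\<And>x. x \<in> cball 0 r \<Longrightarrow> u x \<le> ereal M"
      using subsolution_bounded_above[OF us _ r(2)] by auto
    then have "max_ball u r \<le> ereal M" unfolding max_ball_def by (rule SUP_least)
    moreover obtain x where "x \<in> cball 0 r" "u x \<noteq> -\<infinity>" using not_minus_infinity_near_0[OF u r(2,1)] by blast
    then have "max_ball u r \<noteq> -\<infinity>" unfolding max_ball_def
      by (metis SUP_upper ereal_infty_less_eq(2))
    ultimately show ?thesis by auto
  qed
  then have fin: "max_ball u r = ereal (real_of_ereal (max_ball u r))" if "0 < r" "cball 0 r \<subseteq> X" for r
    using that by (simp add: ereal_real)
  show thesis
  proof (rule that[OF fin])
    fix s t r :: real assume st: "0 < s" "s < t" "t < r" and r: "cball 0 r \<subseteq> X"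
    define f where "f r = real_of_ereal (max_ball u r)" for r
    have sub: "cball 0 s \<subseteq> X" "cball 0 t \<subseteq> X" using r st by (auto simp: subset_eq)
    have fs: "max_ball u s = ereal (f s)" and ft: "max_ball u t = ereal (f t)" and fr: "max_ball u r = ereal (f r)"
      unfolding f_def using fin st sub r by auto
    have up: "u x \<le> max_ball u \<rho>" if "norm x \<le> \<rho>" for x \<rho>
      unfolding max_ball_def by (rule SUP_upper) (use that in auto)
    have mono: "f s \<le> f r"
    proof -
      have "max_ball u s \<le> max_ball u r" unfolding max_ball_def by (rule SUP_subset_mono) (use st in auto)
      then show ?thesis by (simp add: fs fr)
    qed
    have Kst: "K s < K t" "K t < K r" unfolding K_def using st by (auto intro!: riesz_kernel_strict_mono)
    have "u x \<le> ereal (f s + (f r - f s) * ((K t - K s) / (K r - K s)))" if x: "x \<in> cball 0 t" for x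
    proof (cases "norm x \<le> s")
      case True
      have "0 \<le> (f r - f s) * ((K t - K s) / (K r - K s))"
        using mono Kst by (intro mult_nonneg_nonneg divide_nonneg_nonneg) auto
      then have "f s \<le> f s + (f r - f s) * ((K t - K s) / (K r - K s))" by simp
      then show ?thesis using up[OF True] fs by (metis ereal_less_eq(3) order_trans)
    next
      case False
      have "u x \<le> ereal (f s + (f r - f s) * ((riesz_kernel p (norm x) - riesz_kernel p s) / (riesz_kernel p r - riesz_kernel p s)))"
        by (rule three_spheres_comparison[OF us]) (use st r x False mono up[of _ s] up[of _ r] in \<open>auto simp: fs fr\<close>)
      also have "\<dots> \<le> ereal (f s + (f r - f s) * ((K t - K s) / (K r - K s)))"
      proof -
        have "K (norm x) \<le> K t"
        proof (cases "norm x = t")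
          case False
          then show ?thesis unfolding K_def
            using x \<open>\<not> norm x \<le> s\<close> st by (intro less_imp_le riesz_kernel_strict_mono) auto
        qed simp
        then have "(K (norm x) - K s) / (K r - K s) \<le> (K t - K s) / (K r - K s)"
          using Kst by (intro divide_right_mono) auto
        from mult_left_mono[OF this, of "f r - f s"] show ?thesis using mono by (simp add: K_def)
      qed
      finally show ?thesis .
    qed
    then have "max_ball u t \<le> ereal (f s + (f r - f s) * ((K t - K s) / (K r - K s)))"
      unfolding max_ball_def by (rule SUP_least)
    then show "f t \<le> f s + (f r - f s) * ((K t - K s) / (K r - K s))" by (simp add: ft)
  qed auto
qed

end

lemma increasing_diff_quotients_if_convex:
  assumes R: "\<And>r. r \<in> R \<Longrightarrow> 0 < r" and \<Phi>: "\<And>r. r \<in> R \<Longrightarrow> \<Phi> r = ereal (f r)"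
    and mono: "\<And>s t. 0 < s \<Longrightarrow> s < t \<Longrightarrow> K s < K t"
    and conv: "\<And>s t r. s \<in> R \<Longrightarrow> t \<in> R \<Longrightarrow> r \<in> R \<Longrightarrow> s < t \<Longrightarrow> t < r \<Longrightarrow>
        f t \<le> f s + (f r - f s) * ((K t - K s) / (K r - K s))"
  shows "increasing_diff_quotients R \<Phi> K"
proof -
  have dq: "diff_quotient \<Phi> K r s = ereal ((f r - f s) / (K r - K s))" if "r \<in> R" "s \<in> R" "s < r" for r s
    using mono[of s r] R[of s] that by (simp add: diff_quotient_def \<Phi>)
  show ?thesis
    unfolding increasing_diff_quotients_def
  proof (intro conjI ballI impI; (elim conjE)?)
    fix r assume "r \<in> R" then show "\<bar>\<Phi> r\<bar> \<noteq> \<infinity>" by (simp add: \<Phi>)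
  next
    fix s r r' assume in_R: "s \<in> R" "r \<in> R" "r' \<in> R" and sr: "s < r" "r \<le> r'"
    have "(f r - f s) / (K r - K s) \<le> (f r' - f s) / (K r' - K s)"
    proof (cases "r = r'")
      case False
      then have K: "K s < K r" "K r < K r'" using mono R in_R sr by auto
      have "f r \<le> f s + (f r' - f s) * ((K r - K s) / (K r' - K s))"
        using conv in_R sr False by simp
      then show ?thesis using K by (simp add: field_simps)
    qed simp
    then show "diff_quotient \<Phi> K r s \<le> diff_quotient \<Phi> K r' s" using dq in_R sr by simp
  next
    fix s s' r assume in_R: "s \<in> R" "s' \<in> R" "r \<in> R" and sr: "s \<le> s'" "s' < r"
    have "(f r - f s) / (K r - K s) \<le> (f r - f s') / (K r - K s')"
    proof (cases "s = s'")
      case False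
      then have K: "K s < K s'" "K s' < K r" using mono R in_R sr by auto
      have "f s' \<le> f s + (f r - f s) * ((K s' - K s) / (K r - K s))"
        using conv in_R sr False by simp
      also have "\<dots> = f r - (f r - f s) / (K r - K s) * (K r - K s')"
        using K by (simp add: field_simps)
      finally show ?thesis using K by (simp add: pos_le_divide_eq)
    qed simp
    then show "diff_quotient \<Phi> K r s \<le> diff_quotient \<Phi> K r s'" using dq in_R sr by simp
  qed
qed

section \<open>Linear functionals separating a matrix from a convex cone subequation\<close>

lemma matrix_vector_axis: "(A *v axis j 1) $ i = A $ i $ j"
  by (simp add: matrix_vector_mult_def axis_def if_distrib[of "(*) _"] cong: if_cong)

lemma psd_diagonal: "P \<in> psd_cone \<Longrightarrow> 0 \<le> P $ i $ i"
  by (auto simp: psd_cone_def inner_axis' matrix_vector_axis dest!: spec[of _ "axis i 1"])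

lemma psd_eq_0:
  fixes P :: "real^'n^'n"
  assumes P: "P \<in> psd_cone" and diag: "\<And>i. P $ i $ i = 0"
  shows "P = 0"
proof -
  have sym: "P $ i $ j = P $ j $ i" for i j using P by (auto simp: psd_cone_def Sym2_iff)
  have "P $ i $ j = 0" for i j
  proof (rule ccontr)
    assume nz: "P $ i $ j \<noteq> 0"
    define x :: "real^'n" where "x = axis i 1 - P $ i $ j *\<^sub>R axis j 1"
    have "x \<bullet> (P *v x) = - 2 * (P $ i $ j)\<^sup>2"
      using sym[of j i] unfolding x_def
      by (simp add: matrix_vector_mult_diff_distrib matrix_vector_mult_scaleR inner_diff_left inner_diff_right
          inner_axis' matrix_vector_axis diag power2_eq_square)
    moreover have "0 \<le> x \<bullet> (P *v x)" using P by (auto simp: psd_cone_def)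
    ultimately show False using nz by (smt (verit) zero_less_power2)
  qed
  then show ?thesis by (simp add: vec_eq_iff)
qed

text \<open>Cholesky decomposition: subtracting \<open>w w\<^sup>T\<close> with \<open>w = P e\<^sub>i / \<surd>P\<^sub>i\<^sub>i\<close> keeps \<open>P\<close> positive semidefinite and makes
  one more diagonal entry vanish.\<close>

lemma psd_sum_of_outer:
  assumes "P \<in> psd_cone"
  shows "\<exists>vs. P = (\<Sum>v\<leftarrow>vs. outer v v)"
  using assms
proof (induction "card {i. P $ i $ i \<noteq> 0}" arbitrary: P rule: less_induct)
  case less
  note P = less.prems
  show ?case
  proof (cases "\<exists>i. P $ i $ i \<noteq> 0")
    case False
    then have "P = 0" using psd_eq_0[OF P] by blast
    then show ?thesis by (intro exI[of _ "[]"]) simp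
  next
    case True
    then obtain i where i: "P $ i $ i \<noteq> 0" by blast
    with psd_diagonal[OF P, of i] have d: "0 < P $ i $ i" by simp
    have symP: "P \<in> Sym2" using P by (auto simp: psd_cone_def)
    define w where "w = (1 / sqrt (P $ i $ i)) *\<^sub>R (P *v axis i 1)"
    define Q where "Q = P - outer w w"
    have Q_psd: "Q \<in> psd_cone"
      unfolding psd_cone_def
    proof safe
      show "Q \<in> Sym2" unfolding Q_def by (intro Sym2_diff symP Sym2_outer)
      fix x
      define c where "c = (P *v axis i 1) \<bullet> x"
      define y where "y = x - (c / P $ i $ i) *\<^sub>R axis i 1"
      have ax: "axis i 1 \<bullet> (P *v x) = c"
        using Sym2_inner_commute[OF symP, of "axis i 1" x] by (simp add: c_def inner_commute)
      have ax3: "axis i 1 \<bullet> (P *v axis i 1) = P $ i $ i" by (simp add: inner_axis' matrix_vector_axis)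
      have ax2: "x \<bullet> (P *v axis i 1) = c" by (simp add: c_def inner_commute)
      have "x \<bullet> (Q *v x) = x \<bullet> (P *v x) - c\<^sup>2 / P $ i $ i"
        using d by (simp add: Q_def matrix_vector_mult_diff_rdistrib outer_mult_vec inner_diff_right w_def c_def
            inner_commute power2_eq_square real_sqrt_mult[symmetric])
      also have "\<dots> = y \<bullet> (P *v y)"
        using d by (simp add: y_def matrix_vector_mult_diff_distrib matrix_vector_mult_scaleR inner_diff_left
            inner_diff_right ax ax2 ax3 power2_eq_square)
      also have "\<dots> \<ge> 0" using P by (auto simp: psd_cone_def)
      finally show "0 \<le> x \<bullet> (Q *v x)" .
    qed
    have Qd: "Q $ j $ j = P $ j $ j - (w $ j)\<^sup>2" for j by (simp add: Q_def outer_def power2_eq_square)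
    have "Q $ i $ i = 0"
      using d by (simp add: Qd w_def matrix_vector_axis power_mult_distrib power_divide power2_eq_square)
    moreover have "Q $ j $ j = 0" if "P $ j $ j = 0" for j
      using psd_diagonal[OF Q_psd, of j] that by (simp add: Qd)
    ultimately have "{j. Q $ j $ j \<noteq> 0} \<subset> {j. P $ j $ j \<noteq> 0}" using i by auto
    then have "card {j. Q $ j $ j \<noteq> 0} < card {j. P $ j $ j \<noteq> 0}" by (intro psubset_card_mono) auto
    from less.hyps[OF this Q_psd] obtain vs where "Q = (\<Sum>v\<leftarrow>vs. outer v v)" by blast
    then have "P = (\<Sum>v\<leftarrow>w # vs. outer v v)" by (simp add: Q_def algebra_simps)
    then show ?thesis by blast
  qed
qed

lemma inner_sum_list_outer: "(\<Sum>v\<leftarrow>vs. outer v v) \<bullet> B = (\<Sum>v\<leftarrow>vs. v \<bullet> (B *v v))"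
  by (induction vs) (auto simp: inner_add_left inner_outer)

lemma inner_transpose: "transpose A \<bullet> B = A \<bullet> transpose (B::real^'n^'n)"
proof -
  have "(\<Sum>i\<in>UNIV. \<Sum>j\<in>UNIV. A $ j $ i * B $ i $ j) = (\<Sum>i\<in>UNIV. \<Sum>j\<in>UNIV. A $ i $ j * B $ j $ i)"
    by (rule sum.swap)
  then show ?thesis by (simp add: inner_vec_def transpose_def)
qed

text \<open>A linear functional that separates \<open>H\<close> from the closed convex cone \<open>F\<close> is nonnegative on \<open>F\<close>, hence
  on the positive semidefinite matrices. So its symmetric part is positive semidefinite and is a sum of
  matrices \<open>v v\<^sup>T\<close>.\<close>

lemma (in riesz_cone) separating_vectors:
  assumes conv: "convex F" and H: "H \<in> Sym2" "H \<notin> F"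
  obtains v and l :: nat where "0 < l" "\<And>B. B \<in> F \<Longrightarrow> 0 \<le> (\<Sum>k<l. v k \<bullet> (B *v v k))"
    "(\<Sum>k<l. v k \<bullet> (H *v v k)) < 0"
proof -
  obtain A b where A: "A \<bullet> H < b" "\<And>B. B \<in> F \<Longrightarrow> b < A \<bullet> B"
    using separating_hyperplane_closed_point[OF conv F_closed H(2)] by blast
  have b: "b < 0" using A(2)[OF zero_in_F] by simp
  have nonneg: "0 \<le> A \<bullet> B" if "B \<in> F" for B
  proof (rule ccontr)
    assume "\<not> 0 \<le> A \<bullet> B"
    then have neg: "A \<bullet> B < 0" by simp
    have "b < A \<bullet> ((b / (A \<bullet> B)) *\<^sub>R B)"
      by (rule A(2), rule F_scale[OF that]) (use neg b in \<open>simp add: divide_nonpos_neg\<close>)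
    then show False using neg by simp
  qed
  define S where "S = (1/2) *\<^sub>R (A + transpose A)"
  have S: "S \<bullet> B = A \<bullet> B" if "B \<in> Sym2" for B
    using that by (simp add: S_def inner_add_left inner_transpose Sym2_def)
  have "S \<in> psd_cone"
    unfolding psd_cone_def
  proof safe
    show "S \<in> Sym2" by (auto simp: S_def Sym2_iff transpose_def)
    fix x
    have "x \<bullet> (S *v x) = outer x x \<bullet> S" by (simp add: inner_outer)
    also have "\<dots> = A \<bullet> outer x x" using S[OF Sym2_outer, of x] by (simp add: inner_commute)
    also have "\<dots> \<ge> 0" by (intro nonneg psd_in_F psd_outer)
    finally show "0 \<le> x \<bullet> (S *v x)" .
  qed
  then obtain vs where vs: "S = (\<Sum>v\<leftarrow>vs. outer v v)" using psd_sum_of_outer by blast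
  have eq: "(\<Sum>k<length vs. vs ! k \<bullet> (B *v (vs ! k))) = A \<bullet> B" if "B \<in> Sym2" for B
    using S[OF that] unfolding vs inner_sum_list_outer
    by (simp add: sum_list_sum_nth atLeast0LessThan)
  show thesis
  proof (rule that[of "length vs" "\<lambda>k. vs ! k"])
    show neg: "(\<Sum>k<length vs. vs ! k \<bullet> (H *v (vs ! k))) < 0" using eq[OF H(1)] A(1) b by simp
    then show "0 < length vs" by (cases vs) auto
    show "0 \<le> (\<Sum>k<length vs. vs ! k \<bullet> (B *v (vs ! k)))" if "B \<in> F" for B
      using eq[OF F_Sym2[OF that]] nonneg[OF that] by simp
  qed
qed

section \<open>The random walk and the parabolic comparison\<close>

text \<open>One step of the symmetric random walk with increments \<open>\<plusminus> h v\<^sub>k\<close>. For smooth \<open>f\<close> it equals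
  \<open>f + (h\<^sup>2 / 2 l) \<Sum> v\<^sub>k\<^sup>T (D\<^sup>2f) v\<^sub>k + o(h\<^sup>2)\<close>.\<close>

definition walk :: "(nat \<Rightarrow> 'a) \<Rightarrow> nat \<Rightarrow> real \<Rightarrow> ('a::real_vector \<Rightarrow> 'b::real_vector) \<Rightarrow> 'a \<Rightarrow> 'b" where
  "walk v l h f x = (1 / (2 * real l)) *\<^sub>R (\<Sum>k<l. f (x + h *\<^sub>R v k) + f (x - h *\<^sub>R v k))"

lemma walk_mono:
  fixes f g :: "'a::real_vector \<Rightarrow> real"
  shows "(\<And>x. f x \<le> g x) \<Longrightarrow> walk v l h f x \<le> walk v l h g x"
  unfolding walk_def by (intro scaleR_left_mono sum_mono add_mono) auto

lemma walk_const: "0 < l \<Longrightarrow> walk v l h (\<lambda>x. c) x = c"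
  by (simp add: walk_def scaleR_2[symmetric] sum_constant_scaleR)

lemma walk_add: "walk v l h (\<lambda>x. f x + g x) x = walk v l h f x + walk v l h g x"
  unfolding walk_def by (simp add: sum.distrib[symmetric] scaleR_add_right[symmetric] algebra_simps)

lemma walk_sum: 
  fixes m :: nat
  shows "walk v l h (\<lambda>x. \<Sum>i<m. f i x) x = (\<Sum>i<m. walk v l h (f i) x)"
  by (induction m) (auto simp: walk_add, simp add: walk_def)

lemma walk_scaleR: "walk v l h (\<lambda>x. c *\<^sub>R f x) x = c *\<^sub>R walk v l h f x"
  by (simp add: walk_def scaleR_sum_right scaleR_add_right mult_ac)

lemma walk_0: "0 < l \<Longrightarrow> walk v l 0 f x = f x"
  by (simp add: walk_def scaleR_2[symmetric] sum_constant_scaleR)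

lemma walk_convex:
  fixes f :: "'a::real_vector \<Rightarrow> real"
  assumes "0 < l" and "\<And>x a. 2 * f x \<le> f (x + a) + f (x - a)"
  shows "f x \<le> walk v l h f x"
proof -
  have "(\<Sum>k<l. 2 * f x) \<le> (\<Sum>k<l. f (x + h *\<^sub>R v k) + f (x - h *\<^sub>R v k))"
    by (rule sum_mono) (rule assms)
  then show ?thesis using assms(1) by (simp add: walk_def field_simps)
qed

lemma walk_le_of_le:
  assumes l: "0 < l" and g: "\<And>k. k < l \<Longrightarrow> norm (g (x + h *\<^sub>R v k)) \<le> c \<and> norm (g (x - h *\<^sub>R v k)) \<le> c"
  shows "norm (walk v l h g x :: 'b::real_normed_vector) \<le> c"
proof -
  have "norm (\<Sum>k<l. g (x + h *\<^sub>R v k) + g (x - h *\<^sub>R v k)) \<le> (\<Sum>k<l. 2 * c)"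
  proof (rule order_trans[OF norm_sum sum_mono])
    fix k assume "k \<in> {..<l}"
    then show "norm (g (x + h *\<^sub>R v k) + g (x - h *\<^sub>R v k)) \<le> 2 * c"
      using g[of k] norm_triangle_ineq[of "g (x + h *\<^sub>R v k)" "g (x - h *\<^sub>R v k)"] by auto
  qed
  then show ?thesis using l by (simp add: walk_def field_simps)
qed

lemma C2_on_sum:
  fixes l :: nat
  assumes "\<And>k. k < l \<Longrightarrow> C2_on U (f k) (D k) (H k)" and "open U"
  shows "C2_on U (\<lambda>x. \<Sum>k<l. f k x) (\<lambda>x. \<Sum>k<l. D k x) (\<lambda>x. \<Sum>k<l. H k x)"
  using assms by (induction l) (auto intro!: C2_on_const C2_on_add)

lemma C2_on_shift_UNIV: "C2_on UNIV f D H \<Longrightarrow> C2_on UNIV (\<lambda>x. f (x + a)) (\<lambda>x. D (x + a)) (\<lambda>x. H (x + a))"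
  using C2_on_shift[of UNIV f D H a] by (simp add: surj_diff_right)

lemma C2_on_walk:
  assumes "C2_on UNIV f D H"
  shows "C2_on UNIV (walk v l h f) (walk v l h D) (walk v l h H)"
proof -
  have "C2_on UNIV (\<lambda>x. (1 / (2 * real l)) * (\<Sum>k<l. f (x + h *\<^sub>R v k) + f (x + (- h *\<^sub>R v k))))
     (\<lambda>x. (1 / (2 * real l)) *\<^sub>R (\<Sum>k<l. D (x + h *\<^sub>R v k) + D (x + (- h *\<^sub>R v k))))
     (\<lambda>x. (1 / (2 * real l)) *\<^sub>R (\<Sum>k<l. H (x + h *\<^sub>R v k) + H (x + (- h *\<^sub>R v k))))"
    by (intro C2_on_cmul C2_on_sum C2_on_add C2_on_shift_UNIV assms) auto
  then show ?thesis by (simp add: walk_def[abs_def])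
qed

lemma Sym2_sum: "(\<And>k. k \<in> A \<Longrightarrow> f k \<in> Sym2) \<Longrightarrow> sum f A \<in> Sym2"
  by (simp add: Sym2_iff)

lemma Sym2_walk: "(\<And>x. H x \<in> Sym2) \<Longrightarrow> walk v l h H x \<in> Sym2"
  unfolding walk_def by (intro Sym2_scaleR Sym2_sum Sym2_add) auto

definition C2_sym :: "(real^'n \<Rightarrow> real) \<Rightarrow> (real^'n \<Rightarrow> real^'n) \<Rightarrow> (real^'n \<Rightarrow> real^'n^'n) \<Rightarrow> bool" where
  "C2_sym \<phi> D H \<longleftrightarrow> C2_on UNIV \<phi> D H \<and> (\<forall>x. H x \<in> Sym2)"

definition osc_le :: "('a::real_normed_vector \<Rightarrow> 'b::real_normed_vector) \<Rightarrow> real \<Rightarrow> real \<Rightarrow> bool" where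
  "osc_le H d \<omega> \<longleftrightarrow> (\<forall>x y. norm (x - y) \<le> d \<longrightarrow> norm (H x - H y) \<le> \<omega>)"

lemma osc_le_walk:
  assumes "0 < l" "osc_le H d \<omega>"
  shows "osc_le (walk v l h H :: 'a::real_normed_vector \<Rightarrow> 'b::real_normed_vector) d \<omega>"
  unfolding osc_le_def
proof (intro allI impI)
  fix x y :: 'a assume xy: "norm (x - y) \<le> d"
  have "walk v l h H x - walk v l h H y = walk v l h (\<lambda>z. H z - H (z + (y - x))) x"
    by (simp add: walk_def scaleR_diff_right[symmetric] sum_subtractf[symmetric] algebra_simps)
  also have "norm \<dots> \<le> \<omega>"
    by (rule walk_le_of_le[OF assms(1)]) (use assms(2) xy in \<open>auto simp: osc_le_def norm_minus_commute\<close>)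
  finally show "norm (walk v l h H x - walk v l h H y) \<le> \<omega>" .
qed

lemma abs_quadratic_form_le: "\<bar>v \<bullet> ((A::real^'n^'n) *v v)\<bar> \<le> norm A * (norm v)\<^sup>2"
proof -
  have "\<bar>v \<bullet> (A *v v)\<bar> \<le> norm v * norm (A *v v)" by (rule Cauchy_Schwarz_ineq2)
  also have "\<dots> \<le> norm v * (norm A * norm v)" by (intro mult_left_mono norm_matrix_vector_mult) simp
  finally show ?thesis by (simp add: power2_eq_square mult_ac)
qed

text \<open>A parabolic maximum principle for \<open>(h, x) \<mapsto> u x - walk v l h \<phi> x - (\<kappa>\<^sup>2 \<omega> + \<delta>) h\<^sup>2 - \<delta>\<close>. At a positive
  maximum the subsolution property forces second derivatives of \<open>\<phi>\<close> along the \<open>v\<^sub>k\<close>, averaged over \<open>k\<close>, to be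
  at least \<open>- \<kappa>\<^sup>2 \<omega>\<close>; the derivative in \<open>h\<close> forces them to be at most \<open>- 2 (\<kappa>\<^sup>2 \<omega> + \<delta>)\<close>. The maximum exists because
  \<open>u\<close> agrees with the midpoint convex \<open>q\<close> outside a ball and the walk does not decrease \<open>q\<close>.\<close>

lemma walk_step:
  fixes u q \<phi> :: "real^'n \<Rightarrow> real"
  assumes u: "subsolution F UNIV (\<lambda>x. ereal (u x))"
    and qu: "\<And>x. q x \<le> u x" "\<And>x. R \<le> norm x \<Longrightarrow> u x = q x"
    and q: "\<And>x a. 2 * q x \<le> q (x + a) + q (x - a)"
    and l: "0 < l" and F: "\<And>B. B \<in> F \<Longrightarrow> 0 \<le> (\<Sum>k<l. v k \<bullet> (B *v v k))"
    and \<kappa>: "\<And>k. k < l \<Longrightarrow> norm (v k) \<le> \<kappa>"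
    and C2: "C2_sym \<phi> D H" and osc: "osc_le H (2 * h0 * \<kappa>) \<omega>" and h0: "0 \<le> h0"
    and u\<phi>: "\<And>x. u x \<le> \<phi> x"
  shows "u x \<le> walk v l h0 \<phi> x + \<kappa>\<^sup>2 * \<omega> * h0\<^sup>2"
proof -
  have \<kappa>0: "0 \<le> \<kappa>" using \<kappa>[OF l] norm_ge_zero order_trans by blast
  have \<omega>: "0 \<le> \<omega>" using osc h0 \<kappa>0 unfolding osc_le_def by (metis diff_self mult_nonneg_nonneg norm_zero zero_le_numeral)
  have C2': "C2_on UNIV \<phi> D H" and sym: "\<And>x. H x \<in> Sym2" using C2 by (auto simp: C2_sym_def)
  note \<phi> = C2_onD[OF C2']
  have le: "u x1 \<le> walk v l h1 \<phi> x1 + (\<kappa>\<^sup>2 * \<omega> + \<delta>) * h1\<^sup>2 + \<delta>"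
    if \<delta>: "0 < \<delta>" and h1: "h1 \<in> {0..h0}" for \<delta> h1 x1
  proof (rule ccontr)
    define w where "w h x = walk v l h \<phi> x + (\<kappa>\<^sup>2 * \<omega> + \<delta>) * h\<^sup>2 + \<delta>" for h x
    assume "\<not> ?thesis"
    then have gt: "w h1 x1 < u x1" by (simp add: w_def)
    have outside: "u x < w h x" if "R \<le> norm x" for h x
    proof -
      have "q x \<le> walk v l h q x" by (rule walk_convex[OF l q])
      also have "\<dots> \<le> walk v l h \<phi> x" by (rule walk_mono) (meson qu(1) u\<phi> order_trans)
      finally have "u x \<le> walk v l h \<phi> x" using qu(2)[OF that] by simp
      moreover have "0 \<le> (\<kappa>\<^sup>2 * \<omega> + \<delta>) * h\<^sup>2" using \<omega> \<delta> by simp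
      ultimately show ?thesis using \<delta> unfolding w_def by linarith
    qed
    have x1: "norm x1 < R" using outside[of x1 h1] gt by (meson less_asym not_le)
    define K where "K = {0..h0} \<times> cball (0::real^'n) R"
    have K: "compact K" "(h1, x1) \<in> K" using h1 x1 by (auto simp: K_def compact_Times)
    have "usc_on K (\<lambda>z. ereal (u (snd z)) - ereal (w (fst z) (snd z)))"
    proof (rule usc_on_diff_continuous)
      show "usc_on K (\<lambda>z. ereal (u (snd z)))"
        using usc_on_compose[OF subsolutionD(3)[OF u], of K snd] by (simp add: continuous_on_snd[OF continuous_on_id])
      show "continuous_on K (\<lambda>z. w (fst z) (snd z))"
        unfolding w_def walk_def
        by (intro continuous_intros continuous_on_compose2[OF \<phi>(6)]) auto
    qed
    from usc_on_attains_sup[OF this K(1)] K(2) obtain z where z: "z \<in> K"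
      and "\<forall>y\<in>K. ereal (u (snd y)) - ereal (w (fst y) (snd y)) \<le> ereal (u (snd z)) - ereal (w (fst z) (snd z))"
      by blast
    then have max: "\<And>y. y \<in> K \<Longrightarrow> u (snd y) - w (fst y) (snd y) \<le> u (snd z) - w (fst z) (snd z)" by simp
    obtain hs xs where hx: "z = (hs, xs)" by (cases z)
    have hs: "0 \<le> hs" "hs \<le> h0" using z by (auto simp: K_def hx)
    define \<mu> where "\<mu> = u xs - w hs xs"
    have \<mu>: "0 < \<mu>" using max[OF K(2)] gt by (simp add: hx \<mu>_def)
    have all: "u x \<le> w h x + \<mu>" if "h \<in> {0..h0}" for h x
    proof (cases "R \<le> norm x")
      case True
      then show ?thesis using outside[OF True, of h] \<mu> by simp
    next
      case False
      then have "(h, x) \<in> K" using that by (auto simp: K_def)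
      from max[OF this] show ?thesis by (simp add: hx \<mu>_def)
    qed
    have hs_pos: "0 < hs"
    proof (rule ccontr)
      assume "\<not> 0 < hs"
      then have "hs = 0" using hs by simp
      then have "w hs xs = \<phi> xs + \<delta>" by (simp add: w_def walk_0[OF l])
      then show False using u\<phi>[of xs] \<mu> \<delta> by (simp add: \<mu>_def)
    qed
    define c where "c = (\<kappa>\<^sup>2 * \<omega> + \<delta>) * hs\<^sup>2 + \<delta> + \<mu>"
    have "walk v l hs H xs + 0 \<in> F"
    proof (rule subsolutionD(4)[OF u])
      show "C2_on UNIV (\<lambda>x. walk v l hs \<phi> x + c) (\<lambda>x. walk v l hs D x + 0) (\<lambda>x. walk v l hs H x + 0)"
        by (intro C2_on_add C2_on_walk C2' C2_on_const) auto
      have "u x \<le> walk v l hs \<phi> x + c" for x using all[of hs x] hs by (simp add: w_def c_def)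
      then show "\<forall>\<^sub>F x in nhds xs. ereal (u x) \<le> ereal (walk v l hs \<phi> x + c)" by simp
      show "ereal (u xs) = ereal (walk v l hs \<phi> xs + c)" by (simp add: c_def \<mu>_def w_def)
    qed (use Sym2_walk[of H] sym in auto)
    then have spatial: "0 \<le> (\<Sum>k<l. v k \<bullet> (walk v l hs H xs *v v k))" using F by simp
    \<comment> \<open>From here on the maximum is examined in the variable \<open>h\<close>: since \<open>hs\<close> may be the right end point, only a one-sided sign of the derivative is available.\<close>
    have w_deriv: "((\<lambda>h. w h xs) has_real_derivative
       (1 / (2 * real l)) * (\<Sum>k<l. D (xs + hs *\<^sub>R v k) \<bullet> v k - D (xs - hs *\<^sub>R v k) \<bullet> v k) + (\<kappa>\<^sup>2 * \<omega> + \<delta>) * (2 * hs)) (at hs)"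
    proof -
      have p: "((\<lambda>h. \<phi> (xs + h *\<^sub>R a)) has_real_derivative D (xs + hs *\<^sub>R a) \<bullet> a) (at hs)" for a
      proof -
        have "((\<lambda>h. xs + h *\<^sub>R a) has_derivative (\<lambda>t. t *\<^sub>R a)) (at hs)"
          by (auto intro!: derivative_eq_intros)
        from has_derivative_compose[OF this \<phi>(3)[OF UNIV_I]] show ?thesis
          unfolding has_field_derivative_def by (rule has_derivative_eq_rhs, intro ext) (simp add: mult.commute)
      qed
      have m: "((\<lambda>h. \<phi> (xs - h *\<^sub>R a)) has_real_derivative - (D (xs - hs *\<^sub>R a) \<bullet> a)) (at hs)" for a
        using p[of "- a"] by simp
      have "((\<lambda>h. (1 / (2 * real l)) * (\<Sum>k<l. \<phi> (xs + h *\<^sub>R v k) + \<phi> (xs - h *\<^sub>R v k)) + (\<kappa>\<^sup>2 * \<omega> + \<delta>) * h\<^sup>2 + \<delta>)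
        has_real_derivative (1 / (2 * real l)) * (\<Sum>k<l. D (xs + hs *\<^sub>R v k) \<bullet> v k + - (D (xs - hs *\<^sub>R v k) \<bullet> v k)) + (\<kappa>\<^sup>2 * \<omega> + \<delta>) * (2 * hs) + 0) (at hs)"
        by (intro DERIV_add DERIV_cmult DERIV_sum p m DERIV_const) (auto intro!: derivative_eq_intros)
      then show ?thesis by (simp add: w_def walk_def)
    qed
    have "(1 / (2 * real l)) * (\<Sum>k<l. D (xs + hs *\<^sub>R v k) \<bullet> v k - D (xs - hs *\<^sub>R v k) \<bullet> v k) + (\<kappa>\<^sup>2 * \<omega> + \<delta>) * (2 * hs) \<le> 0" (is "?d \<le> 0")
    proof (rule ccontr)
      assume "\<not> ?d \<le> 0"
      then obtain e where e: "e > 0" "\<And>t. 0 < t \<Longrightarrow> t < e \<Longrightarrow> w (hs - t) xs < w hs xs"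
        using DERIV_pos_inc_left[OF w_deriv] by auto
      define t where "t = min (e / 2) hs"
      have t: "0 < t" "t < e" "t \<le> hs" using e hs_pos by (auto simp: t_def)
      have "w (hs - t) xs < w hs xs" by (rule e) (use t in auto)
      moreover have "u xs \<le> w (hs - t) xs + \<mu>" by (rule all) (use t hs in auto)
      ultimately show False by (simp add: \<mu>_def)
    qed
    moreover have "2 * hs * (v k \<bullet> (walk v l hs H xs *v v k) - \<kappa>\<^sup>2 * \<omega>)
        \<le> D (xs + hs *\<^sub>R v k) \<bullet> v k - D (xs - hs *\<^sub>R v k) \<bullet> v k" if k: "k < l" for k
    proof -
      have der: "((\<lambda>t. D (xs + t *\<^sub>R v k) \<bullet> v k) has_real_derivative (v k \<bullet> (H (xs + t *\<^sub>R v k) *v v k))) (at t)" for t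
      proof -
        have "((\<lambda>t. xs + t *\<^sub>R v k) has_derivative (\<lambda>s. s *\<^sub>R v k)) (at t)"
          by (auto intro!: derivative_eq_intros)
        from has_derivative_compose[OF this \<phi>(4)[OF UNIV_I]]
        have "((\<lambda>t. D (xs + t *\<^sub>R v k)) has_derivative (\<lambda>s. s *\<^sub>R (H (xs + t *\<^sub>R v k) *v v k))) (at t)"
          by (simp add: matrix_vector_mult_scaleR)
        from has_derivative_inner_left[OF this, of "v k"] show ?thesis
          unfolding has_field_derivative_def
          by (rule has_derivative_eq_rhs, intro ext) (simp add: mult.commute inner_commute)
      qed
      have "- hs < hs" using hs_pos by simp
      \<comment> \<open>The difference of gradients is a second derivative at a nearby point, which differs from the walk average of the Hessian by at most \<open>\<omega>\<close>.\<close>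
      from MVT2[OF this der] obtain s where s: "- hs < s" "s < hs"
        and mvt: "D (xs + hs *\<^sub>R v k) \<bullet> v k - D (xs + (- hs) *\<^sub>R v k) \<bullet> v k = (hs - (- hs)) * (v k \<bullet> (H (xs + s *\<^sub>R v k) *v v k))"
        by blast
      have near: "norm (H (xs + s *\<^sub>R v k) - H y) \<le> \<omega>" if "y = xs + hs *\<^sub>R v j \<or> y = xs - hs *\<^sub>R v j" "j < l" for y j
      proof -
        have "norm (s *\<^sub>R v k) \<le> h0 * \<kappa>" "norm (hs *\<^sub>R v j) \<le> h0 * \<kappa>"
          using s hs \<kappa>[OF k] \<kappa>[OF that(2)] by (auto intro!: mult_mono)
        then have "norm (s *\<^sub>R v k - hs *\<^sub>R v j) \<le> 2 * h0 * \<kappa>" "norm (s *\<^sub>R v k + hs *\<^sub>R v j) \<le> 2 * h0 * \<kappa>"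
          using norm_triangle_ineq4[of "s *\<^sub>R v k" "hs *\<^sub>R v j"] norm_triangle_ineq[of "s *\<^sub>R v k" "hs *\<^sub>R v j"]
          by linarith+
        then have "norm ((xs + s *\<^sub>R v k) - y) \<le> 2 * h0 * \<kappa>" using that(1) by (auto simp: algebra_simps)
        then show ?thesis using osc by (simp add: osc_le_def)
      qed
      define E where "E = walk v l hs (\<lambda>y. H y - H (xs + s *\<^sub>R v k)) xs"
      have "norm E \<le> \<omega>"
        unfolding E_def by (rule walk_le_of_le[OF l]) (use near in \<open>auto simp: norm_minus_commute\<close>)
      moreover have "E = walk v l hs H xs - H (xs + s *\<^sub>R v k)"
        using walk_add[of v l hs H "\<lambda>_. - H (xs + s *\<^sub>R v k)" xs] walk_const[OF l, of v hs "- H (xs + s *\<^sub>R v k)" xs]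
        by (simp add: E_def)
      moreover have "v k \<bullet> (E *v v k) \<le> norm E * (norm (v k))\<^sup>2" using abs_quadratic_form_le[of "v k" E] by simp
      moreover have "norm E * (norm (v k))\<^sup>2 \<le> \<omega> * \<kappa>\<^sup>2"
        using calculation(1) \<kappa>[OF k] by (intro mult_mono power_mono) (auto simp: \<omega>)
      ultimately have "v k \<bullet> (walk v l hs H xs *v v k) - \<kappa>\<^sup>2 * \<omega> \<le> v k \<bullet> (H (xs + s *\<^sub>R v k) *v v k)"
        by (simp add: matrix_vector_mult_diff_rdistrib inner_diff_right mult.commute)
      then have "2 * hs * (v k \<bullet> (walk v l hs H xs *v v k) - \<kappa>\<^sup>2 * \<omega>) \<le> 2 * hs * (v k \<bullet> (H (xs + s *\<^sub>R v k) *v v k))"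
        using hs_pos by (intro mult_left_mono) auto
      then show ?thesis using mvt by simp
    qed
    then have "(\<Sum>k<l. 2 * hs * (v k \<bullet> (walk v l hs H xs *v v k) - \<kappa>\<^sup>2 * \<omega>))
      \<le> (\<Sum>k<l. D (xs + hs *\<^sub>R v k) \<bullet> v k - D (xs - hs *\<^sub>R v k) \<bullet> v k)"
      by (intro sum_mono) auto
    then have "2 * hs * ((\<Sum>k<l. v k \<bullet> (walk v l hs H xs *v v k)) - l * (\<kappa>\<^sup>2 * \<omega>))
      \<le> (\<Sum>k<l. D (xs + hs *\<^sub>R v k) \<bullet> v k - D (xs - hs *\<^sub>R v k) \<bullet> v k)"
      by (simp add: sum_distrib_left[symmetric] sum_subtractf)
    moreover have "2 * hs * (- (l * (\<kappa>\<^sup>2 * \<omega>))) \<le> 2 * hs * ((\<Sum>k<l. v k \<bullet> (walk v l hs H xs *v v k)) - l * (\<kappa>\<^sup>2 * \<omega>))"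
      using spatial hs_pos by (intro mult_left_mono) auto
    ultimately have "2 * hs * (- (l * (\<kappa>\<^sup>2 * \<omega>))) \<le> (\<Sum>k<l. D (xs + hs *\<^sub>R v k) \<bullet> v k - D (xs - hs *\<^sub>R v k) \<bullet> v k)" by linarith
    then have "(1 / (2 * real l)) * (2 * hs * (- (l * (\<kappa>\<^sup>2 * \<omega>)))) \<le> (1 / (2 * real l)) * (\<Sum>k<l. D (xs + hs *\<^sub>R v k) \<bullet> v k - D (xs - hs *\<^sub>R v k) \<bullet> v k)"
      by (intro mult_left_mono) auto
    moreover have "(1 / (2 * real l)) * (2 * hs * (- (l * (\<kappa>\<^sup>2 * \<omega>)))) = - hs * (\<kappa>\<^sup>2 * \<omega>)" using l by simp
    ultimately have "- hs * (\<kappa>\<^sup>2 * \<omega>) + (\<kappa>\<^sup>2 * \<omega> + \<delta>) * (2 * hs) \<le> 0" using \<open>?d \<le> 0\<close> by linarith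
    moreover have "- hs * (\<kappa>\<^sup>2 * \<omega>) + (\<kappa>\<^sup>2 * \<omega> + \<delta>) * (2 * hs) = hs * (\<kappa>\<^sup>2 * \<omega>) + 2 * \<delta> * hs" by (simp add: algebra_simps)
    moreover have "0 \<le> hs * (\<kappa>\<^sup>2 * \<omega>)" using hs \<omega> by simp
    moreover have "0 < 2 * \<delta> * hs" using hs_pos \<delta> by simp
    ultimately show False by linarith
  qed
  have "((\<lambda>\<delta>. walk v l h0 \<phi> x + (\<kappa>\<^sup>2 * \<omega> + \<delta>) * h0\<^sup>2 + \<delta>) \<longlongrightarrow> walk v l h0 \<phi> x + (\<kappa>\<^sup>2 * \<omega> + 0) * h0\<^sup>2 + 0) (at_right 0)"
    by (intro tendsto_intros)
  moreover have "\<forall>\<^sub>F \<delta> in at_right 0. u x \<le> walk v l h0 \<phi> x + (\<kappa>\<^sup>2 * \<omega> + \<delta>) * h0\<^sup>2 + \<delta>"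
    using eventually_at_right_less[of "0::real"] by eventually_elim (use le h0 in auto)
  ultimately have "u x \<le> walk v l h0 \<phi> x + (\<kappa>\<^sup>2 * \<omega> + 0) * h0\<^sup>2 + 0"
    by (intro tendsto_lowerbound) auto
  then show ?thesis by simp
qed

lemma C2_sym_add_const: "C2_sym \<phi> D H \<Longrightarrow> C2_sym (\<lambda>x. \<phi> x + c) D H"
  using C2_on_add[OF _ C2_on_const, of UNIV \<phi> D H c] by (auto simp: C2_sym_def)

lemma C2_sym_walk: "C2_sym \<phi> D H \<Longrightarrow> C2_sym (walk v l h \<phi>) (walk v l h D) (walk v l h H)"
  by (auto simp: C2_sym_def intro: C2_on_walk Sym2_walk)

text \<open>The walk preserves the regularity of \<open>\<phi>\<close> and the bound on the oscillation of its Hessian, so the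
  one-step estimate can be repeated with the same constants.\<close>

lemma walk_iterate:
  fixes u q \<phi> :: "real^'n \<Rightarrow> real"
  assumes u: "subsolution F UNIV (\<lambda>x. ereal (u x))"
    and qu: "\<And>x. q x \<le> u x" "\<And>x. R \<le> norm x \<Longrightarrow> u x = q x"
    and q: "\<And>x a. 2 * q x \<le> q (x + a) + q (x - a)"
    and l: "0 < l" and F: "\<And>B. B \<in> F \<Longrightarrow> 0 \<le> (\<Sum>k<l. v k \<bullet> (B *v v k))"
    and \<kappa>: "\<And>k. k < l \<Longrightarrow> norm (v k) \<le> \<kappa>"
    and C2: "C2_sym \<phi> D H" and osc: "osc_le H (2 * h * \<kappa>) \<omega>" and h: "0 \<le> h"
    and u\<phi>: "\<And>x. u x \<le> \<phi> x"
  shows "u x \<le> ((walk v l h ^^ j) \<phi>) x + real j * (\<kappa>\<^sup>2 * \<omega> * h\<^sup>2)"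
proof -
  have "\<exists>D H. C2_sym ((walk v l h ^^ j) \<phi>) D H \<and> osc_le H (2 * h * \<kappa>) \<omega> \<and>
    (\<forall>x. u x \<le> ((walk v l h ^^ j) \<phi>) x + real j * (\<kappa>\<^sup>2 * \<omega> * h\<^sup>2))"
  proof (induction j)
    case 0
    then show ?case using C2 osc u\<phi> by auto
  next
    case (Suc j)
    define c where "c = real j * (\<kappa>\<^sup>2 * \<omega> * h\<^sup>2)"
    define \<psi> where "\<psi> = (walk v l h ^^ j) \<phi>"
    from Suc obtain D H where *: "C2_sym \<psi> D H" "osc_le H (2 * h * \<kappa>) \<omega>" "\<And>x. u x \<le> \<psi> x + c"
      by (auto simp: c_def \<psi>_def)
    have "u x \<le> walk v l h (\<lambda>x. \<psi> x + c) x + \<kappa>\<^sup>2 * \<omega> * h\<^sup>2" for x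
      by (rule walk_step[OF u qu q l F \<kappa> C2_sym_add_const[OF *(1)] *(2) h]) (use * in auto)
    then have "u x \<le> walk v l h \<psi> x + real (Suc j) * (\<kappa>\<^sup>2 * \<omega> * h\<^sup>2)" for x
      by (simp add: walk_add walk_const[OF l] c_def algebra_simps)
    moreover have "C2_sym (walk v l h \<psi>) (walk v l h D) (walk v l h H)" by (rule C2_sym_walk[OF *(1)])
    moreover have "osc_le (walk v l h H) (2 * h * \<kappa>) \<omega>" by (rule osc_le_walk[OF l *(2)])
    moreover have "(walk v l h ^^ Suc j) \<phi> = walk v l h \<psi>" by (simp add: \<psi>_def)
    ultimately show ?case by metis
  qed
  then show ?thesis by blast
qed

lemma walk_iterate_mono:
  fixes f g :: "'a::real_vector \<Rightarrow> real"
  assumes "\<And>x. f x \<le> g x"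
  shows "(walk v l h ^^ j) f x \<le> (walk v l h ^^ j) g x"
  by (induction j arbitrary: x) (auto simp: assms intro!: walk_mono)

lemma walk_iterate_average:
  "(walk v l h ^^ j) (\<lambda>x. (1 / real m) *\<^sub>R (\<Sum>i<m. f i x)) x = (1 / real m) *\<^sub>R (\<Sum>i<m. (walk v l h ^^ j) (f i) x)"
proof (induction j arbitrary: x)
  case (Suc j)
  then have "(walk v l h ^^ j) (\<lambda>x. (1 / real m) *\<^sub>R (\<Sum>i<m. f i x)) = (\<lambda>x. (1 / real m) *\<^sub>R (\<Sum>i<m. (walk v l h ^^ j) (f i) x))"
    by (rule ext)
  then show ?case by (simp only: funpow.simps o_apply walk_scaleR walk_sum)
qed simp

text \<open>The second and fourth moments of one step, as an inequality between polynomials of the same form.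
  The mixed terms are controlled by the Cauchy-Schwarz inequality.\<close>

lemma walk_quartic:
  fixes x0 D :: "real^'n" and H :: "real^'n^'n"
  assumes l: "0 < l" and \<kappa>: "\<And>k. k < l \<Longrightarrow> norm (v k) \<le> \<kappa>" and N: "0 \<le> N" and c: "0 \<le> c"
    and H: "H \<in> Sym2"
  defines "P \<equiv> \<lambda>a c x. a + D \<bullet> (x - x0) + (1/2) * ((x - x0) \<bullet> (H *v (x - x0))) + c * ((x - x0) \<bullet> (x - x0)) + N * ((x - x0) \<bullet> (x - x0))\<^sup>2"
  shows "walk v l h (P a c) x \<le> P (a + h\<^sup>2 * ((1 / (2 * real l)) * (\<Sum>k<l. v k \<bullet> (H *v v k)) + c * \<kappa>\<^sup>2) + N * h^4 * \<kappa>^4)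
     (c + 6 * N * h\<^sup>2 * \<kappa>\<^sup>2) x"
proof -
  define y where "y = x - x0"
  define A where "A = 2 * (c * h\<^sup>2 * \<kappa>\<^sup>2) + N * (12 * h\<^sup>2 * \<kappa>\<^sup>2 * (y \<bullet> y) + 2 * (h^4 * \<kappa>^4))"
  have *: "P a c (x + h *\<^sub>R v k) + P a c (x - h *\<^sub>R v k) \<le> 2 * P a c x + h\<^sup>2 * (v k \<bullet> (H *v v k)) + A" if k: "k < l" for k
  proof -
    define w where "w = v k"
    define s where "s = w \<bullet> w"
    define t where "t = y \<bullet> w"
    have s: "0 \<le> s" "s \<le> \<kappa>\<^sup>2"
      using \<kappa>[OF k] by (auto simp: s_def w_def power2_norm_eq_inner[symmetric] intro: power_mono)
    have t: "t\<^sup>2 \<le> (y \<bullet> y) * s" unfolding t_def s_def by (rule Cauchy_Schwarz_ineq)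
    have pl: "x + h *\<^sub>R v k - x0 = y + h *\<^sub>R w" "x - h *\<^sub>R v k - x0 = y - h *\<^sub>R w" "x - x0 = y"
      by (auto simp: y_def w_def)
    have Hc: "w \<bullet> (H *v y) = y \<bullet> (H *v w)" by (rule Sym2_inner_commute[OF H])
    have n1: "(y + h *\<^sub>R w) \<bullet> (y + h *\<^sub>R w) = (y \<bullet> y + h\<^sup>2 * s) + 2 * h * t"
      "(y - h *\<^sub>R w) \<bullet> (y - h *\<^sub>R w) = (y \<bullet> y + h\<^sup>2 * s) - 2 * h * t"
      by (simp_all add: inner_add_left inner_add_right inner_diff_left inner_diff_right s_def t_def inner_commute power2_eq_square)
    have n2: "(y + h *\<^sub>R w) \<bullet> (H *v (y + h *\<^sub>R w)) + (y - h *\<^sub>R w) \<bullet> (H *v (y - h *\<^sub>R w)) = 2 * (y \<bullet> (H *v y)) + 2 * h\<^sup>2 * (w \<bullet> (H *v w))"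
      by (simp add: matrix_vector_right_distrib matrix_vector_mult_diff_distrib matrix_vector_mult_scaleR
          inner_add_left inner_add_right inner_diff_left inner_diff_right Hc power2_eq_square algebra_simps)
    have sq: "((y \<bullet> y + h\<^sup>2 * s) + 2 * h * t)\<^sup>2 + ((y \<bullet> y + h\<^sup>2 * s) - 2 * h * t)\<^sup>2
       = 2 * (y \<bullet> y)\<^sup>2 + 4 * h\<^sup>2 * s * (y \<bullet> y) + 2 * (h\<^sup>2 * s)\<^sup>2 + 8 * h\<^sup>2 * t\<^sup>2"
      by (simp add: power2_eq_square algebra_simps)
    have "P a c (x + h *\<^sub>R v k) + P a c (x - h *\<^sub>R v k)
      = 2 * a + 2 * (D \<bullet> y) + (1/2) * (2 * (y \<bullet> (H *v y)) + 2 * h\<^sup>2 * (w \<bullet> (H *v w))) + c * (2 * (y \<bullet> y) + 2 * (h\<^sup>2 * s))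
        + N * (2 * (y \<bullet> y)\<^sup>2 + 4 * h\<^sup>2 * s * (y \<bullet> y) + 2 * (h\<^sup>2 * s)\<^sup>2 + 8 * h\<^sup>2 * t\<^sup>2)"
      unfolding P_def pl n2[symmetric] n1 sq[symmetric]
      by (simp add: inner_add_right inner_diff_right algebra_simps)
    also have "\<dots> = 2 * P a c x + h\<^sup>2 * (w \<bullet> (H *v w)) + 2 * (c * h\<^sup>2 * s) + N * (4 * h\<^sup>2 * s * (y \<bullet> y) + 2 * (h\<^sup>2 * s)\<^sup>2 + 8 * h\<^sup>2 * t\<^sup>2)"
      unfolding P_def pl by (simp add: algebra_simps)
    also have "\<dots> \<le> 2 * P a c x + h\<^sup>2 * (w \<bullet> (H *v w)) + A"
    proof -
      have e1: "c * h\<^sup>2 * s \<le> c * h\<^sup>2 * \<kappa>\<^sup>2" using s c by (intro mult_left_mono) auto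
      have e2: "h\<^sup>2 * s * (y \<bullet> y) \<le> h\<^sup>2 * \<kappa>\<^sup>2 * (y \<bullet> y)" using s by (intro mult_right_mono mult_left_mono) auto
      have e3: "h\<^sup>2 * t\<^sup>2 \<le> h\<^sup>2 * s * (y \<bullet> y)" using mult_left_mono[OF t, of "h\<^sup>2"] by (simp add: mult_ac)
      have "(h\<^sup>2 * s)\<^sup>2 \<le> (h\<^sup>2 * \<kappa>\<^sup>2)\<^sup>2" using s by (intro power_mono mult_left_mono) auto
      then have e4: "(h\<^sup>2 * s)\<^sup>2 \<le> h^4 * \<kappa>^4" by (simp add: power_mult_distrib power_mult[symmetric])
      have "4 * h\<^sup>2 * s * (y \<bullet> y) + 2 * (h\<^sup>2 * s)\<^sup>2 + 8 * h\<^sup>2 * t\<^sup>2 \<le> 12 * h\<^sup>2 * \<kappa>\<^sup>2 * (y \<bullet> y) + 2 * (h^4 * \<kappa>^4)"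
        using e2 e3 e4 by (simp add: mult.assoc)
      from mult_left_mono[OF this N] e1 show ?thesis unfolding A_def by linarith
    qed
    finally show ?thesis by (simp add: w_def)
  qed
  have "(\<Sum>k<l. P a c (x + h *\<^sub>R v k) + P a c (x - h *\<^sub>R v k)) \<le> (\<Sum>k<l. 2 * P a c x + h\<^sup>2 * (v k \<bullet> (H *v v k)) + A)"
    by (rule sum_mono) (use * in auto)
  also have "\<dots> = l * (2 * P a c x + A) + h\<^sup>2 * (\<Sum>k<l. v k \<bullet> (H *v v k))"
    by (simp add: sum.distrib sum_distrib_left[symmetric] algebra_simps)
  finally have "walk v l h (P a c) x \<le> (1 / (2 * real l)) * (l * (2 * P a c x + A) + h\<^sup>2 * (\<Sum>k<l. v k \<bullet> (H *v v k)))"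
    unfolding walk_def real_scaleR_def by (rule mult_left_mono) simp
  also have "\<dots> = P a c x + A / 2 + h\<^sup>2 * ((1 / (2 * real l)) * (\<Sum>k<l. v k \<bullet> (H *v v k)))"
    using l by (simp add: field_simps)
  also have "\<dots> = P (a + h\<^sup>2 * ((1 / (2 * real l)) * (\<Sum>k<l. v k \<bullet> (H *v v k)) + c * \<kappa>\<^sup>2) + N * h^4 * \<kappa>^4) (c + 6 * N * h\<^sup>2 * \<kappa>\<^sup>2) x"
    unfolding P_def y_def[symmetric] A_def by (simp add: algebra_simps)
  finally show ?thesis .
qed

text \<open>The constant and the quadratic coefficient after \<open>j\<close> steps have a closed form. The point is that the
  quartic term contributes only the square of the elapsed time \<open>j h\<^sup>2\<close>.\<close>

lemma walk_iterate_quartic: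
  fixes x0 D :: "real^'n" and H :: "real^'n^'n"
  assumes l: "0 < l" and \<kappa>: "\<And>k. k < l \<Longrightarrow> norm (v k) \<le> \<kappa>" and N: "0 \<le> N" and c: "0 \<le> c"
    and H: "H \<in> Sym2"
  defines "P \<equiv> \<lambda>a c x. a + D \<bullet> (x - x0) + (1/2) * ((x - x0) \<bullet> (H *v (x - x0))) + c * ((x - x0) \<bullet> (x - x0)) + N * ((x - x0) \<bullet> (x - x0))\<^sup>2"
    and "\<beta> \<equiv> (1 / (2 * real l)) * (\<Sum>k<l. v k \<bullet> (H *v v k)) + c * \<kappa>\<^sup>2"
  shows "(walk v l h ^^ j) (P a c) x0 \<le> a + (j * h\<^sup>2) * \<beta> + 3 * N * \<kappa>^4 * (j * h\<^sup>2)\<^sup>2"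
proof -
  define aj where "aj j = a + (real j * h\<^sup>2) * \<beta> + 3 * N * \<kappa>^4 * (real j * h\<^sup>2)\<^sup>2" for j
  define cj where "cj j = c + 6 * N * h\<^sup>2 * \<kappa>\<^sup>2 * real j" for j
  have cj: "0 \<le> cj j" for j using c N by (simp add: cj_def)
  have "(walk v l h ^^ j) (P a c) x \<le> P (aj j) (cj j) x" for x
  proof (induction j arbitrary: x)
    case (Suc j)
    have "(walk v l h ^^ Suc j) (P a c) x \<le> walk v l h (P (aj j) (cj j)) x"
      using walk_mono[OF Suc] by simp
    also have "\<dots> \<le> P (aj j + h\<^sup>2 * ((1 / (2 * real l)) * (\<Sum>k<l. v k \<bullet> (H *v v k)) + cj j * \<kappa>\<^sup>2) + N * h^4 * \<kappa>^4)
     (cj j + 6 * N * h\<^sup>2 * \<kappa>\<^sup>2) x"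
      unfolding P_def by (rule walk_quartic[OF l \<kappa> N cj H])
    also have "cj j + 6 * N * h\<^sup>2 * \<kappa>\<^sup>2 = cj (Suc j)" by (simp add: cj_def algebra_simps)
    also have "P (aj j + h\<^sup>2 * ((1 / (2 * real l)) * (\<Sum>k<l. v k \<bullet> (H *v v k)) + cj j * \<kappa>\<^sup>2) + N * h^4 * \<kappa>^4) (cj (Suc j)) x
      \<le> P (aj (Suc j)) (cj (Suc j)) x"
    proof -
      have h4: "h^4 = h\<^sup>2 * h\<^sup>2" "\<kappa>^4 = \<kappa>\<^sup>2 * \<kappa>\<^sup>2" by (simp_all add: power2_eq_square power4_eq_xxxx)
      have "aj (Suc j) - (aj j + h\<^sup>2 * ((1 / (2 * real l)) * (\<Sum>k<l. v k \<bullet> (H *v v k)) + cj j * \<kappa>\<^sup>2) + N * h^4 * \<kappa>^4)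
         = 2 * N * \<kappa>^4 * h^4"
        unfolding aj_def cj_def \<beta>_def h4 by (simp add: algebra_simps power2_eq_square add_divide_distrib)
      also have "\<dots> \<ge> 0" using N by simp
      finally show ?thesis by (simp add: P_def)
    qed
    finally show ?case .
  qed (simp add: aj_def cj_def)
  from this[of x0] show ?thesis by (simp add: P_def aj_def)
qed

section \<open>Smooth majorants of upper semicontinuous functions\<close>

lemma max_0_power_deriv:
  "((\<lambda>t::real. (max 0 t) ^ Suc (Suc n)) has_field_derivative real (Suc (Suc n)) * (max 0 t) ^ Suc n) (at t)"
proof -
  consider "t > 0" | "t < 0" | "t = 0" by linarith
  then show ?thesis
  proof cases
    case 1
    have ev: "\<forall>\<^sub>F s in nhds t. (max 0 s) ^ Suc (Suc n) = s ^ Suc (Suc n)"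
      using eventually_nhds_in_open[of "{0<..}" t] 1 by (auto elim!: eventually_mono simp: max_def)
    moreover have "((\<lambda>s. s ^ Suc (Suc n)) has_field_derivative real (Suc (Suc n)) * t ^ Suc n) (at t)"
      by (rule derivative_eq_intros | simp)+
    ultimately show ?thesis using 1 by (subst DERIV_cong_ev[OF refl ev refl]) (simp add: max_def)
  next
    case 2
    have ev: "\<forall>\<^sub>F s in nhds t. (max 0 s) ^ Suc (Suc n) = 0"
      using eventually_nhds_in_open[of "{..<0}" t] 2 by (auto elim!: eventually_mono simp: max_def)
    show ?thesis using 2 by (subst DERIV_cong_ev[OF refl ev refl]) (simp add: max_def)
  next
    case 3
    have "((\<lambda>h::real. (max 0 h) ^ Suc n) \<longlongrightarrow> (max 0 0) ^ Suc n) (at 0)" by (intro tendsto_intros)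
    moreover have "\<forall>\<^sub>F h::real in at 0. (max 0 h) ^ Suc n = ((max 0 (0 + h)) ^ Suc (Suc n) - (max 0 0) ^ Suc (Suc n)) / h"
      by (rule eventually_at_filter[THEN iffD2], rule always_eventually) (auto simp: max_def)
    ultimately have "((\<lambda>h. ((max 0 (0 + h)) ^ Suc (Suc n) - (max 0 0) ^ Suc (Suc n)) / h) \<longlongrightarrow> 0) (at (0::real))"
      by (subst (asm) tendsto_cong) auto
    then show ?thesis using 3 unfolding DERIV_def by simp
  qed
qed

lemma C2_cutoff:
  fixes \<rho> :: real
  obtains b D H where "C2_sym (b :: real^'n \<Rightarrow> real) D H" "b = (\<lambda>x. (max 0 (\<rho>\<^sup>2 - x \<bullet> x)) ^ 3)"
    "\<And>x. \<rho>\<^sup>2 \<le> x \<bullet> x \<Longrightarrow> D x = 0 \<and> H x = 0"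
proof -
  have f: "C2_on UNIV (\<lambda>x::real^'n. \<rho>\<^sup>2 + (-1) * (x \<bullet> x)) (\<lambda>x. 0 + (-1) *\<^sub>R (2 *\<^sub>R x)) (\<lambda>x. 0 + (-1) *\<^sub>R (2 *\<^sub>R mat 1))"
    by (intro C2_on_add C2_on_const C2_on_cmul C2_on_norm_sq) auto
  define k where "k t = (max 0 t) ^ 3" for t :: real
  define k' where "k' t = 3 * (max 0 t)\<^sup>2" for t :: real
  define k'' where "k'' t = 6 * max 0 t" for t :: real
  have dk: "(k has_field_derivative k' t) (at t)" for t
    using max_0_power_deriv[of 1 t] by (simp add: k_def[abs_def] k'_def numeral_eq_Suc)
  have dk': "(k' has_field_derivative k'' t) (at t)" for t
    using DERIV_cmult[OF max_0_power_deriv[of 0 t], of 3] by (simp add: k'_def[abs_def] k''_def numeral_eq_Suc)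
  have ck: "continuous_on A k''" for A unfolding k''_def by (intro continuous_intros)
  note C2 = C2_on_compose[OF f dk dk' ck]
  define D where "D x = k' (\<rho>\<^sup>2 + (-1) * (x \<bullet> x)) *\<^sub>R (0 + (-1) *\<^sub>R (2 *\<^sub>R x))" for x :: "real^'n"
  define H where "H x = k' (\<rho>\<^sup>2 + (-1) * (x \<bullet> x)) *\<^sub>R (0 + (-1) *\<^sub>R (2 *\<^sub>R mat 1)) +
    k'' (\<rho>\<^sup>2 + (-1) * (x \<bullet> x)) *\<^sub>R outer (0 + (-1) *\<^sub>R (2 *\<^sub>R x)) (0 + (-1) *\<^sub>R (2 *\<^sub>R x))" for x :: "real^'n"
  have "C2_on UNIV (\<lambda>x. k (\<rho>\<^sup>2 + (-1) * (x \<bullet> x))) D H"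
    using C2 by (simp add: D_def[abs_def] H_def[abs_def])
  moreover have "H x \<in> Sym2" for x
    unfolding H_def by (intro Sym2_add Sym2_scaleR Sym2_mat Sym2_outer Sym2_0)
  moreover have "D x = 0 \<and> H x = 0" if "\<rho>\<^sup>2 \<le> x \<bullet> x" for x
    using that by (simp add: D_def H_def k'_def k''_def)
  ultimately show thesis
    by (intro that[of "\<lambda>x. (max 0 (\<rho>\<^sup>2 - x \<bullet> x)) ^ 3" D H]) (auto simp: C2_sym_def k_def)
qed

lemma C2_sym_mult:
  assumes "C2_sym f D H" "C2_sym g D' H'"
  shows "C2_sym (\<lambda>x. f x * g x) (\<lambda>x. f x *\<^sub>R D' x + g x *\<^sub>R D x)
    (\<lambda>x. f x *\<^sub>R H' x + g x *\<^sub>R H x + (outer (D x) (D' x) + outer (D' x) (D x)))"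
  using assms by (auto simp: C2_sym_def intro!: C2_on_mult Sym2_add Sym2_scaleR Sym2_outer2)

lemma C2_sym_add:
  "C2_sym f D H \<Longrightarrow> C2_sym g D' H' \<Longrightarrow> C2_sym (\<lambda>x. f x + g x) (\<lambda>x. D x + D' x) (\<lambda>x. H x + H' x)"
  by (auto simp: C2_sym_def intro!: C2_on_add Sym2_add)

text \<open>\<open>C\<^sup>2\<close> functions form an algebra that separates points, so Stone-Weierstrass applies to them directly.\<close>

lemma C2_approximation:
  fixes f :: "real^'n \<Rightarrow> real"
  assumes K: "compact K" and f: "continuous_on K f" and e: "0 < e"
  obtains g D H where "C2_sym g D H" "\<And>x. x \<in> K \<Longrightarrow> \<bar>f x - g x\<bar> < e"
proof -
  define P where "P g \<longleftrightarrow> (\<exists>D H. C2_sym g D H)" for g :: "real^'n \<Rightarrow> real"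
  have "\<exists>g. P g \<and> (\<forall>x\<in>K. \<bar>f x - g x\<bar> < e)"
  proof (rule Stone_Weierstrass_HOL[OF K _ _ _ _ _ f e])
    show "P (\<lambda>x. c)" for c
      unfolding P_def C2_sym_def using C2_on_const[of UNIV c] Sym2_0 by auto
    show "continuous_on K g" if "P g" for g
      using that C2_onD(6) unfolding P_def C2_sym_def by (meson continuous_on_subset top_greatest)
    show "P (\<lambda>x. f x + g x)" if "P f \<and> P g" for f g
      using that C2_sym_add unfolding P_def by blast
    show "P (\<lambda>x. f x * g x)" if "P f \<and> P g" for f g
      using that C2_sym_mult unfolding P_def by blast
    show "\<exists>f. P f \<and> f x \<noteq> f y" if "x \<in> K \<and> y \<in> K \<and> x \<noteq> y" for x y
    proof (intro exI[of _ "\<lambda>z. (x - y) \<bullet> z"] conjI)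
      show "P (\<lambda>z. (x - y) \<bullet> z)"
        unfolding P_def C2_sym_def using C2_on_linear[of UNIV "x - y"] Sym2_0 by auto
      have "(x - y) \<bullet> (x - y) \<noteq> 0" using that by simp
      then show "(x - y) \<bullet> x \<noteq> (x - y) \<bullet> y" by (simp add: inner_diff_right)
    qed
  qed
  then show thesis using that unfolding P_def by blast
qed

text \<open>The quotient of \<open>\<xi>\<close> by a \<open>C\<^sup>2\<close> cutoff \<open>b\<close> is approximated from above, and the approximation is
  multiplied by \<open>b\<close> again. This keeps the Hessian compactly supported, hence uniformly continuous.\<close>

lemma C2_majorant:
  fixes \<xi> :: "real^'n \<Rightarrow> real"
  assumes \<xi>: "continuous_on UNIV \<xi>" "\<And>x. \<rho> \<le> norm x \<Longrightarrow> \<xi> x = 0"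
    and \<rho>: "0 < \<rho>" and e: "0 < e"
  obtains \<phi> D H where "C2_sym \<phi> D H" "\<And>x. \<xi> x \<le> \<phi> x" "\<And>x. \<phi> x \<le> \<xi> x + e"
    "\<And>x. \<rho> + 1 \<le> norm x \<Longrightarrow> H x = 0"
proof -
  obtain b Db Hb where b: "C2_sym (b :: real^'n \<Rightarrow> real) Db Hb" and b_eq: "b = (\<lambda>x. (max 0 ((\<rho> + 1)\<^sup>2 - x \<bullet> x)) ^ 3)"
    and b0: "\<And>x. (\<rho> + 1)\<^sup>2 \<le> x \<bullet> x \<Longrightarrow> Db x = 0 \<and> Hb x = 0"
    by (rule C2_cutoff[of "\<rho> + 1"]) blast
  \<comment> \<open>A lower bound for \<open>b\<close> where \<open>\<xi>\<close> may be nonzero: there \<open>max m (b x)\<close> is \<open>b x\<close>, and dividing by it is continuous everywhere.\<close>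
  define m where "m = ((\<rho> + 1)\<^sup>2 - \<rho>\<^sup>2) ^ 3"
  have m: "0 < m" using \<rho> unfolding m_def by (simp add: power2_eq_square algebra_simps)
  have b_cont: "continuous_on A b" for A unfolding b_eq by (intro continuous_intros)
  have b_nonneg: "0 \<le> b x" for x by (simp add: b_eq)
  have b_le: "b x \<le> (\<rho> + 1) ^ 6" for x
  proof -
    have "b x \<le> ((\<rho> + 1)\<^sup>2) ^ 3" unfolding b_eq by (intro power_mono) auto
    then show ?thesis by (simp add: power_mult[symmetric])
  qed
  define e' where "e' = e / (2 * (\<rho> + 1) ^ 6)"
  have e': "0 < e'" using e \<rho> by (simp add: e'_def)
  define f where "f x = \<xi> x / max m (b x) + e'" for x
  have "continuous_on (cball 0 (\<rho> + 1)) f"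
    unfolding f_def using m by (intro continuous_intros b_cont continuous_on_subset[OF \<xi>(1)]) (auto simp: max_def)
  then obtain g Dg Hg where g: "C2_sym g Dg Hg" and fg: "\<And>x. x \<in> cball 0 (\<rho> + 1) \<Longrightarrow> \<bar>f x - g x\<bar> < e'"
    using C2_approximation[OF compact_cball _ e'] by metis
  have bf: "b x * f x = \<xi> x + b x * e'" for x
  proof (cases "norm x \<le> \<rho>")
    case True
    then have "x \<bullet> x \<le> \<rho>\<^sup>2" using \<rho> by (simp add: power2_norm_eq_inner[symmetric] power_mono)
    then have "m \<le> b x" unfolding m_def b_eq using \<rho> by (intro power_mono) (auto simp: power2_eq_square algebra_simps)
    then show ?thesis using m by (simp add: f_def max_def algebra_simps)
  next
    case False
    then show ?thesis using \<xi>(2)[of x] by (simp add: f_def)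
  qed
  have out: "(\<rho> + 1)\<^sup>2 \<le> x \<bullet> x" if "\<rho> + 1 \<le> norm x" for x :: "real^'n"
    using that \<rho> by (simp add: power2_norm_eq_inner[symmetric] power_mono)
  show thesis
  proof (rule that[OF C2_sym_mult[OF b g]])
    fix x :: "real^'n"
    consider "norm x \<le> \<rho> + 1" | "\<rho> + 1 \<le> norm x" by linarith
    then have "\<xi> x \<le> b x * g x \<and> b x * g x \<le> \<xi> x + e"
    proof cases
      case 1
      then have "f x - e' \<le> g x" "g x \<le> f x + e'" using fg[of x] by auto
      then have "b x * (f x - e') \<le> b x * g x" "b x * g x \<le> b x * (f x + e')"
        using b_nonneg by (auto intro: mult_left_mono)
      moreover have "b x * e' \<le> (\<rho> + 1) ^ 6 * e'" using b_le e' by (intro mult_right_mono) auto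
      moreover have "(\<rho> + 1) ^ 6 * e' = e / 2" using \<rho> by (simp add: e'_def)
      ultimately show ?thesis using bf[of x] by (simp add: algebra_simps)
    next
      case 2
      then have "b x = 0" using out[OF 2] by (simp add: b_eq)
      then show ?thesis using \<xi>(2)[of x] 2 e by simp
    qed
    then show "\<xi> x \<le> b x * g x" "b x * g x \<le> \<xi> x + e" by auto
  next
    fix x :: "real^'n" assume "\<rho> + 1 \<le> norm x"
    from out[OF this] b0[OF out[OF this]]
    show "b x *\<^sub>R Hg x + g x *\<^sub>R Hb x + (outer (Db x) (Dg x) + outer (Dg x) (Db x)) = 0"
      by (simp add: b_eq outer_def vec_eq_iff)
  qed
qed

lemma compact_support_osc:
  fixes H :: "'a::euclidean_space \<Rightarrow> 'b::real_normed_vector"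
  assumes H: "continuous_on UNIV H" "\<And>x. \<rho> \<le> norm x \<Longrightarrow> H x = 0" and \<omega>: "0 < \<omega>"
  obtains d where "0 < d" "osc_le H d \<omega>"
proof -
  have "uniformly_continuous_on (cball 0 (\<rho> + 1)) H"
    by (intro compact_uniformly_continuous continuous_on_subset[OF H(1)]) auto
  then obtain d where d: "d > 0" "\<And>x y. x \<in> cball 0 (\<rho> + 1) \<Longrightarrow> y \<in> cball 0 (\<rho> + 1) \<Longrightarrow> dist y x < d \<Longrightarrow> dist (H y) (H x) < \<omega>"
    using \<omega> unfolding uniformly_continuous_on_def by metis
  show thesis
  proof (rule that[of "min (d / 2) 1"])
    show "osc_le H (min (d / 2) 1) \<omega>"
      unfolding osc_le_def
    proof (intro allI impI)
      fix x y :: 'a assume xy: "norm (x - y) \<le> min (d / 2) 1"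
      show "norm (H x - H y) \<le> \<omega>"
      proof (cases "norm x \<le> \<rho> \<or> norm y \<le> \<rho>")
        case True
        then have "x \<in> cball 0 (\<rho> + 1)" "y \<in> cball 0 (\<rho> + 1)"
          using xy norm_triangle_ineq3[of x y] by auto
        moreover have "dist x y < d" using xy d(1) by (simp add: dist_norm)
        ultimately have "dist (H x) (H y) < \<omega>" using d(2) by blast
        then show ?thesis by (simp add: dist_norm)
      next
        case False
        then show ?thesis using H(2)[of x] H(2)[of y] \<omega> by simp
      qed
    qed
  qed (use d in auto)
qed

text \<open>Sup-convolution: \<open>\<xi>\<^sub>k x = sup\<^sub>y (h y - (k + 1) |x - y|)\<close> is Lipschitz and decreases to \<open>h\<close> by upper
  semicontinuity.\<close>

lemma continuous_majorants:
  fixes h :: "'a::real_normed_vector \<Rightarrow> real"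
  assumes usc: "usc_on UNIV (\<lambda>x. ereal (h x))" and h: "\<And>x. 0 \<le> h x" "\<And>x. h x \<le> M"
    and R: "\<And>x. R \<le> norm x \<Longrightarrow> h x = 0"
  obtains \<xi> :: "nat \<Rightarrow> 'a \<Rightarrow> real" where "\<And>k. continuous_on UNIV (\<xi> k)" "\<And>k x. h x \<le> \<xi> k x"
    "\<And>k x. \<xi> (Suc k) x \<le> \<xi> k x" "\<And>k x. R + M \<le> norm x \<Longrightarrow> \<xi> k x = 0" "\<And>x. (\<lambda>k. \<xi> k x) \<longlonglongrightarrow> h x"
proof -
  define \<xi> where "\<xi> k x = (SUP y. h y - real (Suc k) * dist x y)" for k x
  have M: "0 \<le> M" using h order_trans by blast
  have bound: "h y - real (Suc k) * dist x y \<le> M" for k x y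
    using h(2)[of y] by (smt (verit) mult_nonneg_nonneg of_nat_0_le_iff zero_le_dist)
  then have bdd: "bdd_above (range (\<lambda>y. h y - real (Suc k) * dist x y))" for k x
    by (intro bdd_aboveI2[of _ _ M])
  have upper: "h y - real (Suc k) * dist x y \<le> \<xi> k x" for k x y
    unfolding \<xi>_def by (rule cSUP_upper[OF _ bdd]) simp
  have least: "\<xi> k x \<le> c" if "\<And>y. h y - real (Suc k) * dist x y \<le> c" for k x c
    unfolding \<xi>_def by (rule cSUP_least) (use that in auto)
  have h_le: "h x \<le> \<xi> k x" for k x using upper[of x k x] by simp
  have lip: "\<xi> k x \<le> \<xi> k y + real (Suc k) * dist x y" for k x y
  proof (rule least)
    fix z
    have "real (Suc k) * dist y z \<le> real (Suc k) * (dist x y + dist x z)"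
      by (intro mult_left_mono dist_triangle3) auto
    then show "h z - real (Suc k) * dist x z \<le> \<xi> k y + real (Suc k) * dist x y"
      using upper[of z k y] by (simp add: algebra_simps)
  qed
  show thesis
  proof (rule that[of \<xi>])
    show "continuous_on UNIV (\<xi> k)" for k
      unfolding continuous_on_iff
    proof (intro ballI allI impI)
      fix x and e :: real assume e: "0 < e"
      show "\<exists>d>0. \<forall>x'\<in>UNIV. dist x' x < d \<longrightarrow> dist (\<xi> k x') (\<xi> k x) < e"
      proof (intro exI[of _ "e / real (Suc k)"] conjI ballI impI)
        fix y assume "dist y x < e / real (Suc k)"
        then have "real (Suc k) * dist y x < e" by (simp add: pos_less_divide_eq mult.commute del: of_nat_Suc)
        then show "dist (\<xi> k y) (\<xi> k x) < e"
          using lip[of k x y] lip[of k y x] by (auto simp: dist_real_def dist_commute)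
      qed (use e in simp)
    qed
    show "h x \<le> \<xi> k x" for k x by (rule h_le)
    show "\<xi> (Suc k) x \<le> \<xi> k x" for k x
    proof (rule least)
      fix y
      have "real (Suc k) * dist x y \<le> real (Suc (Suc k)) * dist x y" by (intro mult_right_mono) auto
      then show "h y - real (Suc (Suc k)) * dist x y \<le> \<xi> k x" using upper[of y k x] by linarith
    qed
    show "\<xi> k x = 0" if x: "R + M \<le> norm x" for k x
    proof (rule antisym)
      show "0 \<le> \<xi> k x" using h_le[of x k] h(1)[of x] by linarith
      show "\<xi> k x \<le> 0"
      proof (rule least)
        fix y
        show "h y - real (Suc k) * dist x y \<le> 0"
        proof (cases "R \<le> norm y")
          case False
          then have "M \<le> dist x y" using x norm_triangle_ineq2[of x y] by (simp add: dist_norm)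
          also have "dist x y \<le> real (Suc k) * dist x y" using mult_right_mono[of 1 "real (Suc k)" "dist x y"] by simp
          finally show ?thesis using h(2)[of y] by linarith
        qed (simp add: R)
      qed
    qed
    show "(\<lambda>k. \<xi> k x) \<longlonglongrightarrow> h x" for x
    proof (rule LIMSEQ_I)
      fix e :: real assume e: "0 < e"
      have "\<forall>\<^sub>F y in at x within UNIV. ereal (h y) < ereal (h x + e / 2)"
        using usc[unfolded usc_on_def, rule_format, of x "ereal (h x + e / 2)"] e by simp
      then obtain d where d: "d > 0" "\<And>y. dist y x < d \<Longrightarrow> y \<noteq> x \<Longrightarrow> h y < h x + e / 2"
        unfolding eventually_at by auto
      obtain n :: nat where n: "M / d < real n" using reals_Archimedean2 by blast
      have "norm (\<xi> k x - h x) < e" if k: "n \<le> k" for k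
      proof -
        have "\<xi> k x \<le> h x + e / 2"
        proof (rule least)
          fix y
          show "h y - real (Suc k) * dist x y \<le> h x + e / 2"
          proof (cases "dist y x < d")
            case True
            then have "h y \<le> h x + e / 2" using d(2)[of y] e by (cases "y = x") auto
            moreover have "0 \<le> real (Suc k) * dist x y" by simp
            ultimately show ?thesis by linarith
          next
            case False
            have "M \<le> real (Suc k) * d" using n k d(1) by (simp add: pos_divide_less_eq) (smt (verit) mult_right_mono of_nat_le_iff)
            also have "\<dots> \<le> real (Suc k) * dist x y" using False by (intro mult_left_mono) (auto simp: dist_commute)
            finally show ?thesis using h(2)[of y] h(1)[of x] e by linarith
          qed
        qed
        then show ?thesis using h_le[of x k] e by simp
      qed
      then show "\<exists>no. \<forall>n\<ge>no. norm (\<xi> n x - h x) < e" by blast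
    qed
  qed
qed

text \<open>The upper half of Dini's theorem; it holds because the sets where \<open>f k \<ge> \<psi> + e\<close> are compact, nested and
  have no common point.\<close>

lemma Dini_upper:
  fixes f :: "nat \<Rightarrow> 'a::heine_borel \<Rightarrow> real"
  assumes K: "compact K" and f: "\<And>k. continuous_on K (f k)" and mono: "\<And>k x. f (Suc k) x \<le> f k x"
    and lim: "\<And>x. x \<in> K \<Longrightarrow> (\<lambda>k. f k x) \<longlonglongrightarrow> g x" and g: "\<And>x. x \<in> K \<Longrightarrow> g x \<le> \<psi> x"
    and \<psi>: "continuous_on K \<psi>" and e: "0 < e"
  obtains k where "\<And>x. x \<in> K \<Longrightarrow> f k x < \<psi> x + e"
proof (rule ccontr)
  assume neg: "\<not> thesis"
  define S where "S k = {x\<in>K. \<psi> x + e \<le> f k x}" for k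
  have "compact (S k)" for k
  proof -
    have "closed (S k)" unfolding S_def
      by (rule continuous_on_closed_Collect_le) (intro continuous_intros f \<psi> compact_imp_closed K)+
    then have "compact (K \<inter> S k)" by (rule compact_Int_closed[OF K])
    moreover have "K \<inter> S k = S k" by (auto simp: S_def)
    ultimately show ?thesis by simp
  qed
  moreover have "S k \<noteq> {}" for k
    using neg that[of k] by (force simp: S_def not_less)
  moreover have "S n \<subseteq> S m" if "m \<le> n" for m n
  proof -
    have "decseq (\<lambda>k. f k x)" for x using mono by (intro decseq_SucI)
    then have "f n x \<le> f m x" for x using that by (rule decseqD)
    then show ?thesis unfolding S_def by (auto intro: order_trans)
  qed
  ultimately have "\<Inter>(range S) \<noteq> {}" by (rule compact_nest)
  then obtain x where x: "\<And>k. x \<in> S k" by auto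
  then have "x \<in> K" by (auto simp: S_def)
  have "\<psi> x + e \<le> g x"
    by (rule LIMSEQ_le_const[OF lim[OF \<open>x \<in> K\<close>]]) (use x in \<open>auto simp: S_def\<close>)
  then show False using g[OF \<open>x \<in> K\<close>] e by simp
qed

section \<open>Averages of subsolutions\<close>

text \<open>Real-valued subsolutions on the whole space that dominate a fixed radial paraboloid and agree with it
  outside a ball. Maxima over the whole space are then attained, and rotations and averages preserve the
  class with the same paraboloid.\<close>

definition global_subsolution :: "(real^'n^'n) set \<Rightarrow> real \<Rightarrow> real \<Rightarrow> real \<Rightarrow> (real^'n \<Rightarrow> real) \<Rightarrow> bool" where
  "global_subsolution F R a N u \<longleftrightarrow> subsolution F UNIV (\<lambda>x. ereal (u x)) \<and> 0 \<le> N \<and>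
     (\<forall>x. a + N * (x \<bullet> x) \<le> u x) \<and> (\<forall>x. R \<le> norm x \<longrightarrow> u x = a + N * (x \<bullet> x))"

lemma global_subsolutionD:
  assumes "global_subsolution F R a N u"
  shows "subsolution F UNIV (\<lambda>x. ereal (u x))" "0 \<le> N" "\<And>x. a + N * (x \<bullet> x) \<le> u x"
    "\<And>x. R \<le> norm x \<Longrightarrow> u x = a + N * (x \<bullet> x)"
  using assms by (auto simp: global_subsolution_def)

lemma global_subsolution_bound:
  assumes u: "global_subsolution F R a N u"
  obtains M where "0 \<le> M" "\<And>x. u x \<le> a + N * (x \<bullet> x) + M"
proof -
  note u = global_subsolutionD[OF u]
  obtain M where M: "0 \<le> M" "\<And>x. x \<in> cball 0 R \<Longrightarrow> ereal (u x) \<le> ereal M"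
    using subsolution_bounded_above[OF u(1), of "cball 0 R"] by auto
  have "u x \<le> a + N * (x \<bullet> x) + (M + \<bar>a\<bar>)" for x
  proof (cases "R \<le> norm x")
    case False
    then have "u x \<le> M" using M(2)[of x] by simp
    moreover have "0 \<le> N * (x \<bullet> x)" using u(2) by simp
    ultimately show ?thesis by linarith
  qed (use u(4) M(1) in auto)
  with M(1) show thesis by (intro that[of "M + \<bar>a\<bar>"]) auto
qed

lemma global_subsolution_majorants:
  assumes u: "global_subsolution F R a N u" and M: "\<And>x. u x \<le> a + N * (x \<bullet> x) + M"
  obtains \<eta> :: "nat \<Rightarrow> real^'n \<Rightarrow> real" where "\<And>k. continuous_on UNIV (\<eta> k)" "\<And>k x. u x \<le> \<eta> k x"
    "\<And>k x. \<eta> (Suc k) x \<le> \<eta> k x" "\<And>k x. R + M \<le> norm x \<Longrightarrow> \<eta> k x = a + N * (x \<bullet> x)" "\<And>x. (\<lambda>k. \<eta> k x) \<longlonglongrightarrow> u x"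
proof -
  note u = global_subsolutionD[OF u]
  define q where "q x = a + N * (x \<bullet> x)" for x :: "real^'n"
  have q_cont: "continuous_on A q" for A unfolding q_def by (intro continuous_intros)
  have "usc_on UNIV (\<lambda>x. ereal (u x) - ereal (q x))"
    by (rule usc_on_diff_continuous[OF subsolutionD(3)[OF u(1)] q_cont])
  then have usc: "usc_on UNIV (\<lambda>x. ereal (u x - q x))" by simp
  obtain \<xi> :: "nat \<Rightarrow> real^'n \<Rightarrow> real" where \<xi>: "\<And>k. continuous_on UNIV (\<xi> k)" "\<And>k x. u x - q x \<le> \<xi> k x"
    "\<And>k x. \<xi> (Suc k) x \<le> \<xi> k x" "\<And>k x. R + M \<le> norm x \<Longrightarrow> \<xi> k x = 0" "\<And>x. (\<lambda>k. \<xi> k x) \<longlonglongrightarrow> u x - q x"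
  proof (rule continuous_majorants[OF usc, of M R])
    show "u x - q x \<le> M" for x using M[of x] unfolding q_def by linarith
  qed (use u in \<open>auto simp: q_def\<close>)
  show thesis
  proof (rule that[of "\<lambda>k x. \<xi> k x + q x"])
    show "continuous_on UNIV (\<lambda>x. \<xi> k x + q x)" for k by (intro continuous_intros \<xi>(1) q_cont)
    show "u x \<le> \<xi> k x + q x" for k x using \<xi>(2)[of x k] by simp
    show "(\<lambda>k. \<xi> k x + q x) \<longlonglongrightarrow> u x" for x using tendsto_add[OF \<xi>(5)[of x] tendsto_const[of "q x"]] by simp
  qed (use \<xi>(3,4) in \<open>auto simp: q_def\<close>)
qed

lemma taylor_upper:
  assumes C2: "C2_on U \<phi> D H" and x0: "x0 \<in> U" and sym: "H x0 \<in> Sym2" and \<delta>: "0 < \<delta>"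
  obtains \<rho> where "0 < \<rho>" "\<And>x. norm (x - x0) < \<rho> \<Longrightarrow>
    \<phi> x \<le> \<phi> x0 + D x0 \<bullet> (x - x0) + (1/2) * ((x - x0) \<bullet> (H x0 *v (x - x0))) + \<delta> * ((x - x0) \<bullet> (x - x0))"
proof -
  note \<phi> = C2_onD[OF C2]
  obtain d1 where d1: "d1 > 0" "ball x0 d1 \<subseteq> U" using \<phi>(1) x0 openE by blast
  obtain d2 where d2: "d2 > 0" "\<And>y. norm (y - x0) < d2 \<Longrightarrow> norm (D y - D x0 - H x0 *v (y - x0)) \<le> \<delta> * norm (y - x0)"
    using \<phi>(4)[OF x0] \<delta> unfolding has_derivative_at_alt by metis
  show thesis
  proof (rule that[of "min d1 d2"])
    fix x assume x: "norm (x - x0) < min d1 d2"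
    define y where "y = x - x0"
    have near: "norm (t *\<^sub>R y) < min d1 d2" if "0 \<le> t" "t \<le> 1" for t
    proof -
      have "\<bar>t\<bar> * norm y \<le> 1 * norm y" using that by (intro mult_right_mono) auto
      then show ?thesis using x by (simp add: y_def)
    qed
    define g where "g t = \<phi> (x0 + t *\<^sub>R y) - t * (D x0 \<bullet> y) - (t\<^sup>2 / 2) * (y \<bullet> (H x0 *v y))" for t
    have der: "(g has_real_derivative D (x0 + t *\<^sub>R y) \<bullet> y - D x0 \<bullet> y - t * (y \<bullet> (H x0 *v y))) (at t)" if "0 \<le> t" "t \<le> 1" for t
    proof -
      have "x0 + t *\<^sub>R y \<in> U" using near[OF that] d1 by (auto simp: dist_norm)
      moreover have "((\<lambda>t. x0 + t *\<^sub>R y) has_derivative (\<lambda>s. s *\<^sub>R y)) (at t)"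
        by (auto intro!: derivative_eq_intros)
      ultimately have "((\<lambda>t. \<phi> (x0 + t *\<^sub>R y)) has_derivative (\<lambda>s. D (x0 + t *\<^sub>R y) \<bullet> (s *\<^sub>R y))) (at t)"
        by (intro has_derivative_compose[OF _ \<phi>(3)])
      then have "((\<lambda>t. \<phi> (x0 + t *\<^sub>R y)) has_real_derivative D (x0 + t *\<^sub>R y) \<bullet> y) (at t)"
        unfolding has_field_derivative_def by (rule has_derivative_eq_rhs) (auto simp: mult.commute)
      then show ?thesis unfolding g_def by (auto intro!: derivative_eq_intros)
    qed
    obtain t where t: "0 < t" "t < 1" "g 1 - g 0 = (1 - 0) * (D (x0 + t *\<^sub>R y) \<bullet> y - D x0 \<bullet> y - t * (y \<bullet> (H x0 *v y)))"
      using MVT2[OF zero_less_one der] by blast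
    have "D (x0 + t *\<^sub>R y) \<bullet> y - D x0 \<bullet> y - t * (y \<bullet> (H x0 *v y)) = (D (x0 + t *\<^sub>R y) - D x0 - H x0 *v (t *\<^sub>R y)) \<bullet> y"
      by (simp add: inner_diff_left inner_diff_right matrix_vector_mult_scaleR inner_commute)
    also have "\<dots> \<le> norm (D (x0 + t *\<^sub>R y) - D x0 - H x0 *v (t *\<^sub>R y)) * norm y" by (rule norm_cauchy_schwarz)
    also have "\<dots> \<le> (\<delta> * norm (t *\<^sub>R y)) * norm y"
      using d2(2)[of "x0 + t *\<^sub>R y"] near[of t] t by (intro mult_right_mono) auto
    also have "\<dots> \<le> (\<delta> * norm y) * norm y"
      using t \<delta> by (intro mult_right_mono mult_left_mono) (auto intro: mult_left_le_one_le)
    also have "\<dots> = \<delta> * (y \<bullet> y)" by (simp add: power2_norm_eq_inner[symmetric] power2_eq_square)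
    finally have "g 1 - g 0 \<le> \<delta> * (y \<bullet> y)" using t(3) by simp
    then show "\<phi> x \<le> \<phi> x0 + D x0 \<bullet> (x - x0) + (1/2) * ((x - x0) \<bullet> (H x0 *v (x - x0))) + \<delta> * ((x - x0) \<bullet> (x - x0))"
      unfolding y_def[symmetric] by (simp add: g_def) (simp add: y_def)
  qed (use d1 d2 in auto)
qed

lemma usc_on_real_iff:
  "usc_on X (\<lambda>x. ereal (f x)) \<longleftrightarrow> (\<forall>x\<in>X. \<forall>e>0. \<forall>\<^sub>F y in at x within X. f y < f x + e)" (is "?L = ?R")
proof
  assume L: ?L
  show ?R
  proof (intro ballI allI impI)
    fix x and e :: real assume "x \<in> X" "0 < e"
    with L[unfolded usc_on_def, rule_format, of x "ereal (f x + e)"]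
    show "\<forall>\<^sub>F y in at x within X. f y < f x + e" by simp
  qed
next
  assume R: ?R
  show ?L unfolding usc_on_def
  proof (intro ballI allI impI)
    fix x c assume x: "x \<in> X" "ereal (f x) < c"
    then obtain d where d: "ereal (f x) < ereal d" "ereal d < c" using ereal_dense2[of "ereal (f x)" c] by auto
    have "\<forall>\<^sub>F y in at x within X. f y < f x + (d - f x)" by (rule R[rule_format]) (use x d(1) in auto)
    then show "\<forall>\<^sub>F y in at x within X. ereal (f y) < c"
      by eventually_elim (rule less_trans[OF _ d(2)], simp)
  qed
qed

lemma usc_on_average:
  assumes "\<And>i. i < (m::nat) \<Longrightarrow> usc_on X (\<lambda>x. ereal (f i x))" and m: "0 < m"
  shows "usc_on X (\<lambda>x. ereal ((1 / real m) *\<^sub>R (\<Sum>i<m. f i x)))"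
  unfolding usc_on_real_iff
proof (intro ballI allI impI)
  fix x and e :: real assume x: "x \<in> X" and e: "0 < e"
  have "\<forall>\<^sub>F y in at x within X. \<forall>i\<in>{..<m}. f i y < f i x + e"
    by (rule eventually_ball_finite) (use assms(1) x e in \<open>auto simp: usc_on_real_iff\<close>)
  then show "\<forall>\<^sub>F y in at x within X. (1 / real m) *\<^sub>R (\<Sum>i<m. f i y) < (1 / real m) *\<^sub>R (\<Sum>i<m. f i x) + e"
  proof eventually_elim
    case (elim y)
    then have "(\<Sum>i<m. f i y) < (\<Sum>i<m. f i x + e)" using m by (intro sum_strict_mono) auto
    then show ?case using m by (simp add: sum.distrib field_simps)
  qed
qed

lemma osc_le_add_const: "osc_le H d \<omega> \<Longrightarrow> osc_le (\<lambda>x. c + H x) d \<omega>"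
  by (simp add: osc_le_def)

lemma osc_le_mono: "osc_le H d \<omega> \<Longrightarrow> d' \<le> d \<Longrightarrow> osc_le H d' \<omega>"
  unfolding osc_le_def by (meson order_trans)

text \<open>This turns a quadratic bound that holds near \<open>x0\<close> into a global one, at the price of a term whose
  Hessian vanishes at \<open>x0\<close>.\<close>

lemma quartic_dominates:
  fixes x0 D :: "real^'n" and H :: "real^'n^'n"
  assumes \<rho>: "0 < \<rho>" and N: "0 \<le> N"
  obtains N' where "0 \<le> N'" "\<And>x. \<rho> \<le> norm (x - x0) \<Longrightarrow>
    c + N * (x \<bullet> x) \<le> D \<bullet> (x - x0) + (1/2) * ((x - x0) \<bullet> (H *v (x - x0))) + N' * ((x - x0) \<bullet> (x - x0))\<^sup>2"
proof -
  define C where "C = \<bar>c\<bar> + 2 * N * (norm x0)\<^sup>2"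
  define N' where "N' = C / \<rho>^4 + norm D / \<rho>^3 + (2 * N + norm H / 2) / \<rho>^2"
  have C: "0 \<le> C" using N by (simp add: C_def)
  show thesis
  proof (rule that[of N'])
    show "0 \<le> N'" unfolding N'_def using C N \<rho> by simp
    fix x assume x: "\<rho> \<le> norm (x - x0)"
    define y where "y = x - x0"
    define r where "r = norm y"
    have r: "\<rho> \<le> r" "0 < r" using x \<rho> by (auto simp: r_def y_def)
    have yy: "y \<bullet> y = r\<^sup>2" by (simp add: r_def power2_norm_eq_inner)
    have "norm x \<le> norm x0 + r" using norm_triangle_ineq[of x0 y] by (simp add: y_def r_def)
    then have "(norm x)\<^sup>2 \<le> (norm x0 + r)\<^sup>2" by (intro power_mono) auto
    also have "\<dots> \<le> 2 * (norm x0)\<^sup>2 + 2 * r\<^sup>2"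
      using sum_squares_bound[of "norm x0" r] by (simp add: power2_sum)
    finally have "x \<bullet> x \<le> 2 * (norm x0)\<^sup>2 + 2 * r\<^sup>2" by (simp add: power2_norm_eq_inner)
    from mult_left_mono[OF this N] have "c + N * (x \<bullet> x) \<le> C + 2 * N * r\<^sup>2" by (simp add: C_def algebra_simps)
    moreover have "- (norm D * r) \<le> D \<bullet> y" using Cauchy_Schwarz_ineq2[of D y] by (simp add: r_def)
    moreover have "- (norm H * r\<^sup>2) \<le> y \<bullet> (H *v y)" using abs_quadratic_form_le[of y H] by (simp add: r_def)
    moreover have "C \<le> C / \<rho>^4 * r^4"
    proof -
      have "\<rho>^4 \<le> r^4" using r \<rho> by (intro power_mono) auto
      from mult_left_mono[OF this C] show ?thesis using \<rho> by (simp add: field_simps)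
    qed
    moreover have "norm D * r \<le> norm D / \<rho>^3 * r^4"
    proof -
      have "\<rho>^3 \<le> r^3" using r \<rho> by (intro power_mono) auto
      from mult_left_mono[OF this, of "norm D * r"] r show ?thesis using \<rho> by (simp add: field_simps eval_nat_numeral)
    qed
    moreover have "(2 * N + norm H / 2) * r\<^sup>2 \<le> (2 * N + norm H / 2) / \<rho>^2 * r^4"
    proof -
      have "\<rho>^2 \<le> r^2" using r \<rho> by (intro power_mono) auto
      moreover have "0 \<le> (2 * N + norm H / 2) * r\<^sup>2" using N by simp
      ultimately have "(2 * N + norm H / 2) * r\<^sup>2 * \<rho>^2 \<le> (2 * N + norm H / 2) * r\<^sup>2 * r^2" by (rule mult_left_mono)
      then have "(2 * N + norm H / 2) * r\<^sup>2 \<le> (2 * N + norm H / 2) * r\<^sup>2 * r^2 / \<rho>\<^sup>2" using \<rho> by (subst pos_le_divide_eq) auto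
      also have "\<dots> = (2 * N + norm H / 2) / \<rho>^2 * r^4" by (simp add: eval_nat_numeral)
      finally show ?thesis .
    qed
    ultimately have "c + N * (x \<bullet> x) \<le> D \<bullet> y + (1/2) * (y \<bullet> (H *v y)) + N' * r^4"
      unfolding N'_def distrib_right by (simp add: algebra_simps)
    also have "r^4 = (y \<bullet> y)\<^sup>2" unfolding yy by simp
    finally show "c + N * (x \<bullet> x) \<le> D \<bullet> (x - x0) + (1/2) * ((x - x0) \<bullet> (H *v (x - x0))) + N' * ((x - x0) \<bullet> (x - x0))\<^sup>2"
      by (simp add: y_def)
  qed
qed

lemma average_mono:
  fixes f g :: "nat \<Rightarrow> real"
  shows "(\<And>i. i < m \<Longrightarrow> f i \<le> g i) \<Longrightarrow> (1 / real m) *\<^sub>R (\<Sum>i<m. f i) \<le> (1 / real m) *\<^sub>R (\<Sum>i<m. g i)"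
  by (intro scaleR_left_mono sum_mono) auto

lemma average_add_const: "0 < m \<Longrightarrow> (1 / real m) *\<^sub>R (\<Sum>i<m. f i + c) = (1 / real m) *\<^sub>R (\<Sum>i<m. f i) + (c::real)"
  by (simp add: sum.distrib field_simps)

text \<open>Suppose that a \<open>C\<^sup>2\<close> function with Hessian \<open>A\<close> outside \<open>F\<close> touches the average \<open>v\<close> from above at \<open>x0\<close>. It may be
  replaced by a quartic polynomial \<open>P\<close> that dominates \<open>v\<close> everywhere and has equality at \<open>x0\<close>. By Dini's theorem
  there are \<open>C\<^sup>2\<close> majorants of the \<open>u i\<close> whose average is at most \<open>P + 2 \<epsilon>\<close>. The walk keeps each of them above
  \<open>u i\<close> up to a small error, so \<open>v x0\<close> is at most the walk applied to \<open>P + 2 \<epsilon>\<close>; but by time \<open>t\<close> the walk lowers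
  \<open>P\<close> at \<open>x0\<close> by about \<open>t |\<beta>|\<close>.\<close>

lemma (in riesz_cone) average_subsolution:
  fixes u :: "nat \<Rightarrow> real^'n \<Rightarrow> real" and m :: nat
  assumes conv: "convex F" and m: "0 < m" and u: "\<And>i. i < m \<Longrightarrow> global_subsolution F R a N (u i)"
  shows "global_subsolution F R a N (\<lambda>x. (1 / real m) *\<^sub>R (\<Sum>i<m. u i x))"
proof -
  define q where "q x = a + N * (x \<bullet> x)" for x :: "real^'n"
  define v where "v x = (1 / real m) *\<^sub>R (\<Sum>i<m. u i x)" for x
  note u' = global_subsolutionD[OF u, folded q_def]
  have N: "0 \<le> N" using u'(2)[OF m] .
  have avq: "(1 / real m) *\<^sub>R (\<Sum>i<m. c) = c" for c :: real using m by simp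
  have v_ge: "q x \<le> v x" for x
    using average_mono[of m "\<lambda>i. q x" "\<lambda>i. u i x"] u'(3) unfolding v_def avq by blast
  have v_out: "v x = q x" if "R \<le> norm x" for x
    using u'(4) that avq[of "q x"] by (simp add: v_def)
  have v_usc: "usc_on UNIV (\<lambda>x. ereal (v x))"
    unfolding v_def by (rule usc_on_average) (use u'(1) m in \<open>auto dest: subsolutionD(3)\<close>)
  have q_conv: "2 * q x \<le> q (x + b) + q (x - b)" for x b
  proof -
    have "0 \<le> N * (b \<bullet> b)" using N by simp
    then show ?thesis by (simp add: q_def inner_add_left inner_add_right inner_diff_left inner_diff_right inner_commute algebra_simps)
  qed
  have "\<exists>M. \<forall>i<m. 0 \<le> M i \<and> (\<forall>x. u i x \<le> q x + M i)"
  proof -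
    have "\<forall>i. \<exists>M. i < m \<longrightarrow> 0 \<le> M \<and> (\<forall>x. u i x \<le> q x + M)"
      using global_subsolution_bound[OF u] unfolding q_def by metis
    then show ?thesis by metis
  qed
  then obtain Mi where Mi: "\<And>i. i < m \<Longrightarrow> 0 \<le> Mi i" "\<And>i x. i < m \<Longrightarrow> u i x \<le> q x + Mi i" by blast
  define M where "M = (\<Sum>i<m. Mi i)"
  have "Mi i \<le> M" if "i < m" for i unfolding M_def by (rule member_le_sum) (use that Mi in auto)
  then have uM: "u i x \<le> q x + M" if "i < m" for i x using Mi(2)[OF that, of x] that by (meson add_left_mono order_trans)
  have M: "0 \<le> M" unfolding M_def by (intro sum_nonneg) (use Mi in auto)
  have vM: "v x \<le> q x + M" for x
    using average_mono[of m "\<lambda>i. u i x" "\<lambda>i. q x + M"] uM unfolding v_def avq by blast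
  have "\<exists>\<eta>. (\<forall>k. continuous_on UNIV (\<eta> k)) \<and> (\<forall>k x. u i x \<le> \<eta> k x) \<and>
    (\<forall>k x. \<eta> (Suc k) x \<le> \<eta> k x) \<and> (\<forall>k x. R + M \<le> norm x \<longrightarrow> \<eta> k x = q x) \<and> (\<forall>x. (\<lambda>k. \<eta> k x) \<longlonglongrightarrow> u i x)" if "i < m" for i
    using global_subsolution_majorants[OF u[OF that], of M] uM[OF that] unfolding q_def by metis
  then have "\<forall>i. \<exists>\<eta>. i < m \<longrightarrow> (\<forall>k. continuous_on UNIV (\<eta> k)) \<and> (\<forall>k x. u i x \<le> \<eta> k x) \<and>
    (\<forall>k x. \<eta> (Suc k) x \<le> \<eta> k x) \<and> (\<forall>k x. R + M \<le> norm x \<longrightarrow> \<eta> k x = q x) \<and> (\<forall>x. (\<lambda>k. \<eta> k x) \<longlonglongrightarrow> u i x)"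
    by blast
  from choice[OF this] obtain \<eta> where "\<forall>i. i < m \<longrightarrow> (\<forall>k. continuous_on UNIV (\<eta> i k)) \<and> (\<forall>k x. u i x \<le> \<eta> i k x) \<and>
    (\<forall>k x. \<eta> i (Suc k) x \<le> \<eta> i k x) \<and> (\<forall>k x. R + M \<le> norm x \<longrightarrow> \<eta> i k x = q x) \<and> (\<forall>x. (\<lambda>k. \<eta> i k x) \<longlonglongrightarrow> u i x)" ..
  then have \<eta>: "\<And>i k. i < m \<Longrightarrow> continuous_on UNIV (\<eta> i k)" "\<And>i k x. i < m \<Longrightarrow> u i x \<le> \<eta> i k x"
    "\<And>i k x. i < m \<Longrightarrow> \<eta> i (Suc k) x \<le> \<eta> i k x" "\<And>i k x. i < m \<Longrightarrow> R + M \<le> norm x \<Longrightarrow> \<eta> i k x = q x"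
    "\<And>i x. i < m \<Longrightarrow> (\<lambda>k. \<eta> i k x) \<longlonglongrightarrow> u i x"
    by auto
  have touching: "H x0 \<in> F" if x0U: "x0 \<in> U" and C2: "C2_on U \<phi> D H" and sym: "H x0 \<in> Sym2"
    and ev: "\<forall>\<^sub>F x in nhds x0. v x \<le> \<phi> x" and eq: "v x0 = \<phi> x0" for x0 U \<phi> D H
  proof (rule ccontr)
    assume nF: "H x0 \<notin> F"
    define A where "A = H x0"
    obtain w and l :: nat where l: "0 < l" and wF: "\<And>B. B \<in> F \<Longrightarrow> 0 \<le> (\<Sum>k<l. w k \<bullet> (B *v w k))"
      and wA: "(\<Sum>k<l. w k \<bullet> (A *v w k)) < 0"
    proof (rule separating_vectors[OF conv sym nF])
      fix w' and l' :: nat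
      assume "0 < l'" "\<And>B. B \<in> F \<Longrightarrow> 0 \<le> (\<Sum>k<l'. w' k \<bullet> (B *v w' k))" "(\<Sum>k<l'. w' k \<bullet> (H x0 *v w' k)) < 0"
      then show thesis unfolding A_def[symmetric] by (rule that)
    qed
    define \<kappa> where "\<kappa> = 1 + (\<Sum>k<l. norm (w k))"
    have \<kappa>: "norm (w k) \<le> \<kappa>" if "k < l" for k
      using member_le_sum[of k "{..<l}" "\<lambda>k. norm (w k)"] that by (simp add: \<kappa>_def)
    have \<kappa>0: "0 < \<kappa>" unfolding \<kappa>_def by (intro add_pos_nonneg sum_nonneg) auto
    define \<mu> where "\<mu> = (\<Sum>k<l. w k \<bullet> (A *v w k))"
    \<comment> \<open>Half of the negative contribution of \<open>A\<close> remains after the error \<open>\<delta> |x - x0|\<^sup>2\<close> of the second-order Taylor expansion.\<close>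
    define \<delta> where "\<delta> = - \<mu> / (4 * real l * \<kappa>\<^sup>2)"
    have \<delta>: "0 < \<delta>" unfolding \<delta>_def using wA l \<kappa>0 by (intro divide_pos_pos) (auto simp: \<mu>_def)
    define \<beta> where "\<beta> = (1 / (2 * real l)) * \<mu> + \<delta> * \<kappa>\<^sup>2"
    have "\<beta> = \<mu> / (4 * real l)" unfolding \<beta>_def \<delta>_def using l \<kappa>0 by (simp add: field_simps)
    then have \<beta>: "\<beta> < 0" using wA l by (simp add: \<mu>_def divide_neg_pos)
    obtain \<rho>1 where \<rho>1: "0 < \<rho>1" "\<And>x. norm (x - x0) < \<rho>1 \<Longrightarrow>
      \<phi> x \<le> \<phi> x0 + D x0 \<bullet> (x - x0) + (1/2) * ((x - x0) \<bullet> (A *v (x - x0))) + \<delta> * ((x - x0) \<bullet> (x - x0))"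
      unfolding A_def by (rule taylor_upper[OF C2 x0U sym \<delta>]) blast
    obtain \<rho>2 where \<rho>2: "0 < \<rho>2" "\<And>x. norm (x - x0) < \<rho>2 \<Longrightarrow> v x \<le> \<phi> x"
      using ev unfolding eventually_nhds_metric by (auto simp: dist_norm)
    define \<rho> where "\<rho> = min \<rho>1 \<rho>2"
    have \<rho>: "0 < \<rho>" using \<rho>1 \<rho>2 by (simp add: \<rho>_def)
    obtain N' where N': "0 \<le> N'" "\<And>x. \<rho> \<le> norm (x - x0) \<Longrightarrow>
      (a + M - v x0) + N * (x \<bullet> x) \<le> D x0 \<bullet> (x - x0) + (1/2) * ((x - x0) \<bullet> (A *v (x - x0))) + N' * ((x - x0) \<bullet> (x - x0))\<^sup>2"
      using quartic_dominates[OF \<rho> N, of x0 "a + M - v x0" "D x0" A] by metis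
    define P where "P c x = c + D x0 \<bullet> (x - x0) + (1/2) * ((x - x0) \<bullet> (A *v (x - x0))) + \<delta> * ((x - x0) \<bullet> (x - x0)) + N' * ((x - x0) \<bullet> (x - x0))\<^sup>2" for c x
    have P_cont: "continuous_on S (P c)" for S c
      unfolding P_def by (intro continuous_intros bounded_linear.continuous_on[OF matrix_vector_mul_bounded_linear])
    have vP: "v x \<le> P (v x0) x" for x
    proof (cases "norm (x - x0) < \<rho>")
      case True
      then have "v x \<le> \<phi> x" "\<phi> x \<le> \<phi> x0 + D x0 \<bullet> (x - x0) + (1/2) * ((x - x0) \<bullet> (A *v (x - x0))) + \<delta> * ((x - x0) \<bullet> (x - x0))"
        using \<rho>1 \<rho>2 by (auto simp: \<rho>_def)
      moreover have "0 \<le> N' * ((x - x0) \<bullet> (x - x0))\<^sup>2" using N' by simp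
      ultimately show ?thesis unfolding P_def using eq by linarith
    next
      case False
      have "0 \<le> \<delta> * ((x - x0) \<bullet> (x - x0))" using \<delta> by simp
      then show ?thesis using N'(2)[of x] False vM[of x] unfolding P_def q_def by linarith
    qed
    \<comment> \<open>Each of the three errors, from the fourth moment, from \<open>\<epsilon>\<close> and from \<open>\<omega>\<close>, is at most a quarter of the gain \<open>- t \<beta>\<close>.\<close>
    define t where "t = - \<beta> / (12 * N' * \<kappa>^4 + 1)"
    have den: "0 < 12 * N' * \<kappa>^4 + 1" using N' by (intro add_nonneg_pos) auto
    have t: "0 < t" unfolding t_def using \<beta> den by (intro divide_pos_pos) auto
    have t2: "3 * N' * \<kappa>^4 * t \<le> - \<beta> / 4"
    proof -
      have "12 * N' * \<kappa>^4 * t \<le> (12 * N' * \<kappa>^4 + 1) * t" using t by (intro mult_right_mono) auto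
      also have "\<dots> = - \<beta>" unfolding t_def using den by simp
      finally show ?thesis by simp
    qed
    define \<epsilon> where "\<epsilon> = - (t * \<beta>) / 8"
    have \<epsilon>: "0 < \<epsilon>" unfolding \<epsilon>_def using mult_pos_neg[OF t \<beta>] by simp
    define \<omega> where "\<omega> = - \<beta> / (4 * \<kappa>\<^sup>2)"
    have \<omega>: "0 < \<omega>" unfolding \<omega>_def using \<beta> \<kappa>0 by (intro divide_pos_pos) auto
    have \<omega>\<kappa>: "\<kappa>\<^sup>2 * \<omega> = - \<beta> / 4" unfolding \<omega>_def using \<kappa>0 by simp
    obtain k where k: "\<And>x. x \<in> cball 0 (R + M) \<Longrightarrow> (1 / real m) *\<^sub>R (\<Sum>i<m. \<eta> i k x) < P (v x0) x + \<epsilon>"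
    proof (rule Dini_upper[where K = "cball 0 (R + M) :: (real^'n) set" and f = "\<lambda>k x. (1 / real m) *\<^sub>R (\<Sum>i<m. \<eta> i k x)" and g = v and \<psi> = "P (v x0)" and e = \<epsilon>])
      show "continuous_on (cball 0 (R + M)) (\<lambda>x. (1 / real m) *\<^sub>R (\<Sum>i<m. \<eta> i k x))" for k
        by (intro continuous_intros continuous_on_subset[OF \<eta>(1)]) auto
      show "(1 / real m) *\<^sub>R (\<Sum>i<m. \<eta> i (Suc k) x) \<le> (1 / real m) *\<^sub>R (\<Sum>i<m. \<eta> i k x)" for k x
        by (rule average_mono) (rule \<eta>(3))
      show "(\<lambda>k. (1 / real m) *\<^sub>R (\<Sum>i<m. \<eta> i k x)) \<longlonglongrightarrow> v x" for x
        unfolding v_def by (intro tendsto_intros \<eta>(5)) auto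
    qed (use vP P_cont \<epsilon> in auto)
    have \<eta>P: "(1 / real m) *\<^sub>R (\<Sum>i<m. \<eta> i k x) \<le> P (v x0) x + \<epsilon>" for x
    proof (cases "norm x \<le> R + M")
      case True
      then show ?thesis using k[of x] by simp
    next
      case False
      then have "(1 / real m) *\<^sub>R (\<Sum>i<m. \<eta> i k x) = q x" using \<eta>(4)[of _ x k] avq[of "q x"] by simp
      also have "\<dots> = v x" using v_out[of x] False M by simp
      finally show ?thesis using vP[of x] \<epsilon> by simp
    qed
    have q_C2: "C2_sym q (\<lambda>x. 0 + N *\<^sub>R (2 *\<^sub>R x)) (\<lambda>x. 0 + N *\<^sub>R (2 *\<^sub>R mat 1))"
      unfolding C2_sym_def q_def
      by (intro conjI allI C2_on_add C2_on_const C2_on_cmul C2_on_norm_sq Sym2_add Sym2_0 Sym2_scaleR Sym2_mat open_UNIV)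
    have "\<exists>\<phi>' D' H' d. C2_sym \<phi>' D' H' \<and> (\<forall>x. u i x \<le> \<phi>' x) \<and> (\<forall>x. \<phi>' x \<le> \<eta> i k x + \<epsilon>) \<and> 0 < d \<and> osc_le H' d \<omega>"
      if i: "i < m" for i
    proof -
      have c1: "continuous_on UNIV (\<lambda>x. \<eta> i k x - q x)"
        unfolding q_def by (intro continuous_intros \<eta>(1)[OF i])
      have c2: "\<eta> i k x - q x = 0" if "\<bar>R\<bar> + M + 1 \<le> norm x" for x
        using \<eta>(4)[OF i, of x k] that by simp
      have c3: "0 < \<bar>R\<bar> + M + 1" using M by simp
      obtain \<phi>1 D1 H1 where \<phi>1: "C2_sym \<phi>1 D1 H1" "\<And>x. \<eta> i k x - q x \<le> \<phi>1 x" "\<And>x. \<phi>1 x \<le> \<eta> i k x - q x + \<epsilon>"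
        "\<And>x. \<bar>R\<bar> + M + 1 + 1 \<le> norm x \<Longrightarrow> H1 x = 0"
        by (rule C2_majorant[OF c1 c2 c3 \<epsilon>]) blast+
      have "continuous_on UNIV H1" using C2_onD(2)[of UNIV \<phi>1 D1 H1] \<phi>1(1) unfolding C2_sym_def by simp
      then obtain d where d: "0 < d" "osc_le H1 d \<omega>"
        by (rule compact_support_osc[OF _ \<phi>1(4) \<omega>]) blast+
      have "C2_sym (\<lambda>x. q x + \<phi>1 x) (\<lambda>x. (0 + N *\<^sub>R (2 *\<^sub>R x)) + D1 x) (\<lambda>x. (0 + N *\<^sub>R (2 *\<^sub>R mat 1)) + H1 x)"
        by (rule C2_sym_add[OF q_C2 \<phi>1(1)])
      moreover have "u i x \<le> q x + \<phi>1 x" for x using \<eta>(2)[OF i, of x k] \<phi>1(2)[of x] by linarith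
      moreover have "q x + \<phi>1 x \<le> \<eta> i k x + \<epsilon>" for x using \<phi>1(3)[of x] by linarith
      moreover have "osc_le (\<lambda>x. (0 + N *\<^sub>R (2 *\<^sub>R mat 1)) + H1 x) d \<omega>" by (rule osc_le_add_const[OF d(2)])
      ultimately show ?thesis using d(1) by blast
    qed
    then have "\<forall>i. \<exists>\<phi>' D' H' d. i < m \<longrightarrow> C2_sym \<phi>' D' H' \<and> (\<forall>x. u i x \<le> \<phi>' x) \<and> (\<forall>x. \<phi>' x \<le> \<eta> i k x + \<epsilon>) \<and> 0 < d \<and> osc_le H' d \<omega>"
      by blast
    then obtain \<phi>' D' H' d where \<phi>': "\<And>i. i < m \<Longrightarrow> C2_sym (\<phi>' i) (D' i) (H' i)" "\<And>i x. i < m \<Longrightarrow> u i x \<le> \<phi>' i x"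
      "\<And>i x. i < m \<Longrightarrow> \<phi>' i x \<le> \<eta> i k x + \<epsilon>" and d: "\<And>i. i < m \<Longrightarrow> 0 < d i" "\<And>i. i < m \<Longrightarrow> osc_le (H' i) (d i) \<omega>"
      by metis
    define d0 where "d0 = Min (d ` {..<m})"
    have "d ` {..<m} \<noteq> {}" using m by auto
    then have d0: "0 < d0" unfolding d0_def using d(1) by (subst Min_gr_iff) auto
    have d0_le: "d0 \<le> d i" if "i < m" for i unfolding d0_def using that by simp
    \<comment> \<open>So many steps that a single one has length below the scale \<open>d0\<close> on which the Hessians oscillate by at most \<open>\<omega>\<close>.\<close>
    obtain j :: nat where j: "t * (2 * \<kappa> / d0)\<^sup>2 < real j" using reals_Archimedean2 by blast
    have "0 \<le> t * (2 * \<kappa> / d0)\<^sup>2" using t by simp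
    with j have j0: "0 < real j" by linarith
    define h where "h = sqrt (t / real j)"
    have h: "0 \<le> h" "real j * h\<^sup>2 = t" using t j0 by (auto simp: h_def)
    have h_small: "2 * h * \<kappa> \<le> d0"
    proof -
      have "t * (2 * \<kappa>)\<^sup>2 \<le> real j * d0\<^sup>2"
        using j d0 by (simp add: power_divide field_simps)
      then have "(t / real j) * (2 * \<kappa>)\<^sup>2 \<le> d0\<^sup>2" using j0 by (simp add: field_simps)
      then have "(2 * h * \<kappa>)\<^sup>2 \<le> d0\<^sup>2" using t j0 by (simp add: h_def power_mult_distrib mult_ac)
      then show ?thesis using d0 by (meson less_imp_le power2_le_imp_le)
    qed
    have ui: "u i x0 \<le> ((walk w l h ^^ j) (\<phi>' i)) x0 + t * (\<kappa>\<^sup>2 * \<omega>)" if i: "i < m" for i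
    proof -
      have "u i x0 \<le> ((walk w l h ^^ j) (\<phi>' i)) x0 + real j * (\<kappa>\<^sup>2 * \<omega> * h\<^sup>2)"
        by (rule walk_iterate[where q = q and R = R, OF u'(1)[OF i] u'(3)[OF i] u'(4)[OF i] q_conv l wF \<kappa> \<phi>'(1)[OF i]
              osc_le_mono[OF d(2)[OF i]] h(1) \<phi>'(2)[OF i]])
           (use h_small d0_le[OF i] in auto)
      also have "real j * (\<kappa>\<^sup>2 * \<omega> * h\<^sup>2) = t * (\<kappa>\<^sup>2 * \<omega>)" unfolding h(2)[symmetric] by simp
      finally show ?thesis .
    qed
    have "v x0 \<le> (1 / real m) *\<^sub>R (\<Sum>i<m. ((walk w l h ^^ j) (\<phi>' i)) x0 + t * (\<kappa>\<^sup>2 * \<omega>))"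
      unfolding v_def by (rule average_mono) (rule ui)
    also have "\<dots> = (1 / real m) *\<^sub>R (\<Sum>i<m. ((walk w l h ^^ j) (\<phi>' i)) x0) + t * (\<kappa>\<^sup>2 * \<omega>)"
      by (rule average_add_const[OF m])
    also have "(1 / real m) *\<^sub>R (\<Sum>i<m. ((walk w l h ^^ j) (\<phi>' i)) x0) = (walk w l h ^^ j) (\<lambda>x. (1 / real m) *\<^sub>R (\<Sum>i<m. \<phi>' i x)) x0"
      by (rule walk_iterate_average[symmetric])
    also have "\<dots> \<le> (walk w l h ^^ j) (P (v x0 + 2 * \<epsilon>)) x0"
    proof (rule walk_iterate_mono)
      fix x
      have "(1 / real m) *\<^sub>R (\<Sum>i<m. \<phi>' i x) \<le> (1 / real m) *\<^sub>R (\<Sum>i<m. \<eta> i k x + \<epsilon>)"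
        by (rule average_mono) (rule \<phi>'(3))
      also have "\<dots> = (1 / real m) *\<^sub>R (\<Sum>i<m. \<eta> i k x) + \<epsilon>" by (rule average_add_const[OF m])
      also have "\<dots> \<le> P (v x0 + 2 * \<epsilon>) x" using \<eta>P[of x] by (simp add: P_def)
      finally show "(1 / real m) *\<^sub>R (\<Sum>i<m. \<phi>' i x) \<le> P (v x0 + 2 * \<epsilon>) x" .
    qed
    also have "\<dots> \<le> (v x0 + 2 * \<epsilon>) + (real j * h\<^sup>2) * \<beta> + 3 * N' * \<kappa>^4 * (real j * h\<^sup>2)\<^sup>2"
      unfolding P_def \<beta>_def \<mu>_def
      by (rule walk_iterate_quartic[OF l \<kappa> N'(1)]) (use \<delta> sym in \<open>auto simp: A_def\<close>)
    finally have "0 \<le> 2 * \<epsilon> + t * \<beta> + 3 * N' * \<kappa>^4 * t\<^sup>2 + t * (\<kappa>\<^sup>2 * \<omega>)" unfolding h(2) by simp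
    moreover have "3 * N' * \<kappa>^4 * t\<^sup>2 \<le> - (t * \<beta>) / 4"
      using mult_right_mono[OF t2, of t] t by (simp add: power2_eq_square mult_ac)
    moreover have "t * (\<kappa>\<^sup>2 * \<omega>) = - (t * \<beta>) / 4" unfolding \<omega>\<kappa> by simp
    moreover have "2 * \<epsilon> = - (t * \<beta>) / 4" by (simp add: \<epsilon>_def)
    moreover have "t * \<beta> < 0" using t \<beta> by (rule mult_pos_neg)
    ultimately show False by linarith
  qed
  have "subsolution F UNIV (\<lambda>x. ereal (v x))"
    unfolding subsolution_def using v_usc touching by auto
  then show ?thesis
    unfolding global_subsolution_def using N v_ge v_out by (auto simp: v_def q_def)
qed

section \<open>Averaging over a transitive group\<close>

lemma orthogonal_matrix_inner:
  assumes "orthogonal_matrix (g :: real^'n^'n)"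
  shows "(g *v x) \<bullet> (g *v y) = x \<bullet> y"
proof -
  have "(g *v x) \<bullet> (g *v y) = (transpose g *v (g *v x)) \<bullet> y"
    by (metis dot_lmul_matrix transpose_matrix_vector)
  then show ?thesis using assms by (simp add: orthogonal_matrix_def matrix_vector_mul_assoc)
qed

lemma orthogonal_matrix_norm: "orthogonal_matrix (g :: real^'n^'n) \<Longrightarrow> norm (g *v x) = norm x"
  by (simp add: norm_eq_sqrt_inner orthogonal_matrix_inner)

lemma orthogonal_matrix_transpose_mult:
  "orthogonal_matrix g \<Longrightarrow> transpose g *v (g *v x) = x"
  by (simp add: orthogonal_matrix_def matrix_vector_mul_assoc)

definition orbit_average :: "(nat \<Rightarrow> real^'n^'n) \<Rightarrow> nat \<Rightarrow> (real^'n \<Rightarrow> real) \<Rightarrow> real^'n \<Rightarrow> real" where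
  "orbit_average g m f x = (1 / real m) *\<^sub>R (\<Sum>j<m. f (g j *v x))"

lemma orbit_average_mono: "(\<And>x. f x \<le> f' x) \<Longrightarrow> orbit_average g m f x \<le> orbit_average g m f' x"
  unfolding orbit_average_def by (rule average_mono)

lemma orbit_average_iterate_mono:
  "(\<And>x. f x \<le> f' x) \<Longrightarrow> (orbit_average g m ^^ k) f x \<le> (orbit_average g m ^^ k) f' x"
  by (induction k arbitrary: x) (auto intro: orbit_average_mono)

lemma orbit_average_iterate_0: "0 < m \<Longrightarrow> (orbit_average g m ^^ k) f 0 = f 0"
  by (induction k) (auto simp: orbit_average_def)

lemma continuous_on_orbit_average:
  assumes "continuous_on UNIV f"
  shows "continuous_on UNIV (orbit_average g m f)"
  unfolding orbit_average_def
  by (intro continuous_intros continuous_on_compose2[OF assms] bounded_linear.continuous_on[OF matrix_vector_mul_bounded_linear]) auto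

locale st_cone = riesz_cone F p for F :: "(real^'n^'n) set" and p +
  fixes G :: "(real^'n^'n) set"
  assumes convex_F: "convex F"
    and G: "orthogonal_subgroup G"
    and transitive: "\<And>x y. norm x = 1 \<Longrightarrow> norm y = 1 \<Longrightarrow> \<exists>g\<in>G. g *v x = y"
    and invariant: "\<And>g A. g \<in> G \<Longrightarrow> A \<in> F \<Longrightarrow> g ** A ** transpose g \<in> F"
begin

lemma G_orthogonal: "g \<in> G \<Longrightarrow> orthogonal_matrix g"
  using G by (auto simp: orthogonal_subgroup_def)

lemma G_transpose: "g \<in> G \<Longrightarrow> transpose g \<in> G"
proof -
  assume g: "g \<in> G"
  have "matrix_inv g = transpose g"
  proof -
    have gt: "transpose g ** g = mat 1" "g ** transpose g = mat 1"
      using G_orthogonal[OF g] by (auto simp: orthogonal_matrix_def)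
    have "g ** matrix_inv g = mat 1 \<and> matrix_inv g ** g = mat 1"
      unfolding matrix_inv_def
      by (rule someI[of "\<lambda>B. g ** B = mat 1 \<and> B ** g = mat 1" "transpose g"]) (simp add: gt)
    then have "(matrix_inv g ** g) ** transpose g = transpose g" by simp
    then show ?thesis by (simp add: matrix_mul_assoc[symmetric] gt)
  qed
  moreover have "matrix_inv g \<in> G" using G g by (auto simp: orthogonal_subgroup_def)
  ultimately show ?thesis by simp
qed

lemma global_subsolution_rotate:
  assumes u: "global_subsolution F R a N u" and g: "g \<in> G"
  shows "global_subsolution F R a N (\<lambda>x. u (g *v x))"
proof -
  note transpose_matrix_vector [simp del]
  note u' = global_subsolutionD[OF u] and orth = G_orthogonal[OF g]
  have gt: "transpose g ** g = mat 1" "g ** transpose g = mat 1" using orth by (auto simp: orthogonal_matrix_def)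
  have "subsolution F UNIV (\<lambda>x. ereal (u (g *v x)))"
    unfolding subsolution_def
  proof (intro conjI ballI allI impI; (elim conjE)?)
    show "usc_on UNIV (\<lambda>x. ereal (u (g *v x)))"
      by (rule usc_on_compose[OF subsolutionD(3)[OF u'(1)]])
         (auto intro!: bounded_linear.continuous_on[OF matrix_vector_mul_bounded_linear] continuous_intros)
    fix x0 U \<phi> D H
    assume x0: "x0 \<in> U" and C2: "C2_on U \<phi> D H" and sym: "H x0 \<in> Sym2"
      and ev: "\<forall>\<^sub>F x in nhds x0. ereal (u (g *v x)) \<le> ereal (\<phi> x)" and eq: "ereal (u (g *v x0)) = ereal (\<phi> x0)"
    have bk: "transpose g *v (g *v x) = x" for x using orthogonal_matrix_transpose_mult[OF orth] .
    have forth: "g *v (transpose g *v x) = x" for x by (metis gt(2) matrix_vector_mul_assoc matrix_vector_mul_lid)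
    obtain S where S: "open S" "x0 \<in> S" "\<And>x. x \<in> S \<Longrightarrow> u (g *v x) \<le> \<phi> x"
      using ev unfolding eventually_nhds by auto
    have ev': "\<forall>\<^sub>F y in nhds (g *v x0). ereal (u y) \<le> ereal (\<phi> (transpose g *v y))"
      unfolding eventually_nhds
    proof (intro exI[of _ "(\<lambda>y. transpose g *v y) -` S"] conjI ballI)
      show "open ((\<lambda>y. transpose g *v y) -` S)"
        by (intro open_vimage S(1) bounded_linear.continuous_on[OF matrix_vector_mul_bounded_linear] continuous_intros)
      show "g *v x0 \<in> (\<lambda>y. transpose g *v y) -` S" using S by (simp add: bk)
      fix y assume "y \<in> (\<lambda>y. transpose g *v y) -` S"
      then show "ereal (u y) \<le> ereal (\<phi> (transpose g *v y))" using S(3)[of "transpose g *v y"] by (simp add: forth)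
    qed
    note C2' = C2_on_linear_image[OF C2, of "transpose g"]
    have "transpose (transpose g) ** H (transpose g *v (g *v x0)) ** transpose g \<in> F"
      by (rule subsolutionD(4)[OF u'(1) _ _ C2' _ ev']) (use x0 sym eq in \<open>auto simp: bk Sym2_conj\<close>)
    then have "g ** H x0 ** transpose g \<in> F" by (simp add: bk)
    from invariant[OF G_transpose[OF g] this]
    have "(transpose g ** g) ** H x0 ** (transpose g ** g) \<in> F" by (simp add: matrix_mul_assoc)
    then show "H x0 \<in> F" by (simp add: gt)
  qed auto
  then show ?thesis
    unfolding global_subsolution_def
    using u'(2) u'(3)[of "g *v _"] u'(4)[of "g *v _"] by (simp add: orthogonal_matrix_inner[OF orth] orthogonal_matrix_norm[OF orth])
qed

lemma global_subsolution_orbit_average: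
  assumes "global_subsolution F R a N u" "0 < m" "\<And>j. j < m \<Longrightarrow> g j \<in> G"
  shows "global_subsolution F R a N ((orbit_average g m ^^ k) u)"
proof (induction k)
  case (Suc k)
  show ?case
    using average_subsolution[OF convex_F assms(2) global_subsolution_rotate[OF Suc assms(3)]]
    by (simp add: orbit_average_def[abs_def])
qed (use assms in simp)

text \<open>Compactness of the product of two unit spheres, covered by the open sets of pairs \<open>(x, y)\<close> with
  \<open>h x\<close> near \<open>y\<close>, for \<open>h\<close> in the group.\<close>

lemma finite_net:
  assumes \<delta>: "0 < \<delta>"
  obtains g and m :: nat where "0 < m" "\<And>j. j < m \<Longrightarrow> g j \<in> G"
    "\<And>x y. norm x = norm y \<Longrightarrow> \<exists>j<m. norm (g j *v x - y) \<le> \<delta> * norm x"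
proof -
  define S where "S = sphere (0::real^'n) 1 \<times> sphere (0::real^'n) 1"
  define U where "U h = {z. norm (h *v fst z - snd z) < \<delta>}" for h :: "real^'n^'n"
  have "compact S" unfolding S_def by (intro compact_Times) auto
  moreover have "open (U h)" for h
    unfolding U_def
    by (intro open_Collect_less continuous_intros bounded_linear.continuous_on[OF matrix_vector_mul_bounded_linear])
  moreover have "S \<subseteq> (\<Union>h\<in>G. U h)"
  proof
    fix z assume "z \<in> S"
    then obtain x y where z: "z = (x, y)" "norm x = 1" "norm y = 1" by (auto simp: S_def)
    from transitive[OF z(2,3)] obtain h where "h \<in> G" "h *v x = y" by blast
    then show "z \<in> (\<Union>h\<in>G. U h)" using z \<delta> by (auto simp: U_def intro!: bexI[of _ h])
  qed
  ultimately obtain C where C: "C \<subseteq> G" "finite C" "S \<subseteq> (\<Union>h\<in>C. U h)"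
    by (metis compactE_image)
  obtain b where b: "bij_betw b {0..<card C} C" using ex_bij_betw_nat_finite[OF C(2)] by blast
  have net: "\<exists>j<card C. norm (b j *v x - y) \<le> \<delta>" if "norm x = 1" "norm y = 1" for x y
  proof -
    have "(x, y) \<in> S" using that by (simp add: S_def)
    then obtain h where h: "h \<in> C" "norm (h *v x - y) < \<delta>" using C(3) by (auto simp: U_def)
    have "h \<in> b ` {0..<card C}" using b h(1) by (simp add: bij_betw_def)
    then obtain j where "j < card C" "b j = h" by auto
    then show ?thesis using h by auto
  qed
  have m: "0 < card C" using net[of "axis undefined 1" "axis undefined 1"] by (auto simp: norm_axis_1)
  show thesis
  proof (rule that[OF m])
    show "b j \<in> G" if "j < card C" for j using that b C(1) by (auto simp: bij_betw_def)
    fix x y :: "real^'n" assume xy: "norm x = norm y"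
    show "\<exists>j<card C. norm (b j *v x - y) \<le> \<delta> * norm x"
    proof (cases "x = 0")
      case True
      then show ?thesis using xy m by auto
    next
      case False
      define x' where "x' = x /\<^sub>R norm x"
      define y' where "y' = y /\<^sub>R norm x"
      have "norm y \<noteq> 0" using False xy by (metis norm_eq_zero)
      then have "norm x' = 1" "norm y' = 1" using xy by (auto simp: x'_def y'_def)
      from net[OF this] obtain j where j: "j < card C" "norm (b j *v x' - y') \<le> \<delta>" by blast
      have "b j *v x - y = norm x *\<^sub>R (b j *v x' - y')"
        using False by (simp add: x'_def y'_def matrix_vector_mult_scaleR scaleR_diff_right)
      then have "norm (b j *v x - y) = norm x * norm (b j *v x' - y')" by simp
      also have "\<dots> \<le> norm x * \<delta>" using j by (intro mult_left_mono) auto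
      finally show ?thesis using j(1) by (auto simp: mult.commute)
    qed
  qed
qed

text \<open>Let \<open>z\<close> be a minimum point of \<open>f\<close> on the sphere through \<open>x\<close>. One of the \<open>m\<close> terms of the average at \<open>x\<close>
  is evaluated near \<open>z\<close>, and this term pulls the average towards the minimum by the fraction \<open>1 / m\<close>.\<close>

lemma orbit_average_contracts:
  assumes f: "continuous_on UNIV f" and m: "0 < m" and g: "\<And>j. j < m \<Longrightarrow> g j \<in> G"
    and net: "\<And>x y. norm x = norm y \<Longrightarrow> \<exists>j<m. norm (g j *v x - y) \<le> \<delta> * norm x"
    and \<delta>: "\<delta> * \<rho> \<le> d" "0 \<le> \<delta>"
    and modulus: "\<And>x y. norm x = norm y \<Longrightarrow> norm x \<le> \<rho> \<Longrightarrow> norm (x - y) \<le> d \<Longrightarrow> f x - f y \<le> \<epsilon>"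
    and osc: "\<And>x y. norm x = norm y \<Longrightarrow> norm x \<le> \<rho> \<Longrightarrow> f x - f y \<le> L"
    and xy: "norm x = norm y" "norm x \<le> \<rho>"
  shows "orbit_average g m f x - orbit_average g m f y \<le> (1 - 1 / real m) * L + \<epsilon> / real m"
proof -
  have ng: "norm (g j *v z) = norm z" if "j < m" for j z by (rule orthogonal_matrix_norm[OF G_orthogonal[OF g[OF that]]])
  have "\<exists>z\<in>sphere 0 (norm x). \<forall>w\<in>sphere 0 (norm x). f z \<le> f w"
    by (rule continuous_attains_inf) (auto intro: continuous_on_subset[OF f])
  then obtain z where z: "norm z = norm x" "\<And>w. norm w = norm x \<Longrightarrow> f z \<le> f w" by auto
  obtain i where i: "i < m" "norm (g i *v x - z) \<le> \<delta> * norm x" using net[of x z] z(1) by auto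
  have "\<delta> * norm x \<le> d" using \<delta> xy(2) by (meson mult_left_mono order_trans)
  then have fi: "f (g i *v x) - f z \<le> \<epsilon>" using i xy z(1) by (intro modulus) (auto simp: ng)
  have fj: "f (g j *v x) - f z \<le> L" if "j < m" for j using that xy z(1) by (intro osc) (auto simp: ng)
  have "(\<Sum>j<m. f (g j *v x) - f z) = (f (g i *v x) - f z) + (\<Sum>j\<in>{..<m} - {i}. f (g j *v x) - f z)"
    using i(1) by (intro sum.remove) auto
  also have "\<dots> \<le> \<epsilon> + (\<Sum>j\<in>{..<m} - {i}. L)"
    using fi fj by (intro add_mono sum_mono) auto
  also have "\<dots> = \<epsilon> + (real m - 1) * L" using i(1) m by (simp add: of_nat_diff)
  finally have "(\<Sum>j<m. f (g j *v x)) - real m * f z \<le> \<epsilon> + (real m - 1) * L" by (simp add: sum_subtractf)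
  then have "(\<Sum>j<m. f (g j *v x)) \<le> real m * f z + (\<epsilon> + (real m - 1) * L)" by simp
  then have "orbit_average g m f x \<le> (1 / real m) *\<^sub>R (real m * f z + (\<epsilon> + (real m - 1) * L))"
    unfolding orbit_average_def by (rule scaleR_left_mono) simp
  also have "\<dots> = f z + ((1 - 1 / real m) * L + \<epsilon> / real m)"
    using m by (simp add: field_simps)
  finally have "orbit_average g m f x - f z \<le> (1 - 1 / real m) * L + \<epsilon> / real m" by simp
  moreover have "f z \<le> orbit_average g m f y"
  proof -
    have "(\<Sum>j<m. f z) \<le> (\<Sum>j<m. f (g j *v y))" by (intro sum_mono z(2)) (use xy in \<open>auto simp: ng\<close>)
    then show ?thesis using m by (simp add: orbit_average_def field_simps)
  qed
  ultimately show ?thesis by linarith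
qed

text \<open>Each average preserves the modulus of continuity on spheres and multiplies the excess of the
  oscillation over \<open>\<epsilon> / 2\<close> by \<open>1 - 1 / m\<close>, uniformly in the radius.\<close>

lemma orbit_average_nearly_radial:
  assumes f: "continuous_on UNIV f" and \<rho>: "0 < \<rho>" and \<epsilon>: "0 < \<epsilon>"
  obtains g and m k :: nat where "0 < m" "\<And>j. j < m \<Longrightarrow> g j \<in> G"
    "\<And>x y. norm x = norm y \<Longrightarrow> norm x \<le> \<rho> \<Longrightarrow> (orbit_average g m ^^ k) f x - (orbit_average g m ^^ k) f y \<le> \<epsilon>"
proof -
  have "uniformly_continuous_on (cball 0 \<rho>) f"
    by (intro compact_uniformly_continuous continuous_on_subset[OF f]) auto
  then obtain d where d: "0 < d" "\<And>x y. x \<in> cball 0 \<rho> \<Longrightarrow> y \<in> cball 0 \<rho> \<Longrightarrow> dist x y < d \<Longrightarrow> dist (f x) (f y) < \<epsilon> / 2"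
    using \<epsilon> unfolding uniformly_continuous_on_def by (metis half_gt_zero)
  define \<delta> where "\<delta> = d / (2 * \<rho>)"
  have \<delta>: "0 < \<delta>" "\<delta> * \<rho> \<le> d / 2" using d \<rho> by (auto simp: \<delta>_def)
  obtain g and m :: nat where m: "0 < m" and g: "\<And>j. j < m \<Longrightarrow> g j \<in> G"
    and net: "\<And>x y. norm x = norm y \<Longrightarrow> \<exists>j<m. norm (g j *v x - y) \<le> \<delta> * norm x"
    using finite_net[OF \<delta>(1)] by metis
  obtain C where C: "\<And>x. x \<in> cball 0 \<rho> \<Longrightarrow> \<bar>f x\<bar> \<le> C"
  proof -
    have "bounded (f ` cball 0 \<rho>)"
      by (intro compact_imp_bounded compact_continuous_image continuous_on_subset[OF f]) auto
    then show ?thesis using that by (force simp: bounded_iff)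
  qed
  define f' where "f' k = (orbit_average g m ^^ k) f" for k
  define c where "c = 1 - 1 / real m"
  have c: "0 \<le> c" "c < 1" using m by (auto simp: c_def)
  have f'_Suc: "f' (Suc k) = orbit_average g m (f' k)" for k by (simp add: f'_def)
  have ng: "norm (g j *v z) = norm z" if "j < m" for j z by (rule orthogonal_matrix_norm[OF G_orthogonal[OF g[OF that]]])
  have cont: "continuous_on UNIV (f' k)" for k
    by (induction k) (auto simp: f'_Suc f intro: continuous_on_orbit_average, simp add: f'_def f)
  have modulus: "f' k x - f' k y \<le> \<epsilon> / 2" if "norm x = norm y" "norm x \<le> \<rho>" "norm (x - y) \<le> d / 2" for k x y
    using that
  proof (induction k arbitrary: x y)
    case 0
    then have "dist x y < d" using d(1) by (simp add: dist_norm)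
    with d(2)[of x y] 0 have "\<bar>f x - f y\<bar> < \<epsilon> / 2" by (simp add: dist_real_def)
    then have "f x - f y \<le> \<epsilon> / 2" by linarith
    then show ?case by (simp add: f'_def)
  next
    case (Suc k)
    have "f' k (g j *v x) \<le> f' k (g j *v y) + \<epsilon> / 2" if "j < m" for j
    proof -
      have "norm (g j *v x - g j *v y) \<le> d / 2"
        using Suc.prems(3) ng[OF that, of "x - y"] by (simp add: matrix_vector_mult_diff_distrib)
      from Suc.IH[OF _ _ this] Suc.prems ng[OF that] show ?thesis by simp
    qed
    then have "orbit_average g m (f' k) x \<le> (1 / real m) *\<^sub>R (\<Sum>j<m. f' k (g j *v y) + \<epsilon> / 2)"
      unfolding orbit_average_def by (intro average_mono)
    also have "\<dots> = orbit_average g m (f' k) y + \<epsilon> / 2" unfolding orbit_average_def by (rule average_add_const[OF m])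
    finally show ?case by (simp add: f'_Suc)
  qed
  have osc: "f' k x - f' k y \<le> \<epsilon> / 2 + c ^ k * (2 * C)" if "norm x = norm y" "norm x \<le> \<rho>" for k x y
    using that
  proof (induction k arbitrary: x y)
    case 0
    then show ?case using C[of x] C[of y] \<epsilon> by (auto simp: f'_def)
  next
    case (Suc k)
    have "f' (Suc k) x - f' (Suc k) y \<le> (1 - 1 / real m) * (\<epsilon> / 2 + c ^ k * (2 * C)) + (\<epsilon> / 2) / real m"
      unfolding f'_Suc
      by (rule orbit_average_contracts[OF cont m g net \<delta>(2) _ modulus Suc.IH Suc.prems]) (use \<delta> in auto)
    also have "\<dots> = \<epsilon> / 2 + c ^ Suc k * (2 * C)"
      using m by (simp add: c_def[symmetric] algebra_simps) (simp add: c_def field_simps)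
    finally show ?case .
  qed
  have "(\<lambda>k. c ^ k * (2 * C)) \<longlonglongrightarrow> 0 * (2 * C)" using c by (intro tendsto_intros LIMSEQ_realpow_zero) auto
  then have "\<forall>\<^sub>F k in sequentially. c ^ k * (2 * C) < \<epsilon> / 2" using \<epsilon> by (intro order_tendstoD(2)) auto
  then obtain k where k: "c ^ k * (2 * C) < \<epsilon> / 2" unfolding eventually_sequentially by auto
  show thesis
  proof (rule that[OF m g, where k = k])
    fix x y :: "real^'n" assume "norm x = norm y" "norm x \<le> \<rho>"
    from osc[OF this, of k] k show "(orbit_average g m ^^ k) f x - (orbit_average g m ^^ k) f y \<le> \<epsilon>"
      unfolding f'_def by linarith
  qed
qed

text \<open>On a sphere the averaged \<open>u\<close> lies below the averaged \<open>\<xi>\<close>, which is nearly constant there. So the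
  boundary values in the comparison principles may be read off at arbitrary points \<open>y\<close> and \<open>z\<close>.\<close>

lemma averaged_comparison:
  assumes u: "global_subsolution F R a N u" and \<xi>: "continuous_on UNIV \<xi>" and u\<xi>: "\<And>x. u x \<le> \<xi> x"
    and \<rho>: "0 < \<rho>" and \<epsilon>: "0 < \<epsilon>"
  obtains g and m k :: nat where "0 < m" "\<And>j. j < m \<Longrightarrow> orthogonal_matrix (g j)"
    "\<And>x y. norm x \<le> norm y \<Longrightarrow> norm y \<le> \<rho> \<Longrightarrow> (orbit_average g m ^^ k) u x \<le> (orbit_average g m ^^ k) \<xi> y + \<epsilon>"
    "\<And>x y z. 0 < norm y \<Longrightarrow> norm y < norm x \<Longrightarrow> norm x < norm z \<Longrightarrow> norm z \<le> \<rho> \<Longrightarrow>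
      (orbit_average g m ^^ k) u x \<le> (orbit_average g m ^^ k) \<xi> y +
       ((orbit_average g m ^^ k) \<xi> z - (orbit_average g m ^^ k) \<xi> y) *
       ((riesz_kernel p (norm x) - riesz_kernel p (norm y)) / (riesz_kernel p (norm z) - riesz_kernel p (norm y))) + \<epsilon>"
proof -
  obtain g and m k :: nat where m: "0 < m" and g: "\<And>j. j < m \<Longrightarrow> g j \<in> G"
    and radial: "\<And>x y. norm x = norm y \<Longrightarrow> norm x \<le> \<rho> \<Longrightarrow> (orbit_average g m ^^ k) \<xi> x - (orbit_average g m ^^ k) \<xi> y \<le> \<epsilon>"
    using orbit_average_nearly_radial[OF \<xi> \<rho> \<epsilon>] by metis
  define v where "v = (orbit_average g m ^^ k) u"
  define \<eta> where "\<eta> = (orbit_average g m ^^ k) \<xi>"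
  have v: "subsolution F UNIV (\<lambda>x. ereal (v x))"
    unfolding v_def by (rule global_subsolutionD(1)[OF global_subsolution_orbit_average[OF u m g]])
  have v\<eta>: "v x \<le> \<eta> x" for x unfolding v_def \<eta>_def by (rule orbit_average_iterate_mono[OF u\<xi>])
  have sph: "v x \<le> \<eta> y + \<epsilon>" if "norm x = norm y" "norm y \<le> \<rho>" for x y
    using v\<eta>[of x] radial[of x y] that by (simp add: \<eta>_def)
  have max: "v x \<le> \<eta> y + \<epsilon>" if "norm x \<le> norm y" "norm y \<le> \<rho>" for x y
    using ball_maximum_principle[OF v, of "norm y" "\<eta> y + \<epsilon>" x] sph that by simp
  have three: "v x \<le> \<eta> y + (\<eta> z - \<eta> y) * ((riesz_kernel p (norm x) - riesz_kernel p (norm y)) / (riesz_kernel p (norm z) - riesz_kernel p (norm y))) + \<epsilon>"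
    if n: "0 < norm y" "norm y < norm x" "norm x < norm z" "norm z \<le> \<rho>" for x y z
  proof (cases "\<eta> y \<le> \<eta> z")
    case True
    have "ereal (v x) \<le> ereal ((\<eta> y + \<epsilon>) + ((\<eta> z + \<epsilon>) - (\<eta> y + \<epsilon>)) * ((riesz_kernel p (norm x) - riesz_kernel p (norm y)) / (riesz_kernel p (norm z) - riesz_kernel p (norm y))))"
      by (rule three_spheres_comparison[OF v]) (use n True sph in auto)
    then show ?thesis by simp
  next
    case False
    define \<theta> where "\<theta> = (riesz_kernel p (norm x) - riesz_kernel p (norm y)) / (riesz_kernel p (norm z) - riesz_kernel p (norm y))"
    have "riesz_kernel p (norm y) < riesz_kernel p (norm x)" "riesz_kernel p (norm x) < riesz_kernel p (norm z)"
      using n by (auto intro!: riesz_kernel_strict_mono intro: less_trans)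
    then have \<theta>: "\<theta> \<le> 1" by (simp add: \<theta>_def)
    have "0 \<le> (\<eta> y - \<eta> z) * (1 - \<theta>)" using False \<theta> by simp
    then have "\<eta> z \<le> \<eta> y + (\<eta> z - \<eta> y) * \<theta>" by (simp add: algebra_simps)
    moreover have "v x \<le> \<eta> z + \<epsilon>" by (rule max) (use n in auto)
    ultimately show ?thesis by (simp add: \<theta>_def)
  qed
  show thesis
    by (rule that[where k = k, OF m G_orthogonal[OF g]]) (use max three in \<open>auto simp: v_def \<eta>_def\<close>)
qed

end

section \<open>Means with respect to rotation invariant measures\<close>

definition locally_bounded_borel :: "('a::real_normed_vector \<Rightarrow> real) \<Rightarrow> bool" where
  "locally_bounded_borel f \<longleftrightarrow> f \<in> borel_measurable borel \<and> (\<forall>\<rho>. \<exists>C. \<forall>x\<in>cball 0 \<rho>. \<bar>f x\<bar> \<le> C)"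

lemma locally_bounded_borel_continuous:
  fixes f :: "real^'n \<Rightarrow> real"
  assumes "continuous_on UNIV f"
  shows "locally_bounded_borel f"
  unfolding locally_bounded_borel_def
proof (intro conjI allI)
  show "f \<in> borel_measurable borel" by (rule borel_measurable_continuous_onI[OF assms])
  fix \<rho>
  have "bounded (f ` cball 0 \<rho>)"
    by (intro compact_imp_bounded compact_continuous_image continuous_on_subset[OF assms]) auto
  then show "\<exists>C. \<forall>x\<in>cball 0 \<rho>. \<bar>f x\<bar> \<le> C" by (force simp: bounded_iff)
qed

lemma usc_borel_measurable:
  fixes u :: "'a::topological_space \<Rightarrow> real"
  assumes "usc_on UNIV (\<lambda>x. ereal (u x))"
  shows "u \<in> borel_measurable borel"
proof (rule borel_measurableI_less)
  fix c
  have "open {x. u x < c}"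
  proof (subst open_subopen, safe)
    fix x assume x: "u x < c"
    then have "\<forall>\<^sub>F y in at x within UNIV. ereal (u y) < ereal c"
      using assms unfolding usc_on_def by (metis UNIV_I less_ereal.simps(1))
    then obtain S where "open S" "x \<in> S" "\<forall>y\<in>S. y \<noteq> x \<longrightarrow> u y < c"
      unfolding eventually_at_topological by auto
    with x show "\<exists>T. open T \<and> x \<in> T \<and> T \<subseteq> {x. u x < c}" by (intro exI[of _ S]) auto
  qed
  then show "{x \<in> space borel. u x < c} \<in> sets borel" by simp
qed

lemma locally_bounded_borel_global_subsolution:
  fixes u :: "real^'n \<Rightarrow> real"
  assumes u: "global_subsolution F R a N u"
  shows "locally_bounded_borel u"
proof -
  note u' = global_subsolutionD[OF u]
  obtain M where M: "0 \<le> M" "\<And>x. u x \<le> a + N * (x \<bullet> x) + M" using global_subsolution_bound[OF u] by metis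
  have q: "locally_bounded_borel (\<lambda>x::real^'n. a + N * (x \<bullet> x))"
    by (rule locally_bounded_borel_continuous) (intro continuous_intros)
  have "\<exists>C. \<forall>x\<in>cball 0 \<rho>. \<bar>u x\<bar> \<le> C" for \<rho>
  proof -
    obtain C where C: "\<forall>x\<in>cball (0::real^'n) \<rho>. \<bar>a + N * (x \<bullet> x)\<bar> \<le> C"
      using q unfolding locally_bounded_borel_def by blast
    have "\<bar>u x\<bar> \<le> C + M" if "x \<in> cball 0 \<rho>" for x
      using bspec[OF C that] M(2)[of x] M(1) u'(3)[of x] by (simp add: abs_le_iff)
    then show ?thesis by blast
  qed
  then show ?thesis
    using usc_borel_measurable[OF subsolutionD(3)[OF u'(1)]] by (simp add: locally_bounded_borel_def)
qed

lemma locally_bounded_borel_orbit_average: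
  assumes f: "locally_bounded_borel f" and g: "\<And>j. j < m \<Longrightarrow> orthogonal_matrix (g j)"
  shows "locally_bounded_borel (orbit_average g m f)"
  unfolding locally_bounded_borel_def
proof (intro conjI allI)
  have [measurable]: "f \<in> borel_measurable borel" using f by (simp add: locally_bounded_borel_def)
  have [measurable]: "(\<lambda>x. h *v x) \<in> borel_measurable borel" for h :: "real^'n^'n"
    by (intro borel_measurable_continuous_onI bounded_linear.continuous_on[OF matrix_vector_mul_bounded_linear] continuous_intros)
  show "orbit_average g m f \<in> borel_measurable borel"
    unfolding orbit_average_def[abs_def] by measurable
  fix \<rho>
  obtain C where C: "\<And>x. x \<in> cball 0 \<rho> \<Longrightarrow> \<bar>f x\<bar> \<le> C"
    using f unfolding locally_bounded_borel_def by blast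
  have "\<bar>orbit_average g m f x\<bar> \<le> (1 / real m) *\<^sub>R (\<Sum>j<m. C)" if "x \<in> cball 0 \<rho>" for x
  proof -
    have "\<bar>\<Sum>j<m. f (g j *v x)\<bar> \<le> (\<Sum>j<m. C)"
      by (rule order_trans[OF sum_abs sum_mono]) (use that C g in \<open>auto simp: orthogonal_matrix_norm\<close>)
    then have "(1 / real m) * \<bar>\<Sum>j<m. f (g j *v x)\<bar> \<le> (1 / real m) * (\<Sum>j<m. C)" by (rule mult_left_mono) simp
    then show ?thesis by (simp add: orbit_average_def abs_mult)
  qed
  then show "\<exists>C. \<forall>x\<in>cball 0 \<rho>. \<bar>orbit_average g m f x\<bar> \<le> C" by blast
qed

text \<open>Covers Lebesgue measure on the unit ball and surface measure on the unit sphere. The underlying space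
  may be smaller than \<open>real^'n\<close>, so its relation to Borel sets is expressed by measurability of the inclusion.\<close>

locale rotation_measure = finite_measure M for M :: "(real^'n) measure" +
  assumes space_subset: "space M \<subseteq> cball 0 1"
    and id_measurable: "(\<lambda>x. x) \<in> M \<rightarrow>\<^sub>M borel"
    and rotation: "\<And>g. orthogonal_matrix g \<Longrightarrow> (\<lambda>x. g *v x) \<in> M \<rightarrow>\<^sub>M M \<and> distr M M (\<lambda>x. g *v x) = M"
begin

definition mean :: "(real^'n \<Rightarrow> real) \<Rightarrow> real \<Rightarrow> real" where
  "mean f t = (\<integral>y. f (t *\<^sub>R y) \<partial>M)"

lemma scaled_in_cball: "y \<in> space M \<Longrightarrow> 0 \<le> t \<Longrightarrow> t *\<^sub>R y \<in> cball 0 t"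
  using space_subset mult_left_mono[of "norm y" 1 t] by auto

lemma measurable_scaled: "f \<in> borel_measurable borel \<Longrightarrow> (\<lambda>y. f (t *\<^sub>R y)) \<in> borel_measurable M"
  by (rule measurable_compose[OF _ ]) (use id_measurable in measurable)

lemma integrable_scaled:
  assumes f: "locally_bounded_borel f" and t: "0 \<le> t"
  shows "integrable M (\<lambda>y. f (t *\<^sub>R y))"
proof -
  obtain C where C: "\<And>x. x \<in> cball 0 t \<Longrightarrow> \<bar>f x\<bar> \<le> C"
    using f unfolding locally_bounded_borel_def by blast
  show ?thesis
    by (rule integrable_const_bound[where B = C])
       (use f C scaled_in_cball[OF _ t] in \<open>auto simp: locally_bounded_borel_def intro!: AE_I2 measurable_scaled\<close>)
qed

lemma mean_rotate:
  assumes f: "locally_bounded_borel f" and g: "orthogonal_matrix g"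
  shows "mean (\<lambda>x. f (g *v x)) t = mean f t"
proof -
  have f': "(\<lambda>y. f (t *\<^sub>R y)) \<in> borel_measurable M"
    using f by (intro measurable_scaled) (simp add: locally_bounded_borel_def)
  have "mean f t = (\<integral>y. f (t *\<^sub>R y) \<partial>distr M M (\<lambda>x. g *v x))" using rotation[OF g] by (simp add: mean_def)
  also have "\<dots> = (\<integral>y. f (t *\<^sub>R (g *v y)) \<partial>M)"
    by (rule integral_distr) (use rotation[OF g] f' in auto)
  also have "\<dots> = mean (\<lambda>x. f (g *v x)) t" by (simp add: mean_def matrix_vector_mult_scaleR)
  finally show ?thesis ..
qed

lemma mean_orbit_average:
  assumes f: "locally_bounded_borel f" and g: "\<And>j. j < m \<Longrightarrow> orthogonal_matrix (g j)" and m: "0 < m" and t: "0 \<le> t"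
  shows "mean (orbit_average g m f) t = mean f t"
proof -
  have "locally_bounded_borel (\<lambda>x. f (g j *v x))" if "j < m" for j
  proof -
    have "locally_bounded_borel (orbit_average (\<lambda>_. g j) 1 f)"
      by (rule locally_bounded_borel_orbit_average[OF f]) (use g that in auto)
    then show ?thesis by (simp add: orbit_average_def[abs_def])
  qed
  then have int: "integrable M (\<lambda>y. f (g j *v (t *\<^sub>R y)))" if "j < m" for j
    using integrable_scaled[OF _ t] that by blast
  have "mean (orbit_average g m f) t = (1 / real m) * (\<Sum>j<m. mean (\<lambda>x. f (g j *v x)) t)"
    unfolding mean_def orbit_average_def real_scaleR_def
    by (subst integral_mult_right_zero, subst Bochner_Integration.integral_sum) (use int in auto)
  also have "\<dots> = (1 / real m) * (\<Sum>j<m. mean f t)"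
    using mean_rotate[OF f g] by simp
  finally show ?thesis using m by simp
qed

lemma mean_orbit_average_iterate:
  assumes f: "locally_bounded_borel f" and g: "\<And>j. j < m \<Longrightarrow> orthogonal_matrix (g j)" and m: "0 < m" and t: "0 \<le> t"
  shows "locally_bounded_borel ((orbit_average g m ^^ k) f) \<and> mean ((orbit_average g m ^^ k) f) t = mean f t"
proof (induction k)
  case (Suc k)
  then show ?case
    using locally_bounded_borel_orbit_average[of "(orbit_average g m ^^ k) f" m g]
      mean_orbit_average[of "(orbit_average g m ^^ k) f" m g t] g m t by simp
qed (use f in simp)

lemma mean_limit:
  assumes u: "locally_bounded_borel u" and \<eta>: "\<And>k. locally_bounded_borel (\<eta> k)"
    and between: "\<And>k x. u x \<le> \<eta> k x" "\<And>k x. \<eta> (Suc k) x \<le> \<eta> k x"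
    and lim: "\<And>x. (\<lambda>k. \<eta> k x) \<longlonglongrightarrow> u x" and t: "0 \<le> t"
  shows "(\<lambda>k. mean (\<eta> k) t) \<longlonglongrightarrow> mean u t"
  unfolding mean_def
proof (rule integral_dominated_convergence[where w = "\<lambda>y. \<bar>u (t *\<^sub>R y)\<bar> + \<bar>\<eta> 0 (t *\<^sub>R y)\<bar>"])
  show "(\<lambda>y. u (t *\<^sub>R y)) \<in> borel_measurable M" "(\<lambda>y. \<eta> k (t *\<^sub>R y)) \<in> borel_measurable M" for k
    using integrable_scaled[OF u t] integrable_scaled[OF \<eta> t] by auto
  show "integrable M (\<lambda>y. \<bar>u (t *\<^sub>R y)\<bar> + \<bar>\<eta> 0 (t *\<^sub>R y)\<bar>)"
    using integrable_scaled[OF u t] integrable_scaled[OF \<eta> t] by auto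
  have le0: "\<eta> k x \<le> \<eta> 0 x" for k x
    by (induction k) (auto intro: order_trans[OF between(2)])
  show "AE y in M. norm (\<eta> k (t *\<^sub>R y)) \<le> \<bar>u (t *\<^sub>R y)\<bar> + \<bar>\<eta> 0 (t *\<^sub>R y)\<bar>" for k
  proof (rule AE_I2)
    fix y
    show "norm (\<eta> k (t *\<^sub>R y)) \<le> \<bar>u (t *\<^sub>R y)\<bar> + \<bar>\<eta> 0 (t *\<^sub>R y)\<bar>"
      using between(1)[of "t *\<^sub>R y" k] le0[of k "t *\<^sub>R y"] by (simp add: abs_if split: if_splits)
  qed
qed (use lim in auto)

end

text \<open>Hence the interpolation ratio between three radii does not change when all of them are multiplied by
  \<open>c\<close>, which allows integration of the comparison over all rays at once.\<close>

lemma riesz_kernel_scale: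
  assumes c: "0 < c"
  obtains \<gamma> where "0 < \<gamma>" "\<And>s t. 0 < s \<Longrightarrow> 0 < t \<Longrightarrow> riesz_kernel p (t * c) - riesz_kernel p (s * c) = \<gamma> * (riesz_kernel p t - riesz_kernel p s)"
proof (cases "p = 2")
  case True
  show thesis by (rule that[of 1]) (use True c in \<open>auto simp: riesz_kernel_def ln_mult\<close>)
next
  case False
  show thesis
    by (rule that[of "c powr (2 - p)"]) (use False c in \<open>auto simp: riesz_kernel_def powr_mult algebra_simps\<close>)
qed

context st_cone
begin

text \<open>The common limiting procedure: first \<open>\<epsilon> \<rightarrow> 0\<close> with \<open>\<xi>\<close> fixed, then \<open>\<xi>\<close> decreases to \<open>u\<close>.\<close>

lemma mean_le_of_pointwise:
  assumes u: "global_subsolution F R a N u"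
    and M: "rotation_measure M"
    and le: "\<And>\<xi> \<epsilon>. continuous_on UNIV \<xi> \<Longrightarrow> (\<And>x. u x \<le> \<xi> x) \<Longrightarrow> 0 < \<epsilon> \<Longrightarrow> A \<le> B \<xi> + \<epsilon> * C"
    and B: "\<And>\<eta>. (\<And>k. locally_bounded_borel (\<eta> k)) \<Longrightarrow> (\<And>k x. u x \<le> \<eta> k x) \<Longrightarrow> (\<And>k x. \<eta> (Suc k) x \<le> \<eta> k x) \<Longrightarrow>
       (\<And>x. (\<lambda>k. \<eta> k x) \<longlonglongrightarrow> u x) \<Longrightarrow> (\<lambda>k. B (\<eta> k)) \<longlonglongrightarrow> B u"
    and C: "0 \<le> C"
  shows "A \<le> (B u :: real)"
proof -
  have le': "A \<le> B \<xi>" if \<xi>: "continuous_on UNIV \<xi>" "\<And>x. u x \<le> \<xi> x" for \<xi>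
  proof (rule field_le_epsilon)
    fix e :: real assume e: "0 < e"
    have "A \<le> B \<xi> + (e / (C + 1)) * C" by (rule le[OF \<xi>]) (use e C in auto)
    also have "(e / (C + 1)) * C \<le> e" using e C by (simp add: field_simps)
    finally show "A \<le> B \<xi> + e" by simp
  qed
  obtain M0 where M0: "\<And>x. u x \<le> a + N * (x \<bullet> x) + M0" using global_subsolution_bound[OF u] by metis
  obtain \<eta> :: "nat \<Rightarrow> real^'n \<Rightarrow> real" where \<eta>: "\<And>k. continuous_on UNIV (\<eta> k)" "\<And>k x. u x \<le> \<eta> k x"
    "\<And>k x. \<eta> (Suc k) x \<le> \<eta> k x" "\<And>x. (\<lambda>k. \<eta> k x) \<longlonglongrightarrow> u x"
    using global_subsolution_majorants[OF u M0] by metis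
  have "(\<lambda>k. B (\<eta> k)) \<longlonglongrightarrow> B u"
    by (rule B) (use \<eta> in \<open>auto intro: locally_bounded_borel_continuous\<close>)
  then show ?thesis by (rule LIMSEQ_le_const) (use le' \<eta> in auto)
qed

lemma mean_convex:
  assumes u: "global_subsolution F R a N u" and M: "rotation_measure M" and st: "0 < s" "s < t" "t < r"
  defines "I \<equiv> rotation_measure.mean M"
  shows "I u t \<le> I u s + (I u r - I u s) * ((riesz_kernel p t - riesz_kernel p s) / (riesz_kernel p r - riesz_kernel p s))"
proof -
  interpret rotation_measure M by (rule M)
  define \<theta> where "\<theta> = (riesz_kernel p t - riesz_kernel p s) / (riesz_kernel p r - riesz_kernel p s)"
  have pos: "0 < t" "0 < r" using st by auto
  have "mean u t \<le> mean u s + (mean u r - mean u s) * \<theta>"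
  proof (rule mean_le_of_pointwise[OF u M, where C = "measure M (space M)" and B = "\<lambda>\<xi>. mean \<xi> s + (mean \<xi> r - mean \<xi> s) * \<theta>"])
    fix \<xi> :: "real^'n \<Rightarrow> real" and \<epsilon> :: real
    assume \<xi>: "continuous_on UNIV \<xi>" "\<And>x. u x \<le> \<xi> x" and \<epsilon>: "0 < \<epsilon>"
    obtain g and m k :: nat where m: "0 < m" and g: "\<And>j. j < m \<Longrightarrow> orthogonal_matrix (g j)"
      and max: "\<And>x y. norm x \<le> norm y \<Longrightarrow> norm y \<le> r \<Longrightarrow> (orbit_average g m ^^ k) u x \<le> (orbit_average g m ^^ k) \<xi> y + \<epsilon>"
      and three: "\<And>x y z. 0 < norm y \<Longrightarrow> norm y < norm x \<Longrightarrow> norm x < norm z \<Longrightarrow> norm z \<le> r \<Longrightarrow>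
      (orbit_average g m ^^ k) u x \<le> (orbit_average g m ^^ k) \<xi> y +
       ((orbit_average g m ^^ k) \<xi> z - (orbit_average g m ^^ k) \<xi> y) *
       ((riesz_kernel p (norm x) - riesz_kernel p (norm y)) / (riesz_kernel p (norm z) - riesz_kernel p (norm y))) + \<epsilon>"
      by (rule averaged_comparison[OF u \<xi> pos(2) \<epsilon>]) blast
    define v where "v = (orbit_average g m ^^ k) u"
    define \<eta> where "\<eta> = (orbit_average g m ^^ k) \<xi>"
    have lu: "locally_bounded_borel u" and l\<xi>: "locally_bounded_borel \<xi>"
      using locally_bounded_borel_global_subsolution[OF u] locally_bounded_borel_continuous[OF \<xi>(1)] by auto
    have v: "locally_bounded_borel v" "\<And>t. 0 \<le> t \<Longrightarrow> mean v t = mean u t"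
      using mean_orbit_average_iterate[where f = u and g = g and m = m and k = k, OF lu g m] pos unfolding v_def by auto
    have \<eta>: "locally_bounded_borel \<eta>" "\<And>t. 0 \<le> t \<Longrightarrow> mean \<eta> t = mean \<xi> t"
      using mean_orbit_average_iterate[where f = \<xi> and g = g and m = m and k = k, OF l\<xi> g m] pos unfolding \<eta>_def by auto
    have pw: "v (t *\<^sub>R y) \<le> \<eta> (s *\<^sub>R y) + (\<eta> (r *\<^sub>R y) - \<eta> (s *\<^sub>R y)) * \<theta> + \<epsilon>" if y: "y \<in> space M" for y
    proof (cases "y = 0")
      case True
      then show ?thesis using max[of 0 0] pos by (simp add: v_def \<eta>_def)
    next
      case False
      then have n: "0 < norm y" by simp
      obtain \<gamma> where \<gamma>: "0 < \<gamma>" "\<And>s t. 0 < s \<Longrightarrow> 0 < t \<Longrightarrow> riesz_kernel p (t * norm y) - riesz_kernel p (s * norm y) = \<gamma> * (riesz_kernel p t - riesz_kernel p s)"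
        using riesz_kernel_scale[OF n, of p] by metis
      have "norm y \<le> 1" using space_subset y by auto
      then have ry: "norm (r *\<^sub>R y) \<le> r" using mult_left_mono[of "norm y" 1 r] pos by simp
      have "v (t *\<^sub>R y) \<le> \<eta> (s *\<^sub>R y) + (\<eta> (r *\<^sub>R y) - \<eta> (s *\<^sub>R y)) *
        ((riesz_kernel p (norm (t *\<^sub>R y)) - riesz_kernel p (norm (s *\<^sub>R y))) / (riesz_kernel p (norm (r *\<^sub>R y)) - riesz_kernel p (norm (s *\<^sub>R y)))) + \<epsilon>"
        unfolding v_def \<eta>_def by (rule three) (use st pos n ry in auto)
      also have "(riesz_kernel p (norm (t *\<^sub>R y)) - riesz_kernel p (norm (s *\<^sub>R y))) / (riesz_kernel p (norm (r *\<^sub>R y)) - riesz_kernel p (norm (s *\<^sub>R y))) = \<theta>"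
        using \<gamma> st pos by (simp add: \<theta>_def)
      finally show ?thesis .
    qed
    have iv: "integrable M (\<lambda>y. v (t *\<^sub>R y))" "integrable M (\<lambda>y. \<eta> (s *\<^sub>R y))" "integrable M (\<lambda>y. \<eta> (r *\<^sub>R y))"
      by (rule integrable_scaled, (rule v \<eta>)+, use st in simp)+
    have "mean v t \<le> (\<integral>y. \<eta> (s *\<^sub>R y) + (\<eta> (r *\<^sub>R y) - \<eta> (s *\<^sub>R y)) * \<theta> + \<epsilon> \<partial>M)"
      unfolding mean_def by (rule integral_mono) (use iv pw in auto)
    also have "\<dots> = mean \<eta> s + (mean \<eta> r - mean \<eta> s) * \<theta> + \<epsilon> * measure M (space M)"
      unfolding mean_def using iv by simp
    finally show "mean u t \<le> mean \<xi> s + (mean \<xi> r - mean \<xi> s) * \<theta> + \<epsilon> * measure M (space M)"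
      using v(2)[of t] \<eta>(2)[of s] \<eta>(2)[of r] st by simp
  next
    fix \<eta> :: "nat \<Rightarrow> real^'n \<Rightarrow> real"
    assume "\<And>k. locally_bounded_borel (\<eta> k)" "\<And>k x. u x \<le> \<eta> k x" "\<And>k x. \<eta> (Suc k) x \<le> \<eta> k x" "\<And>x. (\<lambda>k. \<eta> k x) \<longlonglongrightarrow> u x"
    note lim = mean_limit[OF locally_bounded_borel_global_subsolution[OF u] this]
    show "(\<lambda>k. mean (\<eta> k) s + (mean (\<eta> k) r - mean (\<eta> k) s) * \<theta>) \<longlonglongrightarrow> mean u s + (mean u r - mean u s) * \<theta>"
      by (intro tendsto_intros lim) (use st in auto)
  qed simp
  then show ?thesis unfolding I_def \<theta>_def .
qed

text \<open>The maximum principle for the averaged \<open>u\<close>, integrated over both measures. It is applied with the ball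
  and the sphere and then replaces integration in polar coordinates.\<close>

lemma mean_mono_norm:
  assumes u: "global_subsolution F R a N u" and M1: "rotation_measure M1" and M2: "rotation_measure M2" and t: "0 < t"
    and norms: "\<And>x y. x \<in> space M1 \<Longrightarrow> y \<in> space M2 \<Longrightarrow> norm x \<le> norm y"
  shows "rotation_measure.mean M1 u t * measure M2 (space M2) \<le> rotation_measure.mean M2 u t * measure M1 (space M1)"
proof -
  interpret M1: rotation_measure M1 by (rule M1)
  interpret M2: rotation_measure M2 by (rule M2)
  define m1 where "m1 = measure M1 (space M1)"
  define m2 where "m2 = measure M2 (space M2)"
  have m12: "0 \<le> m1" "0 \<le> m2" by (auto simp: m1_def m2_def)
  show ?thesis
    unfolding m1_def[symmetric] m2_def[symmetric]
  proof (rule mean_le_of_pointwise[OF u M2, where C = "m1 * m2" and B = "\<lambda>\<xi>. M2.mean \<xi> t * m1"])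
    fix \<xi> :: "real^'n \<Rightarrow> real" and \<epsilon> :: real
    assume \<xi>: "continuous_on UNIV \<xi>" "\<And>x. u x \<le> \<xi> x" and \<epsilon>: "0 < \<epsilon>"
    obtain g and m k :: nat where m: "0 < m" and g: "\<And>j. j < m \<Longrightarrow> orthogonal_matrix (g j)"
      and max: "\<And>x y. norm x \<le> norm y \<Longrightarrow> norm y \<le> t \<Longrightarrow> (orbit_average g m ^^ k) u x \<le> (orbit_average g m ^^ k) \<xi> y + \<epsilon>"
      by (rule averaged_comparison[OF u \<xi> t \<epsilon>]) blast
    define v where "v = (orbit_average g m ^^ k) u"
    define \<eta> where "\<eta> = (orbit_average g m ^^ k) \<xi>"
    have lu: "locally_bounded_borel u" and l\<xi>: "locally_bounded_borel \<xi>"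
      using locally_bounded_borel_global_subsolution[OF u] locally_bounded_borel_continuous[OF \<xi>(1)] by auto
    have v: "locally_bounded_borel v" "M1.mean v t = M1.mean u t"
      using M1.mean_orbit_average_iterate[OF lu g m, where k = k and t = t] t unfolding v_def by auto
    have \<eta>: "locally_bounded_borel \<eta>" "M2.mean \<eta> t = M2.mean \<xi> t"
      using M2.mean_orbit_average_iterate[OF l\<xi> g m, where k = k and t = t] t unfolding \<eta>_def by auto
    have iv: "integrable M1 (\<lambda>y. v (t *\<^sub>R y))" "integrable M2 (\<lambda>y. \<eta> (t *\<^sub>R y))"
      using M1.integrable_scaled[OF v(1)] M2.integrable_scaled[OF \<eta>(1)] t by auto
    have le: "M1.mean v t \<le> (\<eta> (t *\<^sub>R y) + \<epsilon>) * m1" if y: "y \<in> space M2" for y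
    proof -
      have "M1.mean v t \<le> (\<integral>x. \<eta> (t *\<^sub>R y) + \<epsilon> \<partial>M1)"
        unfolding M1.mean_def
      proof (rule integral_mono)
        fix x assume x: "x \<in> space M1"
        have "norm (t *\<^sub>R x) \<le> norm (t *\<^sub>R y)" using norms[OF x y] t by simp
        moreover have "norm (t *\<^sub>R y) \<le> t" using M2.scaled_in_cball[OF y, of t] t by simp
        ultimately show "v (t *\<^sub>R x) \<le> \<eta> (t *\<^sub>R y) + \<epsilon>" unfolding v_def \<eta>_def by (rule max)
      qed (use iv in auto)
      then show ?thesis by (simp add: m1_def mult.commute)
    qed
    have "(\<integral>y. M1.mean v t \<partial>M2) \<le> (\<integral>y. (\<eta> (t *\<^sub>R y) + \<epsilon>) * m1 \<partial>M2)"
      by (rule integral_mono) (use iv le in auto)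
    also have "\<dots> = (M2.mean \<eta> t + \<epsilon> * m2) * m1"
      unfolding M2.mean_def using iv by (simp add: m2_def mult.commute)
    finally show "M1.mean u t * m2 \<le> M2.mean \<xi> t * m1 + \<epsilon> * (m1 * m2)"
      using v(2) \<eta>(2) by (simp add: m2_def algebra_simps)
  next
    fix \<eta> :: "nat \<Rightarrow> real^'n \<Rightarrow> real"
    assume "\<And>k. locally_bounded_borel (\<eta> k)" "\<And>k x. u x \<le> \<eta> k x" "\<And>k x. \<eta> (Suc k) x \<le> \<eta> k x" "\<And>x. (\<lambda>k. \<eta> k x) \<longlonglongrightarrow> u x"
    note lim = M2.mean_limit[OF locally_bounded_borel_global_subsolution[OF u] this]
    show "(\<lambda>k. M2.mean (\<eta> k) t * m1) \<longlonglongrightarrow> M2.mean u t * m1"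
      by (intro tendsto_intros lim) (use t in auto)
  qed (use m12 in simp)
qed

text \<open>Averaging over rotations does not change the value at the origin, so the maximum principle gives the
  sub-mean value inequality.\<close>

lemma value_at_0_le_mean:
  assumes u: "global_subsolution F R a N u" and M: "rotation_measure M" and t: "0 < t"
  shows "u 0 * measure M (space M) \<le> rotation_measure.mean M u t"
proof -
  interpret rotation_measure M by (rule M)
  show ?thesis
  proof (rule mean_le_of_pointwise[OF u M, where C = "measure M (space M)" and B = "\<lambda>\<xi>. mean \<xi> t"])
    fix \<xi> :: "real^'n \<Rightarrow> real" and \<epsilon> :: real
    assume \<xi>: "continuous_on UNIV \<xi>" "\<And>x. u x \<le> \<xi> x" and \<epsilon>: "0 < \<epsilon>"
    obtain g and m k :: nat where m: "0 < m" and g: "\<And>j. j < m \<Longrightarrow> orthogonal_matrix (g j)"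
      and max: "\<And>x y. norm x \<le> norm y \<Longrightarrow> norm y \<le> t \<Longrightarrow> (orbit_average g m ^^ k) u x \<le> (orbit_average g m ^^ k) \<xi> y + \<epsilon>"
      by (rule averaged_comparison[OF u \<xi> t \<epsilon>]) blast
    define \<eta> where "\<eta> = (orbit_average g m ^^ k) \<xi>"
    have \<eta>: "locally_bounded_borel \<eta>" "mean \<eta> t = mean \<xi> t"
      using mean_orbit_average_iterate[OF locally_bounded_borel_continuous[OF \<xi>(1)] g m, where k = k and t = t] t unfolding \<eta>_def by auto
    have iv: "integrable M (\<lambda>y. \<eta> (t *\<^sub>R y))" using integrable_scaled[OF \<eta>(1)] t by auto
    have "(\<integral>y. u 0 \<partial>M) \<le> (\<integral>y. \<eta> (t *\<^sub>R y) + \<epsilon> \<partial>M)"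
    proof (rule integral_mono)
      fix y assume y: "y \<in> space M"
      have "norm (t *\<^sub>R y) \<le> t" using scaled_in_cball[OF y, of t] t by simp
      then show "u 0 \<le> \<eta> (t *\<^sub>R y) + \<epsilon>"
        using max[of 0 "t *\<^sub>R y"] by (simp add: \<eta>_def orbit_average_iterate_0[OF m])
    qed (use iv in auto)
    then show "u 0 * measure M (space M) \<le> mean \<xi> t + \<epsilon> * measure M (space M)"
      using iv \<eta>(2) by (simp add: mean_def mult.commute)
  qed (use mean_limit[OF locally_bounded_borel_global_subsolution[OF u]] t in auto)
qed

end

section \<open>Rotation invariance of Lebesgue measure\<close>

lemma nn_integral_lborel_translate:
  fixes f :: "'a::euclidean_space \<Rightarrow> ennreal"
  assumes [measurable]: "f \<in> borel_measurable borel"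
  shows "(\<integral>\<^sup>+x. f (x + c) \<partial>lborel) = (\<integral>\<^sup>+x. f x \<partial>lborel)"
proof -
  have "(\<integral>\<^sup>+x. f x \<partial>lborel) = (\<integral>\<^sup>+x. f x \<partial>distr lborel borel ((+) c))" by (simp add: lborel_distr_plus)
  also have "\<dots> = (\<integral>\<^sup>+x. f (c + x) \<partial>lborel)" by (subst nn_integral_distr) auto
  finally show ?thesis by (simp add: add.commute)
qed

text \<open>The argument for uniqueness of translation invariant measures, applied to \<open>A \<mapsto> |T\<^sup>-\<^sup>1A|\<close>: write the
  left-hand side as a double integral, translate \<open>y\<close> by \<open>T x\<close>, exchange the integrals and translate \<open>x\<close> back.\<close>

lemma emeasure_lborel_linear_vimage_product:
  fixes T T' :: "'a::euclidean_space \<Rightarrow> 'a"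
  assumes lin: "linear T" and inv: "\<And>x. T (T' x) = x"
    and [measurable]: "A \<in> sets borel" "B \<in> sets borel"
  shows "emeasure lborel (T -` A) * emeasure lborel B = emeasure lborel (T -` B) * emeasure lborel (uminus -` A)"
proof -
  have [measurable]: "T \<in> borel_measurable borel"
    by (intro borel_measurable_continuous_onI linear_continuous_on linear_conv_bounded_linear[THEN iffD1] lin)
  have vim [measurable]: "T -` C \<in> sets borel" if "C \<in> sets borel" for C
    using measurable_sets[OF \<open>T \<in> borel_measurable borel\<close> that] by simp
  have Tdiff: "T (x - T' y) = T x - y" for x y using inv by (simp add: linear_diff[OF lin])
  have "emeasure lborel (T -` A) * emeasure lborel B
    = (\<integral>\<^sup>+x. indicator A (T x) * (\<integral>\<^sup>+y. indicator B y \<partial>lborel) \<partial>lborel)"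
    by (subst nn_integral_multc) (auto simp: nn_integral_indicator[symmetric] indicator_vimage simp del: nn_integral_indicator)
  also have "\<dots> = (\<integral>\<^sup>+x. (\<integral>\<^sup>+y. indicator A (T x) * indicator B (y + T x) \<partial>lborel) \<partial>lborel)"
    by (subst nn_integral_cmult) (auto simp: nn_integral_lborel_translate)
  also have "\<dots> = (\<integral>\<^sup>+y. (\<integral>\<^sup>+x. indicator A (T x) * indicator B (y + T x) \<partial>lborel) \<partial>lborel)"
    by (rule lborel_pair.Fubini') measurable
  also have "\<dots> = (\<integral>\<^sup>+y. (\<integral>\<^sup>+x. indicator A (T x - y) * indicator B (T x) \<partial>lborel) \<partial>lborel)"
  proof (rule nn_integral_cong)
    fix y
    have "(\<integral>\<^sup>+x. indicator A (T x) * indicator B (y + T x) \<partial>lborel)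
      = (\<integral>\<^sup>+x. (indicator A (T (x + (- T' y))) * indicator B (y + T (x + (- T' y))) :: ennreal) \<partial>lborel)"
      by (subst nn_integral_lborel_translate[symmetric, of _ "- T' y"]) auto
    then show "(\<integral>\<^sup>+x. indicator A (T x) * indicator B (y + T x) \<partial>lborel)
       = (\<integral>\<^sup>+x. indicator A (T x - y) * (indicator B (T x) :: ennreal) \<partial>lborel)"
      by (simp add: Tdiff)
  qed
  also have "\<dots> = (\<integral>\<^sup>+x. (\<integral>\<^sup>+y. indicator A (T x - y) * indicator B (T x) \<partial>lborel) \<partial>lborel)"
    by (rule lborel_pair.Fubini') measurable
  also have "\<dots> = (\<integral>\<^sup>+x. emeasure lborel (uminus -` A) * indicator B (T x) \<partial>lborel)"
  proof (rule nn_integral_cong)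
    fix x
    have "(\<integral>\<^sup>+y. indicator A (T x - y) * indicator B (T x) \<partial>lborel)
      = (\<integral>\<^sup>+y. (indicator A (T x - y) :: ennreal) \<partial>lborel) * indicator B (T x)"
      by (rule nn_integral_multc) measurable
    also have "(\<integral>\<^sup>+y. (indicator A (T x - y) :: ennreal) \<partial>lborel) = (\<integral>\<^sup>+y. indicator A (T x - (y + T x)) \<partial>lborel)"
      by (rule nn_integral_lborel_translate[symmetric]) measurable
    also have "\<dots> = (\<integral>\<^sup>+y. indicator (uminus -` A) y \<partial>lborel)" by (simp add: indicator_vimage)
    also have "\<dots> = emeasure lborel (uminus -` A)"
    proof (rule nn_integral_indicator)
      have "uminus -` A \<inter> space borel \<in> sets (borel :: 'a measure)"
        by (rule measurable_sets[of uminus borel borel]) auto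
      then show "uminus -` A \<in> sets lborel" by simp
    qed
    finally show "(\<integral>\<^sup>+y. indicator A (T x - y) * indicator B (T x) \<partial>lborel) = emeasure lborel (uminus -` A) * indicator B (T x)" .
  qed
  also have "\<dots> = emeasure lborel (uminus -` A) * (\<integral>\<^sup>+x. indicator B (T x) \<partial>lborel)"
    by (rule nn_integral_cmult) measurable
  also have "(\<integral>\<^sup>+x. indicator B (T x) \<partial>lborel) = emeasure lborel (T -` B)"
  proof -
    have "(\<lambda>x. indicator B (T x) :: ennreal) = indicator (T -` B)" by (simp add: fun_eq_iff indicator_vimage)
    then show ?thesis by (simp add: vim)
  qed
  finally show ?thesis by (simp add: mult.commute)
qed

text \<open>Both sides of the claim are determined by the product formula with \<open>B\<close> the unit ball, which is its own
  preimage under \<open>g\<close>.\<close>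

lemma distr_lborel_orthogonal:
  fixes g :: "real^'n^'n"
  assumes g: "orthogonal_matrix g"
  shows "distr lborel borel (\<lambda>x. g *v x) = lborel"
proof (rule measure_eqI)
  have meas: "(\<lambda>x. g *v x) \<in> borel_measurable borel"
    by (intro borel_measurable_continuous_onI bounded_linear.continuous_on[OF matrix_vector_mul_bounded_linear] continuous_intros)
  fix A assume "A \<in> sets (distr lborel borel (\<lambda>x. g *v x))"
  then have A: "A \<in> sets borel" by simp
  define D where "D = cball (0::real^'n) 1"
  have D: "D \<in> sets borel" by (simp add: D_def)
  have gt: "g *v (transpose g *v x) = x" for x
    using g by (metis matrix_vector_mul_assoc matrix_vector_mul_lid orthogonal_matrix_def)
  have gD: "(\<lambda>x. g *v x) -` D = D" by (auto simp: D_def orthogonal_matrix_norm[OF g])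
  have fin: "emeasure lborel D \<noteq> \<infinity>" using emeasure_lborel_cball_finite[of 0 1] by (simp add: D_def less_top)
  have pos: "emeasure lborel D \<noteq> 0"
    using content_cball_pos[of 1 "0::real^'n"] by (auto simp: D_def measure_def)
  have "emeasure lborel ((\<lambda>x. g *v x) -` A) * emeasure lborel D = emeasure lborel D * emeasure lborel (uminus -` A)"
    using emeasure_lborel_linear_vimage_product[OF matrix_vector_mul_linear gt A D] gD by simp
  moreover have "emeasure lborel A * emeasure lborel D = emeasure lborel D * emeasure lborel (uminus -` A)"
    using emeasure_lborel_linear_vimage_product[of "\<lambda>x. x" "\<lambda>x. x", OF _ _ A D] by (simp add: linear_ident)
  ultimately have "emeasure lborel D * emeasure lborel ((\<lambda>x. g *v x) -` A) = emeasure lborel D * emeasure lborel A"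
    by (simp add: mult.commute)
  then have "emeasure lborel ((\<lambda>x. g *v x) -` A) = emeasure lborel A"
    using fin pos by (simp add: ennreal_mult_cancel_left top_unique)
  then show "emeasure (distr lborel borel (\<lambda>x. g *v x)) A = emeasure lborel A"
    using A meas by (subst emeasure_distr) auto
qed simp

section \<open>Truncation and passage to the limit\<close>

text \<open>Dominated convergence for the positive parts and monotone convergence for the negative parts; the
  limit of the latter may be infinite.\<close>

lemma ereal_integral_decreasing_limit:
  fixes f :: "nat \<Rightarrow> 'a \<Rightarrow> real" and u :: "'a \<Rightarrow> ereal"
  assumes int: "\<And>N. integrable M (f N)" and dec: "\<And>N x. x \<in> space M \<Longrightarrow> f (Suc N) x \<le> f N x"
    and lim: "\<And>x. x \<in> space M \<Longrightarrow> (\<lambda>N. ereal (f N x)) \<longlonglongrightarrow> u x"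
  shows "(\<lambda>N. ereal (\<integral>x. f N x \<partial>M)) \<longlonglongrightarrow> ereal_integral M u"
proof -
  have [measurable]: "f N \<in> borel_measurable M" for N using int by auto
  have lim_pos: "(\<lambda>N. ennreal (f N x)) \<longlonglongrightarrow> e2ennreal (u x)" if "x \<in> space M" for x
    using tendsto_e2ennrealI[OF lim[OF that]] by simp
  have lim_neg: "(\<lambda>N. ennreal (- f N x)) \<longlonglongrightarrow> e2ennreal (- u x)" if "x \<in> space M" for x
    using tendsto_e2ennrealI[OF tendsto_uminus_ereal[OF lim[OF that]]] by simp
  have dec0: "f N x \<le> f 0 x" if "x \<in> space M" for N x
    by (induction N) (auto intro: order_trans[OF dec[OF that]])
  have "(\<lambda>N. \<integral>\<^sup>+x. ennreal (f N x) \<partial>M) \<longlonglongrightarrow> (\<integral>\<^sup>+x. e2ennreal (u x) \<partial>M)"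
  proof (rule nn_integral_dominated_convergence[where w = "\<lambda>x. ennreal (f 0 x)"])
    show "(\<lambda>x. e2ennreal (u x)) \<in> borel_measurable M"
      by (rule borel_measurable_LIMSEQ_order[OF lim_pos]) auto
    show "(\<integral>\<^sup>+x. ennreal (f 0 x) \<partial>M) < \<infinity>" using integrableD(2)[OF int[of 0]] by (simp add: less_top)
  qed (use lim_pos dec0 in \<open>auto intro!: AE_I2 ennreal_leI\<close>)
  then have P: "(\<lambda>N. enn2ereal (\<integral>\<^sup>+x. ennreal (f N x) \<partial>M)) \<longlonglongrightarrow> enn2ereal (\<integral>\<^sup>+x. e2ennreal (u x) \<partial>M)"
    by (rule tendsto_enn2erealI)
  have "(\<lambda>N. \<integral>\<^sup>+x. ennreal (- f N x) \<partial>M) \<longlonglongrightarrow> (SUP N. \<integral>\<^sup>+x. ennreal (- f N x) \<partial>M)"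
    by (rule LIMSEQ_SUP) (auto intro!: incseq_SucI nn_integral_mono ennreal_leI dec)
  also have "(SUP N. \<integral>\<^sup>+x. ennreal (- f N x) \<partial>M) = (\<integral>\<^sup>+x. (SUP N. ennreal (- f N x)) \<partial>M)"
    by (rule nn_integral_monotone_convergence_SUP_AE[symmetric]) (auto intro!: AE_I2 ennreal_leI dec)
  also have "\<dots> = (\<integral>\<^sup>+x. e2ennreal (- u x) \<partial>M)"
    by (rule nn_integral_cong) (auto intro!: SUP_Lim lim_neg incseq_SucI ennreal_leI dec)
  finally have Q: "(\<lambda>N. enn2ereal (\<integral>\<^sup>+x. ennreal (- f N x) \<partial>M)) \<longlonglongrightarrow> enn2ereal (\<integral>\<^sup>+x. e2ennreal (- u x) \<partial>M)"
    by (rule tendsto_enn2erealI)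
  have "(\<integral>\<^sup>+x. e2ennreal (u x) \<partial>M) \<le> (\<integral>\<^sup>+x. ennreal (f 0 x) \<partial>M)"
  proof (rule nn_integral_mono)
    fix x assume x: "x \<in> space M"
    show "e2ennreal (u x) \<le> ennreal (f 0 x)"
      by (rule LIMSEQ_le_const2[OF lim_pos[OF x]]) (use dec0[OF x] in \<open>auto intro: ennreal_leI\<close>)
  qed
  also have "\<dots> < \<infinity>" using integrableD(2)[OF int[of 0]] by (simp add: less_top)
  finally have fin: "enn2ereal (\<integral>\<^sup>+x. e2ennreal (u x) \<partial>M) \<noteq> \<infinity>" by simp
  have "ereal (\<integral>x. f N x \<partial>M) = enn2ereal (\<integral>\<^sup>+x. ennreal (f N x) \<partial>M) - enn2ereal (\<integral>\<^sup>+x. ennreal (- f N x) \<partial>M)" for N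
    using integrableD(2,3)[OF int[of N]] real_lebesgue_integral_def[OF int[of N]]
    by (cases rule: ennreal2_cases[of "(\<integral>\<^sup>+x. ennreal (f N x) \<partial>M)" "(\<integral>\<^sup>+x. ennreal (- f N x) \<partial>M)"])
       (auto simp: enn2ereal_ennreal)
  then show ?thesis
    unfolding ereal_integral_def
    using tendsto_diff_ereal_general[OF P Q] fin by auto
qed

lemma cball_subset_open_enlarge:
  fixes X :: "'a::euclidean_space set"
  assumes X: "open X" "cball 0 r \<subseteq> X" and r: "0 \<le> r"
  obtains R where "r < R" "cball 0 R \<subseteq> X"
proof -
  obtain e where e: "0 < e" "(\<Union>x\<in>cball 0 r. cball x e) \<subseteq> X"
    using compact_subset_open_imp_cball_epsilon_subset[OF compact_cball X(1,2)] by metis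
  show thesis
  proof (rule that[of "r + e"])
    show "cball 0 (r + e) \<subseteq> X"
    proof
      fix x :: 'a assume x: "x \<in> cball 0 (r + e)"
      show "x \<in> X"
      proof (cases "norm x \<le> r")
        case False
        then have n: "0 < norm x" using r by linarith
        define z where "z = (r / norm x) *\<^sub>R x"
        have "x - z = (1 - r / norm x) *\<^sub>R x" by (simp add: z_def algebra_simps)
        then have "norm (x - z) = \<bar>1 - r / norm x\<bar> * norm x" by simp
        also have "\<dots> = norm x - r" using n False by (simp add: abs_if field_simps)
        finally have "x \<in> cball z e" using x by (simp add: dist_norm norm_minus_commute)
        moreover have "z \<in> cball 0 r" using n r by (simp add: z_def)
        ultimately show ?thesis using e(2) by blast
      qed (use X in auto)
    qed
  qed (use e in auto)
qed

text \<open>The maximum of \<open>u\<close> on the ball of radius \<open>R\<close> with a paraboloid that has the value \<open>M\<close> on the sphere of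
  radius \<open>\<rho> < R\<close>. If \<open>M\<close> bounds \<open>u\<close>, the paraboloid takes over before the edge of that ball is reached.\<close>

definition truncation :: "(real^'n \<Rightarrow> ereal) \<Rightarrow> real \<Rightarrow> real \<Rightarrow> real \<Rightarrow> real \<Rightarrow> real^'n \<Rightarrow> real" where
  "truncation u M \<rho> R N x = (if norm x \<le> R then real_of_ereal (max (u x) (ereal (M + N * (x \<bullet> x - \<rho>\<^sup>2))))
     else M + N * (x \<bullet> x - \<rho>\<^sup>2))"

context riesz_cone
begin

text \<open>Where the truncation exceeds the paraboloid it is \<open>u\<close>. Elsewhere a function touching it also touches
  the paraboloid from above, so its Hessian is positive semidefinite and belongs to \<open>F\<close>.\<close>

lemma truncation_global_subsolution:
  assumes u: "subsolution F X u" and X: "cball 0 R \<subseteq> X" and \<rho>: "0 < \<rho>" "\<rho> < R"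
    and M: "\<And>x. norm x \<le> R \<Longrightarrow> u x \<le> ereal M" and N: "0 \<le> N"
  shows "global_subsolution F \<rho> (M - N * \<rho>\<^sup>2) N (truncation u M \<rho> R N)"
    and "\<And>x. norm x \<le> R \<Longrightarrow> ereal (truncation u M \<rho> R N x) = max (u x) (ereal (M + N * (x \<bullet> x - \<rho>\<^sup>2)))"
proof -
  note u' = subsolutionD[OF u]
  define q where "q x = M + N * (x \<bullet> x - \<rho>\<^sup>2)" for x :: "real^'n"
  define w where "w = truncation u M \<rho> R N"
  have w_in: "ereal (w x) = max (u x) (ereal (q x))" if "norm x \<le> R" for x
    using that M[OF that] by (cases "u x") (auto simp: w_def truncation_def q_def max_def)
  then show "\<And>x. norm x \<le> R \<Longrightarrow> ereal (truncation u M \<rho> R N x) = max (u x) (ereal (M + N * (x \<bullet> x - \<rho>\<^sup>2)))"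
    by (simp add: w_def q_def)
  have w_q: "q x \<le> w x" for x
  proof (cases "norm x \<le> R")
    case True
    then have "ereal (q x) \<le> ereal (w x)" using w_in[OF True] by simp
    then show ?thesis by simp
  qed (simp add: w_def truncation_def q_def)
  have w_out: "w x = q x" if "\<rho> \<le> norm x" for x
  proof (cases "norm x \<le> R")
    case True
    have "\<rho>\<^sup>2 \<le> x \<bullet> x" using that \<rho> by (simp add: power2_norm_eq_inner[symmetric] power_mono)
    then have "M \<le> q x" using N by (simp add: q_def)
    then have "u x \<le> ereal (q x)" using M[OF True] by (meson ereal_less_eq(3) order_trans)
    then have "ereal (w x) = ereal (q x)" using w_in[OF True] by (simp add: max_def)
    then show ?thesis by simp
  qed (simp add: w_def truncation_def q_def)
  have q_cont: "isCont q x" for x unfolding q_def by (intro continuous_intros)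
  have in_X: "x \<in> X" if "norm x \<le> R" for x using that X by auto
  have w_usc: "usc_on UNIV (\<lambda>x. ereal (w x))"
    unfolding usc_on_def
  proof (intro ballI allI impI)
    fix x c assume c: "ereal (w x) < c"
    have qc: "\<forall>\<^sub>F y in at x. ereal (q y) < c" if "ereal (q x) < c"
    proof -
      have "((\<lambda>y. ereal (q y)) \<longlongrightarrow> ereal (q x)) (at x)" using q_cont[of x] by (simp add: isCont_def)
      then show ?thesis using that by (rule order_tendstoD(2))
    qed
    show "\<forall>\<^sub>F y in at x within UNIV. ereal (w y) < c"
    proof (cases "norm x < R")
      case True
      have "u x < c" "ereal (q x) < c" using c w_in[of x] True by auto
      then have "\<forall>\<^sub>F y in at x within X. u y < c" using u'(3) in_X[of x] True unfolding usc_on_def by auto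
      then have "\<forall>\<^sub>F y in at x. u y < c" using at_within_open[OF in_X[of x] u'(1)] True by simp
      moreover have "\<forall>\<^sub>F y in at x. norm y < R"
        using True by (intro order_tendstoD(2)[OF tendsto_norm[OF tendsto_ident_at]]) auto
      ultimately show ?thesis using qc[OF \<open>ereal (q x) < c\<close>]
        by eventually_elim (auto simp: w_in)
    next
      case False
      then have "\<rho> < norm x" using \<rho> by simp
      then have "\<forall>\<^sub>F y in at x. \<rho> < norm y"
        by (intro order_tendstoD(1)[OF tendsto_norm[OF tendsto_ident_at]]) auto
      moreover have "ereal (q x) < c" using c w_out[of x] \<open>\<rho> < norm x\<close> by simp
      from qc[OF this] have "\<forall>\<^sub>F y in at x. ereal (q y) < c" .
      ultimately show ?thesis by eventually_elim (auto simp: w_out)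
    qed
  qed
  have touching: "H x0 \<in> F" if x0U: "x0 \<in> U" and C2: "C2_on U \<phi> D H" and sym: "H x0 \<in> Sym2"
    and ev: "\<forall>\<^sub>F x in nhds x0. w x \<le> \<phi> x" and eq: "w x0 = \<phi> x0" for x0 U \<phi> D H
  proof (cases "w x0 = q x0")
    case True
    have "0 \<le> y \<bullet> (H x0 *v y)" for y
    proof -
      have "- (2 * \<delta>) * (y \<bullet> y) \<le> y \<bullet> (H x0 *v y)" if \<delta>: "0 < \<delta>" for \<delta>
      proof -
        obtain d1 where d1: "0 < d1" "\<And>x. norm (x - x0) < d1 \<Longrightarrow>
          \<phi> x \<le> \<phi> x0 + D x0 \<bullet> (x - x0) + (1/2) * ((x - x0) \<bullet> (H x0 *v (x - x0))) + \<delta> * ((x - x0) \<bullet> (x - x0))"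
          by (rule taylor_upper[OF C2 x0U sym \<delta>]) blast
        obtain d2 where d2: "0 < d2" "\<And>x. norm (x - x0) < d2 \<Longrightarrow> w x \<le> \<phi> x"
          using ev unfolding eventually_nhds_metric by (auto simp: dist_norm)
        \<comment> \<open>Adding the Taylor bounds at \<open>x0 + s y\<close> and \<open>x0 - s y\<close> cancels the first-order terms.\<close>
        define s where "s = min d1 d2 / (norm y + 1)"
        have ny: "0 < norm y + 1" using norm_ge_zero[of y] by linarith
        have s: "0 < s" using d1 d2 ny by (simp add: s_def)
        have "s * norm y < s * (norm y + 1)" using s by simp
        also have "\<dots> = min d1 d2" using ny by (simp add: s_def)
        finally have sy: "norm (s *\<^sub>R y) < min d1 d2" using s by simp
        define z where "z = s *\<^sub>R y"
        have near: "q (x0 + z') \<le> \<phi> x0 + D x0 \<bullet> z' + (1/2) * (z' \<bullet> (H x0 *v z')) + \<delta> * (z' \<bullet> z')" if "norm z' = norm z" for z'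
        proof -
          have "norm z' < d1" "norm z' < d2" using that sy by (auto simp: z_def)
          then show ?thesis using d1(2)[of "x0 + z'"] d2(2)[of "x0 + z'"] w_q[of "x0 + z'"] by simp
        qed
        have "q (x0 + z) + q (x0 - z) = 2 * q x0 + 2 * N * (z \<bullet> z)"
          by (simp add: q_def inner_add_left inner_add_right inner_diff_left inner_diff_right inner_commute algebra_simps)
        moreover have "(- z) \<bullet> (H x0 *v (- z)) = z \<bullet> (H x0 *v z)"
          using matrix_vector_mult_scaleR[of "H x0" "- 1" z] by simp
        moreover have "0 \<le> N * (z \<bullet> z)" using N by simp
        ultimately have "- (2 * \<delta>) * (z \<bullet> z) \<le> z \<bullet> (H x0 *v z)"
          using near[of z] near[of "- z"] True eq by simp
        then have "s\<^sup>2 * (- (2 * \<delta>) * (y \<bullet> y)) \<le> s\<^sup>2 * (y \<bullet> (H x0 *v y))"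
          by (simp add: z_def matrix_vector_mult_scaleR power2_eq_square mult_ac)
        then show ?thesis by (rule mult_left_le_imp_le) (use s in simp)
      qed
      then have "\<forall>\<^sub>F \<delta> in at_right 0. - (2 * \<delta>) * (y \<bullet> y) \<le> y \<bullet> (H x0 *v y)"
        using eventually_at_right_less[of "0::real"] by (auto elim: eventually_mono)
      moreover have "((\<lambda>\<delta>. - (2 * \<delta>) * (y \<bullet> y)) \<longlongrightarrow> - (2 * 0) * (y \<bullet> y)) (at_right 0)"
        by (intro tendsto_intros)
      ultimately have "- (2 * 0) * (y \<bullet> y) \<le> y \<bullet> (H x0 *v y)" by (intro tendsto_upperbound) auto
      then show ?thesis by simp
    qed
    then show ?thesis using sym by (intro psd_in_F) (simp add: psd_cone_def)
  next
    case False
    then have x0: "norm x0 < \<rho>" using w_out[of x0] by (meson not_le)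
    then have wu: "ereal (w x0) = u x0" using w_in[of x0] False \<rho> by (auto simp: max_def split: if_splits)
    have "\<forall>\<^sub>F x in nhds x0. norm x < \<rho>"
      using eventually_nhds_in_open[of "ball 0 \<rho>" x0] x0 by simp
    with ev have "\<forall>\<^sub>F x in nhds x0. u x \<le> ereal (\<phi> x)"
    proof eventually_elim
      case (elim x)
      then have "u x \<le> ereal (w x)" using w_in[of x] \<rho> by simp
      with elim show ?case by (meson ereal_less_eq(3) order_trans)
    qed
    then show ?thesis
      by (intro u'(4)[OF in_X x0U C2 sym]) (use x0 \<rho> wu eq in auto)
  qed
  have "subsolution F UNIV (\<lambda>x. ereal (w x))"
    unfolding subsolution_def using w_usc touching by auto
  then show "global_subsolution F \<rho> (M - N * \<rho>\<^sup>2) N (truncation u M \<rho> R N)"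
    unfolding global_subsolution_def w_def[symmetric]
    using N w_q w_out by (auto simp: q_def algebra_simps)
qed

lemma decreasing_truncations:
  assumes u: "subsolution F X u" and r: "0 < r" "cball 0 r \<subseteq> X"
  obtains w a \<rho> where "\<And>N. global_subsolution F \<rho> (a N) (real N) (w N)"
    "\<And>N x. norm x \<le> r \<Longrightarrow> w (Suc N) x \<le> w N x" "\<And>N x. norm x \<le> r \<Longrightarrow> u x \<le> ereal (w N x)"
    "\<And>x. norm x \<le> r \<Longrightarrow> (\<lambda>N. ereal (w N x)) \<longlonglongrightarrow> u x"
proof -
  obtain R where R: "r < R" "cball 0 R \<subseteq> X"
    using cball_subset_open_enlarge[OF subsolutionD(1)[OF u] r(2)] r(1) by auto
  obtain M where M: "\<And>x. x \<in> cball 0 R \<Longrightarrow> u x \<le> ereal M"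
    using subsolution_bounded_above[OF u compact_cball R(2)] by metis
  define \<rho> where "\<rho> = (r + R) / 2"
  have \<rho>: "0 < \<rho>" "\<rho> < R" "r < \<rho>" using r R by (auto simp: \<rho>_def)
  have M': "u x \<le> ereal M" if "norm x \<le> R" for x using M that by simp
  note tr = truncation_global_subsolution[OF u R(2) \<rho>(1,2) M' of_nat_0_le_iff]
  have neg: "x \<bullet> x - \<rho>\<^sup>2 < 0" if "norm x \<le> r" for x :: "real^'n"
  proof -
    have "norm x < \<rho>" using that \<rho> by simp
    then have "(norm x)\<^sup>2 < \<rho>\<^sup>2" by (intro power_strict_mono) auto
    then show ?thesis by (simp add: power2_norm_eq_inner)
  qed
  have eq: "ereal (truncation u M \<rho> R (real N) x) = max (u x) (ereal (M + real N * (x \<bullet> x - \<rho>\<^sup>2)))" if "norm x \<le> r" for N x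
    by (rule tr(2)) (use that R in auto)
  show thesis
  proof (rule that[of \<rho> "\<lambda>N. M - real N * \<rho>\<^sup>2" "\<lambda>N. truncation u M \<rho> R (real N)"])
    show "global_subsolution F \<rho> (M - real N * \<rho>\<^sup>2) (real N) (truncation u M \<rho> R (real N))" for N by (rule tr(1))
    fix x :: "real^'n" assume x: "norm x \<le> r"
    show "u x \<le> ereal (truncation u M \<rho> R (real N) x)" for N by (simp add: eq[OF x])
    show "truncation u M \<rho> R (real (Suc N)) x \<le> truncation u M \<rho> R (real N) x" for N
    proof -
      have "real (Suc N) * (x \<bullet> x - \<rho>\<^sup>2) \<le> real N * (x \<bullet> x - \<rho>\<^sup>2)"
        using neg[OF x] by (intro mult_right_mono_neg) auto
      then have "ereal (truncation u M \<rho> R (real (Suc N)) x) \<le> ereal (truncation u M \<rho> R (real N) x)"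
        unfolding eq[OF x] by (intro max.mono) auto
      then show ?thesis by simp
    qed
    have "0 < - (x \<bullet> x - \<rho>\<^sup>2)" using neg[OF x] by simp
    from filterlim_tendsto_add_at_top[OF tendsto_const[of "- M"] filterlim_tendsto_pos_mult_at_top[OF tendsto_const this filterlim_real_sequentially]]
    have "filterlim (\<lambda>N. - (M + real N * (x \<bullet> x - \<rho>\<^sup>2))) at_top sequentially" by (simp add: algebra_simps)
    then have "filterlim (\<lambda>N. M + real N * (x \<bullet> x - \<rho>\<^sup>2)) at_bot sequentially"
      unfolding filterlim_uminus_at_bot .
    then have "(\<lambda>N. ereal (M + real N * (x \<bullet> x - \<rho>\<^sup>2))) \<longlonglongrightarrow> -\<infinity>"
      unfolding tendsto_MInfty filterlim_at_bot_dense by simp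
    then have "(\<lambda>N. max (u x) (ereal (M + real N * (x \<bullet> x - \<rho>\<^sup>2)))) \<longlonglongrightarrow> max (u x) (-\<infinity>)"
      by (intro tendsto_max tendsto_const)
    then show "(\<lambda>N. ereal (truncation u M \<rho> R (real N) x)) \<longlonglongrightarrow> u x"
      by (simp add: eq[OF x] max_def)
  qed
qed

end

context st_cone
begin

lemma ereal_mean_limit:
  assumes w: "\<And>N. global_subsolution F \<rho> (a N) (b N) (w N)" "\<And>N x. norm x \<le> r \<Longrightarrow> w (Suc N) x \<le> w N x"
    "\<And>x. norm x \<le> r \<Longrightarrow> (\<lambda>N. ereal (w N x)) \<longlonglongrightarrow> u x"
    and M: "rotation_measure M" and t: "0 \<le> t" "t \<le> r"
  shows "(\<lambda>N. ereal (rotation_measure.mean M (w N) t)) \<longlonglongrightarrow> ereal_integral M (\<lambda>y. u (t *\<^sub>R y))"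
    and "ereal_integral M (\<lambda>y. u (t *\<^sub>R y)) \<le> ereal (rotation_measure.mean M (w N) t)"
proof -
  interpret rotation_measure M by (rule M)
  have small: "norm (t *\<^sub>R y) \<le> r" if "y \<in> space M" for y using scaled_in_cball[OF that t(1)] t by auto
  have int: "integrable M (\<lambda>y. w N (t *\<^sub>R y))" for N
    by (rule integrable_scaled[OF locally_bounded_borel_global_subsolution[OF w(1)] t(1)])
  show lim: "(\<lambda>N. ereal (mean (w N) t)) \<longlonglongrightarrow> ereal_integral M (\<lambda>y. u (t *\<^sub>R y))"
    unfolding mean_def by (rule ereal_integral_decreasing_limit[OF int]) (use w small in auto)
  have "mean (w (Suc N)) t \<le> mean (w N) t" for N
    unfolding mean_def by (rule integral_mono[OF int int]) (use w small in auto)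
  then have "decseq (\<lambda>N. ereal (mean (w N) t))" by (intro decseq_SucI) simp
  then show "ereal_integral M (\<lambda>y. u (t *\<^sub>R y)) \<le> ereal (mean (w N) t)" using lim by (rule decseq_ge)
qed

lemma ereal_mean_less_infinity:
  assumes u: "subsolution F X u" and r: "0 < r" "cball 0 r \<subseteq> X" and M: "rotation_measure M"
  shows "ereal_integral M (\<lambda>y. u (r *\<^sub>R y)) < \<infinity>"
proof -
  obtain w a \<rho> where w: "\<And>N. global_subsolution F \<rho> (a N) (real N) (w N)"
    "\<And>N x. norm x \<le> r \<Longrightarrow> w (Suc N) x \<le> w N x" "\<And>N x. norm x \<le> r \<Longrightarrow> u x \<le> ereal (w N x)"
    "\<And>x. norm x \<le> r \<Longrightarrow> (\<lambda>N. ereal (w N x)) \<longlonglongrightarrow> u x"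
    by (rule decreasing_truncations[OF u r]) blast
  have "ereal_integral M (\<lambda>y. u (r *\<^sub>R y)) \<le> ereal (rotation_measure.mean M (w 0) r)"
    by (rule ereal_mean_limit(2)[OF w(1,2,4) M]) (use r in auto)
  also have "\<dots> < \<infinity>" by simp
  finally show ?thesis .
qed

lemma value_at_0_le_ereal_mean:
  assumes u: "subsolution F X u" and r: "0 < r" "cball 0 r \<subseteq> X" and M: "rotation_measure M" and u0: "u 0 = ereal c"
  shows "ereal (c * measure M (space M)) \<le> ereal_integral M (\<lambda>y. u (r *\<^sub>R y))"
proof -
  obtain w a \<rho> where w: "\<And>N. global_subsolution F \<rho> (a N) (real N) (w N)"
    "\<And>N x. norm x \<le> r \<Longrightarrow> w (Suc N) x \<le> w N x" "\<And>N x. norm x \<le> r \<Longrightarrow> u x \<le> ereal (w N x)"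
    "\<And>x. norm x \<le> r \<Longrightarrow> (\<lambda>N. ereal (w N x)) \<longlonglongrightarrow> u x"
    by (rule decreasing_truncations[OF u r]) blast
  have lim: "(\<lambda>N. ereal (rotation_measure.mean M (w N) r)) \<longlonglongrightarrow> ereal_integral M (\<lambda>y. u (r *\<^sub>R y))"
    by (rule ereal_mean_limit(1)[OF w(1,2,4) M]) (use r in auto)
  have "c * measure M (space M) \<le> rotation_measure.mean M (w N) r" for N
  proof -
    have "c \<le> w N 0" using w(3)[of 0 N] u0 r by simp
    then have "c * measure M (space M) \<le> w N 0 * measure M (space M)" by (rule mult_right_mono) simp
    also have "\<dots> \<le> rotation_measure.mean M (w N) r" by (rule value_at_0_le_mean[OF w(1) M r(1)])
    finally show ?thesis .
  qed
  then show ?thesis by (intro LIMSEQ_le_const[OF lim]) auto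
qed

lemma ereal_mean_mono_norm:
  assumes u: "subsolution F X u" and r: "0 < r" "cball 0 r \<subseteq> X" and M1: "rotation_measure M1" and M2: "rotation_measure M2"
    and norms: "\<And>x y. x \<in> space M1 \<Longrightarrow> y \<in> space M2 \<Longrightarrow> norm x \<le> norm y"
    and pos: "0 < measure M1 (space M1)" and c: "ereal c \<le> ereal_integral M1 (\<lambda>y. u (r *\<^sub>R y))"
  shows "ereal (c * measure M2 (space M2) / measure M1 (space M1)) \<le> ereal_integral M2 (\<lambda>y. u (r *\<^sub>R y))"
proof -
  obtain w a \<rho> where w: "\<And>N. global_subsolution F \<rho> (a N) (real N) (w N)"
    "\<And>N x. norm x \<le> r \<Longrightarrow> w (Suc N) x \<le> w N x" "\<And>N x. norm x \<le> r \<Longrightarrow> u x \<le> ereal (w N x)"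
    "\<And>x. norm x \<le> r \<Longrightarrow> (\<lambda>N. ereal (w N x)) \<longlonglongrightarrow> u x"
    by (rule decreasing_truncations[OF u r]) blast
  have lim: "(\<lambda>N. ereal (rotation_measure.mean M2 (w N) r)) \<longlonglongrightarrow> ereal_integral M2 (\<lambda>y. u (r *\<^sub>R y))"
    by (rule ereal_mean_limit(1)[OF w(1,2,4) M2]) (use r in auto)
  have "c * measure M2 (space M2) / measure M1 (space M1) \<le> rotation_measure.mean M2 (w N) r" for N
  proof -
    have "ereal c \<le> ereal (rotation_measure.mean M1 (w N) r)"
      by (rule order_trans[OF c]) (rule ereal_mean_limit(2)[OF w(1,2,4) M1], use r in auto)
    then have "c * measure M2 (space M2) \<le> rotation_measure.mean M1 (w N) r * measure M2 (space M2)"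
      by (intro mult_right_mono) auto
    also have "\<dots> \<le> rotation_measure.mean M2 (w N) r * measure M1 (space M1)"
      by (rule mean_mono_norm[OF w(1) M1 M2 r(1) norms])
    finally show ?thesis using pos by (simp add: pos_divide_le_eq)
  qed
  then show ?thesis by (intro LIMSEQ_le_const[OF lim]) auto
qed

lemma ereal_mean_convex:
  assumes u: "subsolution F X u" and st: "0 < s" "s < t" "t < r" and X: "cball 0 r \<subseteq> X" and M: "rotation_measure M"
    and J: "\<And>\<tau>. \<tau> \<in> {s, t, r} \<Longrightarrow> ereal_integral M (\<lambda>y. u (\<tau> *\<^sub>R y)) = ereal (J \<tau>)"
  shows "J t \<le> J s + (J r - J s) * ((riesz_kernel p t - riesz_kernel p s) / (riesz_kernel p r - riesz_kernel p s))"
proof -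
  have r: "0 < r" using st by simp
  obtain w a \<rho> where w: "\<And>N. global_subsolution F \<rho> (a N) (real N) (w N)"
    "\<And>N x. norm x \<le> r \<Longrightarrow> w (Suc N) x \<le> w N x" "\<And>N x. norm x \<le> r \<Longrightarrow> u x \<le> ereal (w N x)"
    "\<And>x. norm x \<le> r \<Longrightarrow> (\<lambda>N. ereal (w N x)) \<longlonglongrightarrow> u x"
    by (rule decreasing_truncations[OF u r X]) blast
  have lim: "(\<lambda>N. rotation_measure.mean M (w N) \<tau>) \<longlonglongrightarrow> J \<tau>" if "\<tau> \<in> {s, t, r}" for \<tau>
  proof -
    have "(\<lambda>N. ereal (rotation_measure.mean M (w N) \<tau>)) \<longlonglongrightarrow> ereal_integral M (\<lambda>y. u (\<tau> *\<^sub>R y))"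
      by (rule ereal_mean_limit(1)[OF w(1,2,4) M]) (use st that in auto)
    then show ?thesis by (simp add: J[OF that])
  qed
  show ?thesis
  proof (rule LIMSEQ_le[OF lim[of t]])
    show "(\<lambda>N. rotation_measure.mean M (w N) s + (rotation_measure.mean M (w N) r - rotation_measure.mean M (w N) s) *
        ((riesz_kernel p t - riesz_kernel p s) / (riesz_kernel p r - riesz_kernel p s)))
      \<longlonglongrightarrow> J s + (J r - J s) * ((riesz_kernel p t - riesz_kernel p s) / (riesz_kernel p r - riesz_kernel p s))"
      by (intro tendsto_intros lim) auto
  qed (use mean_convex[OF w(1) M st] in auto)
qed

lemma increasing_diff_quotients_mean:
  assumes u: "subsolution F X u" and M: "rotation_measure M" and pos: "0 < measure M (space M)"
    and fin: "\<And>r. 0 < r \<Longrightarrow> cball 0 r \<subseteq> X \<Longrightarrow> ereal_integral M (\<lambda>y. u (r *\<^sub>R y)) \<noteq> -\<infinity>"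
  shows "increasing_diff_quotients {r. 0 < r \<and> cball 0 r \<subseteq> X} (\<lambda>r. mean_value M (\<lambda>y. u (r *\<^sub>R y))) (riesz_kernel p)"
proof -
  define m where "m = measure M (space M)"
  define J where "J r = real_of_ereal (ereal_integral M (\<lambda>y. u (r *\<^sub>R y)))" for r
  have J: "ereal_integral M (\<lambda>y. u (r *\<^sub>R y)) = ereal (J r)" if "0 < r" "cball 0 r \<subseteq> X" for r
    using fin[OF that] ereal_mean_less_infinity[OF u that M] unfolding J_def
    by (cases "ereal_integral M (\<lambda>y. u (r *\<^sub>R y))") auto
  show ?thesis
  proof (rule increasing_diff_quotients_if_convex[where f = "\<lambda>r. J r / m"])
    show "mean_value M (\<lambda>y. u (r *\<^sub>R y)) = ereal (J r / m)" if "r \<in> {r. 0 < r \<and> cball 0 r \<subseteq> X}" for r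
      using that J pos by (simp add: mean_value_def m_def)
    fix s t r assume R: "s \<in> {r. 0 < r \<and> cball 0 r \<subseteq> X}" "t \<in> {r. 0 < r \<and> cball 0 r \<subseteq> X}" "r \<in> {r. 0 < r \<and> cball 0 r \<subseteq> X}"
      and st: "s < t" "t < r"
    have "J t \<le> J s + (J r - J s) * ((riesz_kernel p t - riesz_kernel p s) / (riesz_kernel p r - riesz_kernel p s))"
      by (rule ereal_mean_convex[OF u _ st _ M]) (use R J in auto)
    then have "J t / m \<le> (J s + (J r - J s) * ((riesz_kernel p t - riesz_kernel p s) / (riesz_kernel p r - riesz_kernel p s))) / m"
      using pos by (intro divide_right_mono) (auto simp: m_def)
    then show "J t / m \<le> J s / m + (J r / m - J s / m) * ((riesz_kernel p t - riesz_kernel p s) / (riesz_kernel p r - riesz_kernel p s))"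
      by (simp add: add_divide_distrib diff_divide_distrib[symmetric] mult.commute)
  qed (auto intro: riesz_kernel_strict_mono)
qed

end

section \<open>Lebesgue measure on the ball and surface measure on the sphere\<close>

abbreviation ball_measure :: "(real^'n) measure" where
  "ball_measure \<equiv> restrict_space lborel (cball 0 1)"

lemma borel_measurable_matrix_vector_mult: "(\<lambda>x. g *v x) \<in> borel_measurable borel" for g :: "real^'n^'n"
  by (intro borel_measurable_continuous_onI bounded_linear.continuous_on[OF matrix_vector_mul_bounded_linear] continuous_intros)

lemma measurable_orthogonal_restrict:
  fixes S :: "(real^'n) set"
  assumes "\<And>x. x \<in> S \<Longrightarrow> g *v x \<in> S"
  shows "(\<lambda>x. g *v x) \<in> restrict_space borel S \<rightarrow>\<^sub>M restrict_space borel S"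
  by (intro measurable_restrict_space3 borel_measurable_matrix_vector_mult) (use assms in auto)

lemma rotation_measure_ball: "rotation_measure (ball_measure :: (real^'n) measure)"
proof (intro rotation_measure.intro rotation_measure_axioms.intro finite_measureI)
  have sets_eq: "sets (ball_measure :: (real^'n) measure) = sets (restrict_space borel (cball 0 1))"
    by (rule sets_restrict_space_cong) simp
  show "emeasure (ball_measure :: (real^'n) measure) (space ball_measure) \<noteq> \<infinity>"
    using emeasure_lborel_cball_finite[of "0::real^'n" 1] by (simp add: space_restrict_space emeasure_restrict_space less_top)
  show "space (ball_measure :: (real^'n) measure) \<subseteq> cball 0 1" by (simp add: space_restrict_space)
  show "(\<lambda>x. x) \<in> (ball_measure :: (real^'n) measure) \<rightarrow>\<^sub>M borel" by (intro measurable_restrict_space1) simp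
  fix g :: "real^'n^'n" assume g: "orthogonal_matrix g"
  have meas: "(\<lambda>x. g *v x) \<in> (ball_measure :: (real^'n) measure) \<rightarrow>\<^sub>M ball_measure"
    by (subst measurable_cong_sets[OF sets_eq sets_eq])
       (rule measurable_orthogonal_restrict, simp add: orthogonal_matrix_norm[OF g])
  have "distr ball_measure ball_measure (\<lambda>x. g *v x) = (ball_measure :: (real^'n) measure)"
  proof (rule measure_eqI)
    fix A assume "A \<in> sets (distr ball_measure ball_measure (\<lambda>x. g *v x))"
    then have A: "A \<in> sets (ball_measure :: (real^'n) measure)" by simp
    then have A': "A \<in> sets borel" "A \<subseteq> cball 0 1"
      by (auto simp: sets_restrict_space)
    have vim: "(\<lambda>x. g *v x) -` A \<inter> space ball_measure = (\<lambda>x. g *v x) -` A"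
      using A'(2) by (auto simp: space_restrict_space orthogonal_matrix_norm[OF g] subset_eq)
    have "emeasure (distr ball_measure ball_measure (\<lambda>x. g *v x)) A = emeasure ball_measure ((\<lambda>x. g *v x) -` A)"
      by (subst emeasure_distr[OF meas A]) (simp only: vim)
    also have "\<dots> = emeasure lborel ((\<lambda>x. g *v x) -` A)"
      using A'(2) by (intro emeasure_restrict_space) (auto simp: orthogonal_matrix_norm[OF g] subset_eq)
    also have "\<dots> = emeasure (distr lborel borel (\<lambda>x. g *v x)) A"
      using A' borel_measurable_matrix_vector_mult[of g] by (simp add: emeasure_distr)
    also have "\<dots> = emeasure lborel A" by (simp add: distr_lborel_orthogonal[OF g])
    also have "\<dots> = emeasure ball_measure A" using A'(2) by (intro emeasure_restrict_space[symmetric]) auto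
    finally show "emeasure (distr ball_measure ball_measure (\<lambda>x. g *v x)) A = emeasure ball_measure A" .
  qed simp
  with meas show "(\<lambda>x. g *v x) \<in> (ball_measure :: (real^'n) measure) \<rightarrow>\<^sub>M ball_measure \<and>
      distr ball_measure ball_measure (\<lambda>x. g *v x) = (ball_measure :: (real^'n) measure)" by blast
qed

lemma measure_ball_pos: "0 < measure (ball_measure :: (real^'n) measure) (space ball_measure)"
  using content_cball_pos[of 1 "0::real^'n"]
  by (simp add: measure_restrict_space space_restrict_space)

lemma sets_sphere_measure: "sets (sphere_measure :: (real^'n) measure) = sets (restrict_space borel (sphere 0 1))"
  and space_sphere_measure: "space (sphere_measure :: (real^'n) measure) = sphere 0 1"
  by (simp_all add: sphere_measure_def space_restrict_space space_scale_measure)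

lemma emeasure_sphere_measure_space:
  "emeasure (sphere_measure :: (real^'n) measure) (space sphere_measure) = of_nat CARD('n) * emeasure lborel (cball (0::real^'n) 1 - {0})"
proof -
  have "{x \<in> cball 0 1 - {0}. sgn x \<in> sphere 0 1} = (cball 0 1 - {0} :: (real^'n) set)" by (auto simp: norm_sgn)
  moreover have "sphere 0 1 \<in> sets (restrict_space borel (sphere (0::real^'n) 1))"
    by (auto simp: sets_restrict_space)
  ultimately show ?thesis
    unfolding space_sphere_measure by (simp add: emeasure_sphere_measure)
qed

lemma emeasure_punctured_ball: "emeasure lborel (cball (0::real^'n) 1 - {0}) = ennreal (measure lborel (cball (0::real^'n) 1))"
proof -
  have "emeasure lborel (cball (0::real^'n) 1 - {0}) = emeasure lborel (cball (0::real^'n) 1)"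
    by (rule emeasure_Diff_null_set) auto
  also have "\<dots> = ennreal (measure lborel (cball (0::real^'n) 1))"
    using emeasure_lborel_cball_finite[of "0::real^'n" 1] by (intro emeasure_eq_ennreal_measure) auto
  finally show ?thesis .
qed

lemma rotation_measure_sphere: "rotation_measure (sphere_measure :: (real^'n) measure)"
proof (intro rotation_measure.intro rotation_measure_axioms.intro finite_measureI)
  show "emeasure (sphere_measure :: (real^'n) measure) (space sphere_measure) \<noteq> \<infinity>"
    unfolding emeasure_sphere_measure_space emeasure_punctured_ball
    by (simp add: ennreal_mult_eq_top_iff ennreal_of_nat_neq_top)
  show "space (sphere_measure :: (real^'n) measure) \<subseteq> cball 0 1" by (auto simp: space_sphere_measure)
  show "(\<lambda>x. x) \<in> (sphere_measure :: (real^'n) measure) \<rightarrow>\<^sub>M borel"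
    by (subst measurable_cong_sets[OF sets_sphere_measure refl]) (intro measurable_restrict_space1, simp)
  fix g :: "real^'n^'n" assume g: "orthogonal_matrix g"
  note ng = orthogonal_matrix_norm[OF g]
  have meas: "(\<lambda>x. g *v x) \<in> (sphere_measure :: (real^'n) measure) \<rightarrow>\<^sub>M sphere_measure"
    by (subst measurable_cong_sets[OF sets_sphere_measure sets_sphere_measure])
       (rule measurable_orthogonal_restrict, simp add: ng)
  have "distr sphere_measure sphere_measure (\<lambda>x. g *v x) = (sphere_measure :: (real^'n) measure)"
  proof (rule measure_eqI)
    fix A assume "A \<in> sets (distr sphere_measure sphere_measure (\<lambda>x. g *v x))"
    then have A: "A \<in> sets (restrict_space borel (sphere (0::real^'n) 1))" by (simp add: sets_sphere_measure)
    define E where "E = {x \<in> cball 0 1 - {0}. sgn x \<in> A}"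
    have E: "E \<in> sets borel"
    proof -
      have "cball 0 1 - {0::real^'n} \<in> sets borel" by auto
      moreover have "A \<in> sets borel" using A by (auto simp: sets_restrict_space)
      ultimately have "(cball 0 1 - {0}) \<inter> sgn -` A \<inter> space borel \<in> sets (borel :: (real^'n) measure)"
        using measurable_sets[OF borel_measurable_sgn, of A] by (simp add: Int_assoc sets.Int)
      then show ?thesis by (simp add: E_def Int_def)
    qed
    have A': "(\<lambda>x. g *v x) -` A \<inter> space sphere_measure \<in> sets (restrict_space borel (sphere (0::real^'n) 1))"
      using measurable_sets[OF meas, of A] A by (simp add: sets_sphere_measure)
    have sgn_g: "sgn (g *v x) = g *v sgn x" for x by (simp add: sgn_div_norm ng matrix_vector_mult_scaleR)
    have g0: "g *v x = 0 \<longleftrightarrow> x = 0" for x using ng[of x] by (metis norm_eq_zero)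
    have "emeasure (distr sphere_measure sphere_measure (\<lambda>x. g *v x)) A = emeasure sphere_measure ((\<lambda>x. g *v x) -` A \<inter> space sphere_measure)"
      using meas A by (simp add: emeasure_distr sets_sphere_measure)
    also have "\<dots> = of_nat CARD('n) * emeasure lborel {x \<in> cball 0 1 - {0}. sgn x \<in> (\<lambda>x. g *v x) -` A \<inter> space sphere_measure}"
      by (rule emeasure_sphere_measure[OF A'])
    also have "{x \<in> cball 0 1 - {0}. sgn x \<in> (\<lambda>x. g *v x) -` A \<inter> space sphere_measure} = (\<lambda>x. g *v x) -` E"
      by (auto simp: E_def ng sgn_g g0 space_sphere_measure norm_sgn)
    also have "emeasure lborel ((\<lambda>x. g *v x) -` E) = emeasure (distr lborel borel (\<lambda>x. g *v x)) E"
      using E borel_measurable_matrix_vector_mult[of g] by (simp add: emeasure_distr)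
    also have "\<dots> = emeasure lborel E" by (simp add: distr_lborel_orthogonal[OF g])
    also have "of_nat CARD('n) * \<dots> = emeasure sphere_measure A" unfolding E_def by (rule emeasure_sphere_measure[OF A, symmetric])
    finally show "emeasure (distr sphere_measure sphere_measure (\<lambda>x. g *v x)) A = emeasure sphere_measure A" .
  qed simp
  with meas show "(\<lambda>x. g *v x) \<in> (sphere_measure :: (real^'n) measure) \<rightarrow>\<^sub>M sphere_measure \<and>
      distr sphere_measure sphere_measure (\<lambda>x. g *v x) = (sphere_measure :: (real^'n) measure)" by blast
qed

lemma measure_sphere_pos: "0 < measure (sphere_measure :: (real^'n) measure) (space sphere_measure)"
proof -
  have "measure (sphere_measure :: (real^'n) measure) (space sphere_measure) = real CARD('n) * measure lborel (cball (0::real^'n) 1)"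
    unfolding measure_def[of sphere_measure] emeasure_sphere_measure_space emeasure_punctured_ball
    by (simp add: enn2real_mult)
  then show ?thesis using content_cball_pos[of 1 "0::real^'n"] by simp
qed

section \<open>Finiteness of the means\<close>

text \<open>The ball of radius \<open>r\<close> about the origin lies in the ball of radius \<open>r + |z|\<close> about \<open>z\<close>. Both integrals
  are taken over the unit ball, so the inclusion becomes an affine change of variables.\<close>

lemma nn_integral_ball_recentre:
  fixes h :: "real^'n \<Rightarrow> ennreal" and z :: "real^'n"
  assumes [measurable]: "h \<in> borel_measurable borel" and r: "0 < r" and \<rho>: "\<rho> = r + norm z"
    and fin: "(\<integral>\<^sup>+y. h (\<rho> *\<^sub>R y + z) * indicator (cball 0 1) y \<partial>lborel) < \<infinity>"
  shows "(\<integral>\<^sup>+x. h (r *\<^sub>R x) * indicator (cball 0 1) x \<partial>lborel) < \<infinity>"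
proof -
  define c where "c = \<rho> / r"
  have \<rho>_pos: "0 < \<rho>" using r norm_ge_zero[of z] by (simp add: \<rho> add_pos_nonneg)
  have c: "c \<noteq> 0" using \<rho>_pos r by (simp add: c_def)
  have sc: "r *\<^sub>R ((1 / r) *\<^sub>R z + c *\<^sub>R y) = \<rho> *\<^sub>R y + z" for y
    using r by (simp add: c_def scaleR_add_right add.commute)
  have "(\<integral>\<^sup>+x. h (r *\<^sub>R x) * indicator (cball 0 1) x \<partial>lborel)
    = (\<integral>\<^sup>+x. h (r *\<^sub>R x) * indicator (cball 0 1) x \<partial>density (distr lborel borel (\<lambda>y. (1 / r) *\<^sub>R z + c *\<^sub>R y)) (\<lambda>_. \<bar>c\<bar>^DIM(real^'n)))"
    using lborel_affine[OF c, of "(1 / r) *\<^sub>R z"] by simp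
  also have "\<dots> = (\<integral>\<^sup>+y. \<bar>c\<bar>^DIM(real^'n) * (h (\<rho> *\<^sub>R y + z) * indicator (cball 0 1) ((1 / r) *\<^sub>R z + c *\<^sub>R y)) \<partial>lborel)"
  proof -
    define H where "H x = h (r *\<^sub>R x) * indicator (cball 0 1) x" for x
    have [measurable]: "H \<in> borel_measurable borel"
      unfolding H_def by (intro borel_measurable_times_ennreal borel_measurable_indicator) auto
    have "(\<integral>\<^sup>+x. H x \<partial>density (distr lborel borel (\<lambda>y. (1 / r) *\<^sub>R z + c *\<^sub>R y)) (\<lambda>_. \<bar>c\<bar>^DIM(real^'n)))
      = (\<integral>\<^sup>+x. ennreal (\<bar>c\<bar>^DIM(real^'n)) * H x \<partial>distr lborel borel (\<lambda>y. (1 / r) *\<^sub>R z + c *\<^sub>R y))"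
      by (rule nn_integral_density) auto
    also have "\<dots> = (\<integral>\<^sup>+y. ennreal (\<bar>c\<bar>^DIM(real^'n)) * H ((1 / r) *\<^sub>R z + c *\<^sub>R y) \<partial>lborel)"
      by (rule nn_integral_distr) auto
    finally show ?thesis by (simp only: H_def sc)
  qed
  also have "\<dots> \<le> (\<integral>\<^sup>+y. \<bar>c\<bar>^DIM(real^'n) * (h (\<rho> *\<^sub>R y + z) * indicator (cball 0 1) y) \<partial>lborel)"
  proof (rule nn_integral_mono, intro mult_left_mono)
    fix y :: "real^'n"
    have "y \<in> cball 0 1" if "(1 / r) *\<^sub>R z + c *\<^sub>R y \<in> cball 0 1"
    proof -
      have "norm (r *\<^sub>R ((1 / r) *\<^sub>R z + c *\<^sub>R y)) \<le> r * 1"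
        unfolding norm_scaleR using that r by (intro mult_mono) auto
      then have "norm (\<rho> *\<^sub>R y + z) \<le> r" unfolding sc by simp
      then have "norm (\<rho> *\<^sub>R y) \<le> r + norm z" using norm_triangle_ineq4[of "\<rho> *\<^sub>R y + z" z] by simp
      then have "\<rho> * norm y \<le> \<rho> * 1" using \<rho>_pos by (simp add: \<rho>)
      then show ?thesis using \<rho>_pos by simp
    qed
    then show "(indicator (cball 0 1) ((1 / r) *\<^sub>R z + c *\<^sub>R y) :: ennreal) \<le> indicator (cball 0 1) y"
      by (auto simp: indicator_def)
  qed auto
  also have "\<dots> = ennreal (\<bar>c\<bar>^DIM(real^'n)) * (\<integral>\<^sup>+y. h (\<rho> *\<^sub>R y + z) * indicator (cball 0 1) y \<partial>lborel)"
    by (rule nn_integral_cmult) (intro borel_measurable_times_ennreal borel_measurable_indicator, auto)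
  also have "\<dots> < \<infinity>" using fin by (simp add: ennreal_mult_less_top)
  finally show ?thesis .
qed

lemma ereal_integral_ne_minus_infinity_iff:
  assumes "ereal_integral M f < \<infinity>"
  shows "ereal_integral M f \<noteq> -\<infinity> \<longleftrightarrow> (\<integral>\<^sup>+x. e2ennreal (- f x) \<partial>M) < \<infinity>"
  using assms unfolding ereal_integral_def
  by (cases "\<integral>\<^sup>+x. e2ennreal (f x) \<partial>M"; cases "\<integral>\<^sup>+x. e2ennreal (- f x) \<partial>M")
     (auto simp: enn2ereal_ennreal)

context st_cone
begin

lemma subsolution_borel_measurable_on_cball:
  assumes u: "subsolution F X u" and r: "0 < r" "cball 0 r \<subseteq> X"
  shows "(\<lambda>x. e2ennreal (- u x) * indicator (cball 0 r) x) \<in> borel_measurable borel"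
proof -
  obtain w a \<rho> where w: "\<And>N. global_subsolution F \<rho> (a N) (real N) (w N)"
    "\<And>N x. norm x \<le> r \<Longrightarrow> w (Suc N) x \<le> w N x" "\<And>N x. norm x \<le> r \<Longrightarrow> u x \<le> ereal (w N x)"
    "\<And>x. norm x \<le> r \<Longrightarrow> (\<lambda>N. ereal (w N x)) \<longlonglongrightarrow> u x"
    by (rule decreasing_truncations[OF u r]) blast
  have [measurable]: "w N \<in> borel_measurable borel" for N
    using locally_bounded_borel_global_subsolution[OF w(1)] by (simp add: locally_bounded_borel_def)
  show ?thesis
  proof (rule borel_measurable_LIMSEQ_order)
    show "(\<lambda>N. ennreal (- w N x) * indicator (cball 0 r) x) \<longlonglongrightarrow> e2ennreal (- u x) * indicator (cball 0 r) x" for x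
    proof (cases "norm x \<le> r")
      case True
      then show ?thesis using tendsto_e2ennrealI[OF tendsto_uminus_ereal[OF w(4)[OF True]]] by simp
    qed simp
    show "(\<lambda>x. ennreal (- w N x) * indicator (cball 0 r) x) \<in> borel_measurable borel" for N
      by (intro borel_measurable_times_ennreal borel_measurable_indicator) auto
  qed
qed

text \<open>There are points \<open>z\<close> arbitrarily close to the origin with \<open>u z > -\<infinity>\<close>. The sub-mean value inequality at
  such a \<open>z\<close> makes \<open>u\<close> integrable on a ball about \<open>z\<close> that contains the given one.\<close>

lemma ball_mean_finite:
  assumes u: "subharmonic F X u" and r: "0 < r" "cball 0 r \<subseteq> X"
  shows "ereal_integral ball_measure (\<lambda>y. u (r *\<^sub>R y)) \<noteq> -\<infinity>"
proof -
  have us: "subsolution F X u" by (rule subharmonic_imp_subsolution[OF u])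
  obtain R where R: "r < R" "cball 0 R \<subseteq> X"
    using cball_subset_open_enlarge[OF subsolutionD(1)[OF us] r(2)] r(1) by auto
  have sub: "cball 0 ((R - r) / 2) \<subseteq> X" using R r by (auto simp: subset_eq)
  obtain z where z: "norm z \<le> (R - r) / 2" "u z \<noteq> -\<infinity>"
    using not_minus_infinity_near_0[OF u sub] R(1) by auto
  have "z \<in> X" using z sub by auto
  then obtain c where c: "u z = ereal c" using subsolutionD(2)[OF us, of z] z(2) by (cases "u z") auto
  define \<rho> where "\<rho> = r + norm z"
  have \<rho>: "0 < \<rho>" unfolding \<rho>_def using r(1) by (intro add_pos_nonneg) auto
  have \<rho>R: "\<rho> *\<^sub>R y + z \<in> cball 0 R" if "y \<in> cball 0 1" for y
  proof -
    have "norm (\<rho> *\<^sub>R y) \<le> \<rho> * 1" unfolding norm_scaleR using that \<rho> by (intro mult_mono) auto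
    then show ?thesis using norm_triangle_ineq[of "\<rho> *\<^sub>R y" z] z(1) by (simp add: \<rho>_def)
  qed
  have cb: "cball 0 \<rho> \<subseteq> (\<lambda>x. x - z) ` X"
  proof
    fix x :: "real^'n" assume x: "x \<in> cball 0 \<rho>"
    have "norm (x + z) \<le> R" using x norm_triangle_ineq[of x z] z(1) by (simp add: \<rho>_def)
    then have "x + z \<in> X" using R(2) by auto
    then show "x \<in> (\<lambda>x. x - z) ` X" by (auto intro!: image_eqI[of _ _ "x + z"])
  qed
  note v = subsolution_translate[OF us, of z]
  have "ereal (c * measure ball_measure (space (ball_measure :: (real^'n) measure))) \<le> ereal_integral ball_measure (\<lambda>y. u (\<rho> *\<^sub>R y + z))"
    by (rule value_at_0_le_ereal_mean[OF v \<rho> cb rotation_measure_ball]) (simp add: c)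
  then have "ereal_integral ball_measure (\<lambda>y. u (\<rho> *\<^sub>R y + z)) \<noteq> -\<infinity>" by auto
  then have fin: "(\<integral>\<^sup>+y. e2ennreal (- u (\<rho> *\<^sub>R y + z)) \<partial>ball_measure) < \<infinity>"
    using ereal_integral_ne_minus_infinity_iff[OF ereal_mean_less_infinity[OF v \<rho> cb rotation_measure_ball]] by simp
  define h where "h x = e2ennreal (- u x) * indicator (cball 0 R) x" for x
  have h: "h \<in> borel_measurable borel"
    unfolding h_def using r R by (intro subsolution_borel_measurable_on_cball[OF us]) auto
  have B: "cball (0::real^'n) 1 \<inter> space lborel \<in> sets lborel" by simp
  have "(\<integral>\<^sup>+y. e2ennreal (- u (\<rho> *\<^sub>R y + z)) \<partial>ball_measure) = (\<integral>\<^sup>+y. h (\<rho> *\<^sub>R y + z) * indicator (cball 0 1) y \<partial>lborel)"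
    unfolding nn_integral_restrict_space[OF B]
    by (rule nn_integral_cong) (use \<rho>R in \<open>auto simp: h_def indicator_def\<close>)
  with fin have "(\<integral>\<^sup>+y. h (\<rho> *\<^sub>R y + z) * indicator (cball 0 1) y \<partial>lborel) < \<infinity>" by simp
  from nn_integral_ball_recentre[OF h r(1) \<rho>_def this]
  have "(\<integral>\<^sup>+x. h (r *\<^sub>R x) * indicator (cball 0 1) x \<partial>lborel) < \<infinity>" .
  also have "(\<integral>\<^sup>+x. h (r *\<^sub>R x) * indicator (cball 0 1) x \<partial>lborel) = (\<integral>\<^sup>+y. e2ennreal (- u (r *\<^sub>R y)) \<partial>ball_measure)"
    unfolding nn_integral_restrict_space[OF B]
  proof (rule nn_integral_cong)
    fix x :: "real^'n"
    have "norm (r *\<^sub>R x) \<le> R" if "norm x \<le> 1"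
    proof -
      have "norm (r *\<^sub>R x) \<le> r * 1" unfolding norm_scaleR using that r(1) by (intro mult_mono) auto
      then show ?thesis using R(1) by simp
    qed
    then show "h (r *\<^sub>R x) * indicator (cball 0 1) x = e2ennreal (- u (r *\<^sub>R x)) * indicator (cball 0 1) x"
      by (auto simp: h_def indicator_def)
  qed
  finally show ?thesis
    using ereal_integral_ne_minus_infinity_iff[OF ereal_mean_less_infinity[OF us r rotation_measure_ball]] by simp
qed

text \<open>The normalised mean over the ball bounds that over the sphere from below.\<close>

lemma sphere_mean_finite:
  assumes u: "subharmonic F X u" and r: "0 < r" "cball 0 r \<subseteq> X"
  shows "ereal_integral sphere_measure (\<lambda>y. u (r *\<^sub>R y)) \<noteq> -\<infinity>"
proof -
  have us: "subsolution F X u" by (rule subharmonic_imp_subsolution[OF u])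
  obtain c where c: "ereal_integral ball_measure (\<lambda>y. u (r *\<^sub>R y)) = ereal c"
    using ball_mean_finite[OF assms] ereal_mean_less_infinity[OF us r rotation_measure_ball]
    by (cases "ereal_integral ball_measure (\<lambda>y. u (r *\<^sub>R y))") auto
  have "ereal (c * measure sphere_measure (space (sphere_measure :: (real^'n) measure)) / measure ball_measure (space (ball_measure :: (real^'n) measure)))
     \<le> ereal_integral sphere_measure (\<lambda>y. u (r *\<^sub>R y))"
    by (rule ereal_mean_mono_norm[OF us r rotation_measure_ball rotation_measure_sphere _ measure_ball_pos])
       (auto simp: space_restrict_space space_sphere_measure c)
  then show ?thesis by auto
qed

end

section \<open>The monotonicity theorem\<close>

lemma proj_line_rotate: "g ** proj_line e ** transpose g = proj_line (g *v e)"
  by (simp add: proj_line_def matrix_matrix_mult_def matrix_vector_mult_def transpose_def vec_eq_iff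
      sum_distrib_left sum_distrib_right mult_ac)

text \<open>Conjugation by an element of the group that moves \<open>e'\<close> to \<open>e\<close> carries the matrices
  \<open>P\<^sub>\<bottom> - (q - 1) P\<^sub>e\<close> at \<open>e'\<close> to those at \<open>e\<close>.\<close>

lemma riesz_cone_of_characteristic:
  fixes F :: "(real^'n^'n) set"
  assumes F: "cone_subequation F" and ST: "ST_invariant F" and e: "norm e = 1"
    and p: "riesz_characteristic F e = ereal p"
  shows "riesz_cone F p"
proof
  obtain G where G: "orthogonal_subgroup G" and trans: "\<And>x y. norm x = 1 \<Longrightarrow> norm y = 1 \<Longrightarrow> \<exists>g\<in>G. g *v x = y"
    and inv: "\<And>g A. g \<in> G \<Longrightarrow> A \<in> F \<Longrightarrow> g ** A ** transpose g \<in> F"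
    using ST unfolding ST_invariant_def by auto
  have le_p: "q \<le> p" if "proj_perp e - (q - 1) *\<^sub>R proj_line e \<in> F" for q
  proof -
    have "ereal q \<le> riesz_characteristic F e"
      unfolding riesz_characteristic_def using that by (intro Sup_upper) auto
    then show ?thesis by (simp add: p)
  qed
  show "cone_subequation F" by (rule F)
  show "1 \<le> p"
  proof (rule le_p)
    from F obtain A where A: "A \<in> F" unfolding cone_subequation_def subequation_def by auto
    have "0 *\<^sub>R A \<in> F" using F A unfolding cone_subequation_def by blast
    then have "0 + proj_perp e \<in> F"
      using F psd_proj_perp[OF e] unfolding cone_subequation_def subequation_def by auto
    then show "proj_perp e - (1 - 1) *\<^sub>R proj_line e \<in> F" by simp
  qed
  fix e' :: "real^'n" and q assume e': "norm e' = 1" and q: "p < q"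
  show "proj_perp e' - (q - 1) *\<^sub>R proj_line e' \<notin> F"
  proof
    assume in_F: "proj_perp e' - (q - 1) *\<^sub>R proj_line e' \<in> F"
    obtain g where g: "g \<in> G" "g *v e' = e" using trans[OF e' e] by blast
    have "g ** transpose g = mat 1" using G g(1) by (auto simp: orthogonal_subgroup_def orthogonal_matrix_def)
    moreover have "proj_perp e' - (q - 1) *\<^sub>R proj_line e' = mat 1 - q *\<^sub>R proj_line e'"
      by (simp add: proj_perp_def algebra_simps)
    moreover have "proj_perp e - (q - 1) *\<^sub>R proj_line e = mat 1 - q *\<^sub>R proj_line e"
      by (simp add: proj_perp_def algebra_simps)
    moreover have "g ** (mat 1 - q *\<^sub>R proj_line e') ** transpose g = g ** transpose g - q *\<^sub>R (g ** proj_line e' ** transpose g)"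
    proof -
      have "g ** (A - q *\<^sub>R B) ** C = g ** A ** C - q *\<^sub>R (g ** B ** C)" for A B C :: "real^'n^'n"
        by (simp add: matrix_matrix_mult_def vec_eq_iff sum_subtractf sum_distrib_left sum_distrib_right algebra_simps)
      then show ?thesis by simp
    qed
    ultimately have "proj_perp e - (q - 1) *\<^sub>R proj_line e \<in> F"
      using inv[OF g(1) in_F] by (simp add: proj_line_rotate g(2))
    from le_p[OF this] q show False by simp
  qed
qed

theorem theorem1p4:
  fixes F :: "(real^'n^'n) set" and X :: "(real^'n) set" and u :: "real^'n \<Rightarrow> ereal"
    and e :: "real^'n" and p :: real
  assumes "CARD('n) \<ge> 2"
    and "cone_subequation F" and "ST_invariant F"
    and "norm e = 1" and "riesz_characteristic F e = ereal p"
    and "0 \<in> X" and "subharmonic F X u"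
  shows "increasing_diff_quotients {r. 0 < r \<and> cball 0 r \<subseteq> X} (max_ball u) (riesz_kernel p) \<and>
    (convex F \<longrightarrow>
      increasing_diff_quotients {r. 0 < r \<and> cball 0 r \<subseteq> X} (mean_sphere u) (riesz_kernel p) \<and>
      increasing_diff_quotients {r. 0 < r \<and> cball 0 r \<subseteq> X} (mean_ball u) (riesz_kernel p))"
proof (intro conjI impI)
  interpret riesz_cone F p by (rule riesz_cone_of_characteristic[OF assms(2-5)])
  note sub = subharmonic_imp_subsolution[OF assms(7)]
  obtain f where f: "\<And>r. 0 < r \<Longrightarrow> cball 0 r \<subseteq> X \<Longrightarrow> max_ball u r = ereal (f r)"
    "\<And>s t r. 0 < s \<Longrightarrow> s < t \<Longrightarrow> t < r \<Longrightarrow> cball 0 r \<subseteq> X \<Longrightarrow>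
        f t \<le> f s + (f r - f s) * ((riesz_kernel p t - riesz_kernel p s) / (riesz_kernel p r - riesz_kernel p s))"
    using max_ball_convex[OF assms(7)] by metis
  show "increasing_diff_quotients {r. 0 < r \<and> cball 0 r \<subseteq> X} (max_ball u) (riesz_kernel p)"
    by (rule increasing_diff_quotients_if_convex[where f = f]) (use f in \<open>auto intro: riesz_kernel_strict_mono\<close>)
  assume convex: "convex F"
  obtain G where G: "orthogonal_subgroup G" and trans: "\<And>x y. norm x = 1 \<Longrightarrow> norm y = 1 \<Longrightarrow> \<exists>g\<in>G. g *v x = y"
    and inv: "\<And>g A. g \<in> G \<Longrightarrow> A \<in> F \<Longrightarrow> g ** A ** transpose g \<in> F"
    using assms(3) unfolding ST_invariant_def by auto
  interpret st_cone F p G by unfold_locales (use convex G trans inv in auto)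
  show "increasing_diff_quotients {r. 0 < r \<and> cball 0 r \<subseteq> X} (mean_sphere u) (riesz_kernel p)"
    unfolding mean_sphere_def[abs_def]
    by (rule increasing_diff_quotients_mean[OF sub rotation_measure_sphere measure_sphere_pos sphere_mean_finite[OF assms(7)]])
  show "increasing_diff_quotients {r. 0 < r \<and> cball 0 r \<subseteq> X} (mean_ball u) (riesz_kernel p)"
    unfolding mean_ball_def[abs_def]
    by (rule increasing_diff_quotients_mean[OF sub rotation_measure_ball measure_ball_pos ball_mean_finite[OF assms(7)]])
qed

end
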